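(* Let $\mathbf{K}$ be a subfield of $\mathbf{C}$, and let $f$ and $g$ be loxodromic polynomial automorphisms of the affine plane $\mathbb{A}^2$ defined over $\mathbf{K}$. Let $\varphi\colon \mathbf{C}^2\to\mathbf{C}^2$ be a biholomorphism that conjugates $f$ to $g$, i.e. $\varphi\circ f\circ\varphi^{-1}=g$. Then $\varphi$ is a polynomial automorphism of $\mathbf{C}^2$, and it is defined over a finite extension of $\mathbf{K}$. Moreover, there exists $\psi\in \mathsf{Aut}(\mathbb{A}^2_{\overline{\mathbf{K}}})$ such that $\psi\circ f=g\circ\psi$ and $\deg(\psi)\leq 2^{57}(\deg(f)\deg(g))^{29}$.
   Context: For a field $\mathbf{K}$, $\mathsf{Aut}(\mathbb{A}^2_{\mathbf{K}})$ is the group of polynomial automorphisms of the affine plane over $\mathbf{K}$: maps $(x,y)\mapsto (f_1(x,y),f_2(x,y))$ with $f_1,f_2\in\mathbf{K}[x,y]$ having an inverse of the same form. The degree $\deg(f)$ is the degree of the formulas defining $f$, that is $\max(\deg f_1,\deg f_2)$. The dynamical degree is $\lambda_1(f)=\lim_{n\to+\infty}\deg(f^n)^{1/n}$. An automorphism $f$ is called loxodromic if $\lambda_1(f)>1$. Here $\overline{\mathbf{K}}$ denotes the algebraic closure of $\mathbf{K}$ (in $\mathbf{C}$). A polynomial automorphism is defined over a field $\mathbf{L}\subset \mathbf{C}$ if its coordinate polynomials have coefficients in $\mathbf{L}$. *)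

theory Defs
  imports
    "HOL-Analysis.Analysis"
    "HOL-Algebra.Algebraic_Closure_Type"
begin

text \<open>
  These notations clash with the inverse of a function and with vector components.
\<close>

unbundle no m_inv_syntax
unbundle no Formal_Power_Series.fps_syntax

section \<open>Subfields of the complex numbers\<close>

abbreviation complex_ring :: "complex ring" where
  "complex_ring \<equiv> ring_of_type_algebra"

definition finite_extension :: "complex set \<Rightarrow> complex set \<Rightarrow> bool" where
  "finite_extension K L \<longleftrightarrow>
     subfield L complex_ring \<and> K \<subseteq> L \<and> ring.finite_dimension complex_ring K L"

definition alg_closure_in_C :: "complex set \<Rightarrow> complex set" where
  "alg_closure_in_C K = {z. ring.algebraic complex_ring K z}"


section \<open>Polynomials in two variables\<close>

text \<open>
  An element of \<open>\<complex>[x,y]\<close> is represented as an element of \<open>\<complex>[x][y]\<close>: the coefficient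
  of \<open>x\<^sup>i y\<^sup>j\<close> in \<open>P\<close> is \<open>coeff (coeff P j) i\<close>.
\<close>

definition bieval :: "complex poly poly \<Rightarrow> complex ^ 2 \<Rightarrow> complex" where
  "bieval P v = poly (poly P [:v $ 2:]) (v $ 1)"

definition total_degree :: "complex poly poly \<Rightarrow> nat" where
  "total_degree P =
     Max (insert 0 {i + j | i j. Polynomial.coeff (Polynomial.coeff P j) i \<noteq> 0})"

definition bipoly_over :: "complex set \<Rightarrow> complex poly poly set" where
  "bipoly_over L = {P. \<forall>i j. Polynomial.coeff (Polynomial.coeff P j) i \<in> L}"


section \<open>Polynomial automorphisms of the affine plane\<close>

text \<open>
  Polynomial maps of the plane over a subfield \<open>L\<close> of \<open>\<complex>\<close> are identified with the self-maps
  of \<open>\<complex>\<^sup>2\<close> they induce. Nothing is lost: a polynomial over \<open>\<complex>\<close> is determined by its values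
  (see \<open>polymap_inject\<close> below).
\<close>

definition polymap :: "complex poly poly \<Rightarrow> complex poly poly \<Rightarrow> complex ^ 2 \<Rightarrow> complex ^ 2" where
  "polymap P Q v = vector [bieval P v, bieval Q v]"

definition defined_over :: "complex set \<Rightarrow> (complex ^ 2 \<Rightarrow> complex ^ 2) \<Rightarrow> bool" where
  "defined_over L F \<longleftrightarrow> (\<exists>P\<in>bipoly_over L. \<exists>Q\<in>bipoly_over L. F = polymap P Q)"

definition Aut_A2 :: "complex set \<Rightarrow> (complex ^ 2 \<Rightarrow> complex ^ 2) set" where
  "Aut_A2 L = {F. defined_over L F \<and> (\<exists>G. defined_over L G \<and> G \<circ> F = id \<and> F \<circ> G = id)}"

definition map_degree :: "(complex ^ 2 \<Rightarrow> complex ^ 2) \<Rightarrow> nat" where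
  "map_degree F = (THE d. \<exists>P Q. F = polymap P Q \<and> d = max (total_degree P) (total_degree Q))"

definition dynamical_degree :: "(complex ^ 2 \<Rightarrow> complex ^ 2) \<Rightarrow> real" where
  "dynamical_degree F = lim (\<lambda>n. root n (real (map_degree (F ^^ n))))"

definition loxodromic :: "(complex ^ 2 \<Rightarrow> complex ^ 2) \<Rightarrow> bool" where
  "loxodromic F \<longleftrightarrow> F \<in> Aut_A2 UNIV \<and> dynamical_degree F > 1"


section \<open>Biholomorphisms of the complex plane\<close>

definition holomorphic_C2 :: "(complex ^ 2 \<Rightarrow> complex ^ 2) \<Rightarrow> bool" where
  "holomorphic_C2 F \<longleftrightarrow>
     (\<forall>p. \<exists>D. (F has_derivative D) (at p) \<and> Vector_Spaces.linear (*s) (*s) D)"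

definition biholomorphism :: "(complex ^ 2 \<Rightarrow> complex ^ 2) \<Rightarrow> bool" where
  "biholomorphism F \<longleftrightarrow> bij F \<and> holomorphic_C2 F \<and> holomorphic_C2 (inv F)"


section \<open>Basic facts\<close>

lemma finite_bidegrees:
  "finite {i + j | i j. Polynomial.coeff (Polynomial.coeff P j) i \<noteq> 0}"
proof -
  have "{i + j | i j. Polynomial.coeff (Polynomial.coeff P j) i \<noteq> 0} \<subseteq>
        (\<Union>j\<in>{..Polynomial.degree P}. (\<lambda>i. i + j) ` {..Polynomial.degree (Polynomial.coeff P j)})"
  proof
    fix n assume "n \<in> {i + j | i j. Polynomial.coeff (Polynomial.coeff P j) i \<noteq> 0}"
    then obtain i j where n: "n = i + j" and c: "Polynomial.coeff (Polynomial.coeff P j) i \<noteq> 0"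
      by blast
    from c have "i \<le> Polynomial.degree (Polynomial.coeff P j)" by (rule le_degree)
    moreover from c have "j \<le> Polynomial.degree P" by (intro le_degree) auto
    ultimately show
      "n \<in> (\<Union>j\<in>{..Polynomial.degree P}. (\<lambda>i. i + j) ` {..Polynomial.degree (Polynomial.coeff P j)})"
      using n by blast
  qed
  thus ?thesis by (rule finite_subset) auto
qed

lemma bieval_inject: "bieval P = bieval Q \<longleftrightarrow> P = Q"
proof
  assume eq: "bieval P = bieval Q"
  have "poly P [:y:] = poly Q [:y:]" for y
  proof -
    have "poly (poly P [:y:]) x = poly (poly Q [:y:]) x" for x
      using fun_cong[OF eq, of "vector [x, y]"] by (simp add: bieval_def)
    thus ?thesis by (simp add: poly_eq_poly_eq_iff[symmetric] fun_eq_iff)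
  qed
  hence "range (\<lambda>y. [:y:]) \<subseteq> {p. poly (P - Q) p = 0}" by auto
  moreover have "infinite (range (\<lambda>y::complex. [:y:]))"
    by (simp add: finite_image_iff inj_on_def infinite_UNIV_char_0)
  ultimately have "infinite {p. poly (P - Q) p = 0}" by (rule infinite_super)
  thus "P = Q" using poly_roots_finite[of "P - Q"] by auto
qed auto

lemma polymap_inject: "polymap P Q = polymap P' Q' \<longleftrightarrow> P = P' \<and> Q = Q'"
proof
  assume eq: "polymap P Q = polymap P' Q'"
  have "bieval P v = bieval P' v" "bieval Q v = bieval Q' v" for v
    using arg_cong[OF fun_cong[OF eq, of v], of "\<lambda>w. w $ 1"]
          arg_cong[OF fun_cong[OF eq, of v], of "\<lambda>w. w $ 2"]
    by (simp_all add: polymap_def)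
  thus "P = P' \<and> Q = Q'" by (simp add: bieval_inject[symmetric] fun_eq_iff)
qed auto

lemma map_degree_polymap: "map_degree (polymap P Q) = max (total_degree P) (total_degree Q)"
  unfolding map_degree_def by (rule the_equality) (auto simp: polymap_inject)

end

theory Submission
  imports Defs "HOL-Complex_Analysis.Complex_Analysis"
begin

unbundle no m_inv_syntax
unbundle no Formal_Power_Series.fps_syntax

text \<open>
  By Jung's degree reduction, \<open>f\<close> and \<open>g\<close> are conjugate over \<open>K\<close> to regular automorphisms: the
  map and its inverse contract the line at infinity to two distinct points. So assume that
  \<open>f\<close> and \<open>g\<close> are regular.

  Let \<open>G\<close> be the escape rate of \<open>g\<close>. The function \<open>u = G \<circ> \<phi>\<close> is a positive limit of logarithms of
  absolute values of holomorphic functions on the escaping set of \<open>f\<close>, and \<open>u \<circ> f = deg g \<cdot> u\<close>.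
  Harnack's inequality, on horizontal discs and in the half plane of the variable \<open>log y\<close>, shows
  that \<open>u\<close> grows at most like \<open>log |z|\<close>. Hence \<open>\<phi>\<close> has polynomial growth and is polynomial.

  A polynomial conjugacy between regular maps must share its first triangular factor with \<open>g\<close> or
  with the inverse of \<open>g\<close>. Choosing \<open>\<phi>\<close> of minimal degree among its compositions with powers of
  \<open>g\<close>, one finds that \<open>\<phi>\<close> is a prefix of \<open>g\<close> or of its inverse, which is defined over \<open>K\<close> and
  has degree at most \<open>deg g\<close>, followed by an affine map. The affine map conjugates regular maps
  over \<open>K\<close>; in coordinates in which the two points at infinity are those of the axes, it is
  diagonal up to a translation, and comparing leading coefficients shows that its diagonal entries
  are roots of elements of \<open>K\<close>.
\<close>

section \<open>Subfields of the complex numbers\<close>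

text \<open>Near infinity nothing is known about \<phi>; only its continuity on bounded sets and the
  fact that it preserves bounded orbits are available. A positive harmonic function on a half plane
  grows at most linearly, and the variable is log y, so positivity alone turns a bound on one circle
  |y| = const into u(0, y) = O(log |y|). The functional equation carries this to every escaping
  point as u(z) \<le> A (deg f / deg g)^n (log |z| + C) for all large n. Letting n grow gives deg g
  \<le> deg f, and the inverse conjugacy gives equality. This bounds \<phi> where \<phi>(z) lies
  near the attracting point of g; the inverse maps give the bound near the other point.

  On the algebraic side, the degrees of non-affine F and G multiply in F o G as soon as the point at
  infinity of G differs from that of the inverse of F. A conjugation by a triangular map divides deg
  f by at least the degree of that map and multiplies the degree of the conjugator by at most the
  same number, so deg h deg f0 \<le> deg f. The proof ends with deg \<psi> \<le> deg f deg g, which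
  is below the stated bound.\<close>

definition cfield :: "complex set \<Rightarrow> bool" where
  "cfield K \<longleftrightarrow> 0 \<in> K \<and> 1 \<in> K \<and> (\<forall>a\<in>K. \<forall>b\<in>K. a + b \<in> K) \<and> (\<forall>a\<in>K. \<forall>b\<in>K. a * b \<in> K) \<and>
     (\<forall>a\<in>K. - a \<in> K) \<and> (\<forall>a\<in>K. inverse a \<in> K)"

lemma cfieldD:
  assumes "cfield K"
  shows cfield_0: "0 \<in> K" and cfield_1: "1 \<in> K"
    and cfield_add: "a \<in> K \<Longrightarrow> b \<in> K \<Longrightarrow> a + b \<in> K"
    and cfield_mult: "a \<in> K \<Longrightarrow> b \<in> K \<Longrightarrow> a * b \<in> K"
    and cfield_minus: "a \<in> K \<Longrightarrow> - a \<in> K"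
    and cfield_inverse: "a \<in> K \<Longrightarrow> inverse a \<in> K"
  using assms by (auto simp: cfield_def)

lemma cfield_diff: "cfield K \<Longrightarrow> a \<in> K \<Longrightarrow> b \<in> K \<Longrightarrow> a - b \<in> K"
  using cfield_add[of K a "- b"] cfield_minus[of K b] by simp

lemma cfield_divide: "cfield K \<Longrightarrow> a \<in> K \<Longrightarrow> b \<in> K \<Longrightarrow> a / b \<in> K"
  by (simp add: divide_inverse cfield_mult cfield_inverse)

lemma cfield_power: "cfield K \<Longrightarrow> a \<in> K \<Longrightarrow> a ^ n \<in> K"
  by (induction n) (auto intro: cfieldD)

lemma cfield_of_nat: "cfield K \<Longrightarrow> of_nat n \<in> K"
  by (induction n) (auto intro: cfieldD)

lemma cfield_sum: "cfield K \<Longrightarrow> (\<And>i. i \<in> A \<Longrightarrow> h i \<in> K) \<Longrightarrow> sum h A \<in> K"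
  by (induction A rule: infinite_finite_induct) (auto intro: cfieldD)

lemmas cfield_intros = cfield_0 cfield_1 cfield_add cfield_mult cfield_minus cfield_inverse
  cfield_diff cfield_divide cfield_power cfield_of_nat cfield_sum

text \<open>Statements over \<open>K\<close> thus contain their complex versions, at
  \<open>K = UNIV\<close>.\<close>

lemma cfield_UNIV: "cfield UNIV"
  by (simp add: cfield_def)

section \<open>Weighted leading forms\<close>

definition bicoeff :: "complex poly poly \<Rightarrow> nat \<Rightarrow> nat \<Rightarrow> complex" where
  "bicoeff P i j = Polynomial.coeff (Polynomial.coeff P j) i"

definition bimonom :: "complex \<Rightarrow> nat \<Rightarrow> nat \<Rightarrow> complex poly poly" where
  "bimonom c i j = Polynomial.monom (Polynomial.monom c i) j"

definition wle :: "nat \<Rightarrow> nat \<Rightarrow> nat \<Rightarrow> complex poly poly \<Rightarrow> bool" where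
  "wle n q W P \<longleftrightarrow> (\<forall>i j. bicoeff P i j \<noteq> 0 \<longrightarrow> n * i + q * j \<le> W)"

text \<open>The part of \<open>P\<close> of weight exactly \<open>W\<close>, for x of weight
  \<open>n\<close> and y of weight \<open>q\<close>, as a function of (a, b).\<close>

definition wtop :: "nat \<Rightarrow> nat \<Rightarrow> nat \<Rightarrow> complex poly poly \<Rightarrow> complex \<Rightarrow> complex \<Rightarrow> complex" where
  "wtop n q W P a b =
     (\<Sum>i\<le>W. \<Sum>j\<le>W. if n * i + q * j = W then bicoeff P i j * a ^ i * b ^ j else 0)"

text \<open>The homogeneous part of degree \<open>d\<close>. Here \<open>d\<close> is free and may
  exceed the degree of \<open>P\<close>, in which case the form is zero; this lets several
  polynomials share one \<open>d\<close>.\<close>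

definition hcf :: "nat \<Rightarrow> complex poly poly \<Rightarrow> complex ^ 2 \<Rightarrow> complex" where
  "hcf d P z = wtop 1 1 d P (z $ 1) (z $ 2)"

lemma bipoly_eqI: "(\<And>i j. bicoeff P i j = bicoeff Q i j) \<Longrightarrow> P = Q"
  by (simp add: bicoeff_def poly_eq_iff)

lemma bicoeff_simps [simp]:
  "bicoeff 0 i j = 0"
  "bicoeff (P + Q) i j = bicoeff P i j + bicoeff Q i j"
  "bicoeff (P - Q) i j = bicoeff P i j - bicoeff Q i j"
  "bicoeff (- P) i j = - bicoeff P i j"
  "bicoeff (sum F A) i j = (\<Sum>x\<in>A. bicoeff (F x) i j)"
  "bicoeff (bimonom c k l) i j = (if k = i \<and> l = j then c else 0)"
  by (auto simp: bicoeff_def bimonom_def coeff_sum coeff_monom)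

lemma bicoeff_mult:
  "bicoeff (P * Q) i j = (\<Sum>l\<le>j. \<Sum>k\<le>i. bicoeff P k l * bicoeff Q (i - k) (j - l))"
  by (simp add: bicoeff_def coeff_mult coeff_sum)

lemma bieval_simps [simp]:
  "bieval 0 z = 0" "bieval 1 z = 1"
  "bieval (P + Q) z = bieval P z + bieval Q z"
  "bieval (P - Q) z = bieval P z - bieval Q z"
  "bieval (- P) z = - bieval P z"
  "bieval (P * Q) z = bieval P z * bieval Q z"
  "bieval (P ^ n) z = bieval P z ^ n"
  "bieval (sum F A) z = (\<Sum>x\<in>A. bieval (F x) z)"
  "bieval (bimonom c i j) z = c * (z $ 1) ^ i * (z $ 2) ^ j"
  by (simp_all add: bieval_def poly_sum bimonom_def poly_monom poly_power poly_mult)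

lemma bicoeff_sum_bimonom:
  "bicoeff (\<Sum>k\<le>N. \<Sum>l\<le>N. bimonom (c k l) k l) i j = (if i \<le> N \<and> j \<le> N then c i j else 0)"
proof -
  have "(\<Sum>l\<le>N. if k = i \<and> l = j then c k l else 0) = (if k = i then if j \<le> N then c k j else 0 else 0)" for k
    by (cases "k = i") (auto simp: sum.delta)
  thus ?thesis by (simp add: sum.delta)
qed

lemma bipoly_as_sum:
  assumes "\<And>i j. bicoeff P i j \<noteq> 0 \<Longrightarrow> i \<le> N \<and> j \<le> N"
  shows "P = (\<Sum>i\<le>N. \<Sum>j\<le>N. bimonom (bicoeff P i j) i j)"
  by (rule bipoly_eqI) (simp only: bicoeff_sum_bimonom, use assms in auto)

lemma bieval_as_sum:
  assumes "\<And>i j. bicoeff P i j \<noteq> 0 \<Longrightarrow> i \<le> N \<and> j \<le> N"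
  shows "bieval P z = (\<Sum>i\<le>N. \<Sum>j\<le>N. bicoeff P i j * z $ 1 ^ i * z $ 2 ^ j)"
  using arg_cong[OF bipoly_as_sum[OF assms], where f = "\<lambda>R. bieval R z"]
  by (simp only: bieval_simps)

lemma finite_bisupport: "finite {(i, j). bicoeff P i j \<noteq> 0}"
proof -
  have "{(i, j). bicoeff P i j \<noteq> 0} \<subseteq>
      (\<Union>j\<in>{..Polynomial.degree P}. (\<lambda>i. (i, j)) ` {..Polynomial.degree (Polynomial.coeff P j)})"
  proof
    fix x assume "x \<in> {(i, j). bicoeff P i j \<noteq> 0}"
    then obtain i j where x: "x = (i, j)" and c: "Polynomial.coeff (Polynomial.coeff P j) i \<noteq> 0"
      by (auto simp: bicoeff_def)
    from c have "i \<le> Polynomial.degree (Polynomial.coeff P j)" by (rule le_degree)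
    moreover from c have "j \<le> Polynomial.degree P" by (intro le_degree) auto
    ultimately show "x \<in> (\<Union>j\<in>{..Polynomial.degree P}. (\<lambda>i. (i, j)) ` {..Polynomial.degree (Polynomial.coeff P j)})"
      using x by blast
  qed
  thus ?thesis by (rule finite_subset) auto
qed

lemma total_degree_le_iff: "total_degree P \<le> d \<longleftrightarrow> (\<forall>i j. bicoeff P i j \<noteq> 0 \<longrightarrow> i + j \<le> d)"
  using finite_bidegrees[of P] by (auto simp: total_degree_def bicoeff_def)

lemma total_degree_le_wle: "total_degree P \<le> d \<longleftrightarrow> wle 1 1 d P"
  by (simp add: total_degree_le_iff wle_def)

lemma total_degree_attained:
  assumes "P \<noteq> 0" obtains i j where "bicoeff P i j \<noteq> 0" "i + j = total_degree P"
proof -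
  let ?S = "{i + j | i j. Polynomial.coeff (Polynomial.coeff P j) i \<noteq> 0}"
  from assms obtain i j where "bicoeff P i j \<noteq> 0" using bipoly_eqI[of P 0] by auto
  hence ne: "?S \<noteq> {}" by (auto simp: bicoeff_def)
  hence "total_degree P = Max ?S" using finite_bidegrees[of P] by (simp add: total_degree_def)
  hence "total_degree P \<in> ?S" using Max_in[OF finite_bidegrees ne] by simp
  thus ?thesis using that by (auto simp: bicoeff_def)
qed

lemma wle_bound:
  assumes "wle n q W P" "n \<ge> 1" "q \<ge> 1" "bicoeff P i j \<noteq> 0"
  shows "i \<le> W \<and> j \<le> W"
proof -
  have "n * i + q * j \<le> W" using assms by (auto simp: wle_def)
  moreover have "i \<le> n * i" "j \<le> q * j" using assms by auto
  ultimately show ?thesis by linarith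
qed

lemma bieval_vector_as_sum:
  assumes "wle n q W P" "n \<ge> 1" "q \<ge> 1"
  shows "bieval P (vector [u, v]) = (\<Sum>i\<le>W. \<Sum>j\<le>W. bicoeff P i j * u ^ i * v ^ j)"
  using bieval_as_sum[OF wle_bound[OF assms]] by simp

text \<open>Leading forms are handled as limits, so that their uniqueness and their behaviour under
  products and composition come from the limit rules. Since \<open>u\<close> and \<open>v\<close>
  are arbitrary functions of the given growth, they may themselves be values of polynomials.\<close>

lemma weighted_limit:
  fixes S u v :: "'a \<Rightarrow> complex"
  assumes W: "wle n q W P" and nq: "n \<ge> 1" "q \<ge> 1"
    and S: "filterlim S at_infinity F"
    and u: "((\<lambda>t. u t / S t ^ n) \<longlongrightarrow> a) F" and v: "((\<lambda>t. v t / S t ^ q) \<longlongrightarrow> b) F"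
  shows "((\<lambda>t. bieval P (vector [u t, v t]) / S t ^ W) \<longlongrightarrow> wtop n q W P a b) F"
proof -
  have nz: "eventually (\<lambda>t. S t \<noteq> 0) F"
    using filterlim_at_infinity_imp_eventually_ne[OF S] .
  have inv0: "((\<lambda>t. inverse (S t)) \<longlongrightarrow> 0) F"
    using S by (metis filterlim_compose tendsto_inverse_0)
  have trm: "((\<lambda>t. bicoeff P i j * u t ^ i * v t ^ j / S t ^ W) \<longlongrightarrow>
      (if n * i + q * j = W then bicoeff P i j * a ^ i * b ^ j else 0)) F" for i j
  proof (cases "bicoeff P i j = 0")
    case False
    hence le: "n * i + q * j \<le> W" using W by (auto simp: wle_def)
    define k where "k = W - (n * i + q * j)"
    have Wk: "W = n * i + q * j + k" using le by (simp add: k_def)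
    have "((\<lambda>t. bicoeff P i j * (u t / S t ^ n) ^ i * (v t / S t ^ q) ^ j * inverse (S t) ^ k)
        \<longlongrightarrow> bicoeff P i j * a ^ i * b ^ j * 0 ^ k) F"
      by (intro tendsto_intros u v inv0)
    moreover have "eventually (\<lambda>t. bicoeff P i j * (u t / S t ^ n) ^ i * (v t / S t ^ q) ^ j * inverse (S t) ^ k
        = bicoeff P i j * u t ^ i * v t ^ j / S t ^ W) F"
      using nz
    proof eventually_elim
      case (elim t)
      have "(S t ^ n) ^ i = S t ^ (n * i)" "(S t ^ q) ^ j = S t ^ (q * j)" by (simp_all add: power_mult)
      thus ?case using elim by (simp add: Wk power_add power_divide power_inverse divide_inverse power_mult_distrib)
    qed
    ultimately have "((\<lambda>t. bicoeff P i j * u t ^ i * v t ^ j / S t ^ W)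
        \<longlongrightarrow> bicoeff P i j * a ^ i * b ^ j * 0 ^ k) F"
      by (rule Lim_transform_eventually)
    \<comment> \<open>The factor \<open>0 ^ k\<close> is 1 for \<open>k = 0\<close>, that is for the
      monomials of full weight, and 0 otherwise.\<close>
    moreover have "bicoeff P i j * a ^ i * b ^ j * 0 ^ k =
       (if n * i + q * j = W then bicoeff P i j * a ^ i * b ^ j else 0)"
      using Wk by (cases k) auto
    ultimately show ?thesis by simp
  qed auto
  have "((\<lambda>t. \<Sum>i\<le>W. \<Sum>j\<le>W. bicoeff P i j * u t ^ i * v t ^ j / S t ^ W) \<longlongrightarrow> wtop n q W P a b) F"
    unfolding wtop_def by (intro tendsto_sum trm)
  thus ?thesis
    by (simp add: bieval_vector_as_sum[OF W nq] sum_divide_distrib)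
qed

lemma vector_2_eta: "vector [z $ 1, z $ 2] = (z :: complex ^ 2)"
  by (simp add: vec_eq_iff forall_2)

text \<open>The point \<open>w\<close> is allowed to move, because in a composition the inner map
  supplies a direction that only converges.\<close>

lemma hcf_limit:
  fixes S :: "'a \<Rightarrow> complex" and w :: "'a \<Rightarrow> complex ^ 2"
  assumes d: "total_degree P \<le> d" and S: "filterlim S at_infinity F" and w: "(w \<longlongrightarrow> w0) F"
  shows "((\<lambda>t. bieval P (S t *s w t) / S t ^ d) \<longlongrightarrow> hcf d P w0) F"
proof -
  have nz: "eventually (\<lambda>t. S t \<noteq> 0) F"
    using filterlim_at_infinity_imp_eventually_ne[OF S] .
  have *: "((\<lambda>t. (S t *s w t) $ i / S t ^ 1) \<longlongrightarrow> w0 $ i) F" for i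
  proof (rule Lim_transform_eventually)
    show "((\<lambda>t. w t $ i) \<longlongrightarrow> w0 $ i) F" by (intro tendsto_intros w)
    show "eventually (\<lambda>t. w t $ i = (S t *s w t) $ i / S t ^ 1) F"
      using nz by eventually_elim simp
  qed
  show ?thesis
    using weighted_limit[of 1 1 d P S F "\<lambda>t. (S t *s w t) $ 1" "w0 $ 1" "\<lambda>t. (S t *s w t) $ 2" "w0 $ 2"]
      d S *[of 1] *[of 2]
    unfolding hcf_def total_degree_le_wle by (simp only: vector_2_eta)
qed

lemma hcf_limit_line:
  assumes "total_degree P \<le> d"
  shows "((\<lambda>t. bieval P (t *s z) / t ^ d) \<longlongrightarrow> hcf d P z) at_infinity"
  using hcf_limit[OF assms filterlim_ident tendsto_const] .

lemma wtop_bipoly: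
  obtains H where "\<And>z. bieval H z = wtop n q W P (z $ 1) (z $ 2)"
    "\<And>i j. n \<ge> 1 \<Longrightarrow> q \<ge> 1 \<Longrightarrow> bicoeff H i j = (if n * i + q * j = W then bicoeff P i j else 0)"
proof
  let ?H = "\<Sum>k\<le>W. \<Sum>l\<le>W. bimonom (if n * k + q * l = W then bicoeff P k l else 0) k l"
  show "bieval ?H z = wtop n q W P (z $ 1) (z $ 2)" for z
    by (auto simp: wtop_def intro!: sum.cong)
  fix i j assume nq: "n \<ge> 1" "q \<ge> 1"
  have "i \<le> W \<and> j \<le> W" if "n * i + q * j = W"
  proof -
    have "i \<le> n * i" "j \<le> q * j" using nq by auto
    thus ?thesis using that by linarith
  qed
  thus "bicoeff ?H i j = (if n * i + q * j = W then bicoeff P i j else 0)"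
    by (simp only: bicoeff_sum_bimonom) auto
qed

lemma bieval_eq_0_iff: "(\<forall>z. bieval P z = 0) \<longleftrightarrow> P = 0"
  using bieval_inject[of P 0] by (auto simp: fun_eq_iff)

lemma hcf_bipoly:
  obtains H where "bieval H = hcf d P"
    "\<And>i j. bicoeff H i j = (if i + j = d then bicoeff P i j else 0)"
proof -
  obtain H where "\<And>z. bieval H z = wtop 1 1 d P (z $ 1) (z $ 2)"
    "\<And>i j. (1::nat) \<ge> 1 \<Longrightarrow> (1::nat) \<ge> 1 \<Longrightarrow> bicoeff H i j = (if 1 * i + 1 * j = d then bicoeff P i j else 0)"
    by (metis wtop_bipoly)
  thus ?thesis using that[of H] by (simp add: hcf_def fun_eq_iff)
qed

text \<open>The way to show that a degree drops. Degree 0 is excluded because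
  \<open>total_degree 0 = 0\<close>, so that a vanishing constant term cannot lower the
  degree.\<close>

lemma hcf_eq_0_iff:
  assumes "total_degree P \<le> d" "d \<ge> 1"
  shows "(\<forall>z. hcf d P z = 0) \<longleftrightarrow> total_degree P < d"
proof -
  obtain H where H: "bieval H = hcf d P"
    "\<And>i j. bicoeff H i j = (if i + j = d then bicoeff P i j else 0)"
    by (metis hcf_bipoly)
  have "(\<forall>z. hcf d P z = 0) \<longleftrightarrow> H = 0" by (simp flip: H(1) add: bieval_eq_0_iff)
  also have "\<dots> \<longleftrightarrow> (\<forall>i j. i + j = d \<longrightarrow> bicoeff P i j = 0)"
    using H(2) bipoly_eqI[of H 0] by (metis bicoeff_simps(1))
  also have "\<dots> \<longleftrightarrow> total_degree P \<le> d - 1"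
  proof
    assume *: "\<forall>i j. i + j = d \<longrightarrow> bicoeff P i j = 0"
    show "total_degree P \<le> d - 1"
      unfolding total_degree_le_iff
    proof (intro allI impI)
      fix i j assume "bicoeff P i j \<noteq> 0"
      hence "i + j \<le> d" "i + j \<noteq> d" using * assms(1) by (auto simp: total_degree_le_iff)
      thus "i + j \<le> d - 1" by linarith
    qed
  next
    assume "total_degree P \<le> d - 1"
    thus "\<forall>i j. i + j = d \<longrightarrow> bicoeff P i j = 0"
      using assms(2) unfolding total_degree_le_iff by fastforce
  qed
  finally show ?thesis using assms(2) by auto
qed

lemma hcf_nonzero:
  assumes "P \<noteq> 0" obtains z where "hcf (total_degree P) P z \<noteq> 0"
proof -
  obtain H where H: "bieval H = hcf (total_degree P) P"
    "\<And>i j. bicoeff H i j = (if i + j = (total_degree P) then bicoeff P i j else 0)"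
    by (metis hcf_bipoly)
  obtain i j where "bicoeff P i j \<noteq> 0" "i + j = total_degree P"
    using total_degree_attained[OF assms] .
  hence "bicoeff H i j \<noteq> 0" using H(2) by simp
  hence "H \<noteq> 0" by auto
  then obtain z where "bieval H z \<noteq> 0" using bieval_eq_0_iff by blast
  thus ?thesis using that H(1) by metis
qed

lemma total_degree_0 [simp]: "total_degree 0 = 0"
  using total_degree_le_iff[of 0 0] by simp

lemma total_degree_mult_le: "total_degree (P * Q) \<le> total_degree P + total_degree Q"
  unfolding total_degree_le_iff
proof (intro allI impI)
  fix i j assume "bicoeff (P * Q) i j \<noteq> 0"
  then obtain l where l: "l \<le> j" "(\<Sum>k\<le>i. bicoeff P k l * bicoeff Q (i - k) (j - l)) \<noteq> 0"
    unfolding bicoeff_mult by (meson atMost_iff sum.not_neutral_contains_not_neutral)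
  then obtain k where k: "k \<le> i" "bicoeff P k l * bicoeff Q (i - k) (j - l) \<noteq> 0"
    by (meson atMost_iff sum.not_neutral_contains_not_neutral)
  have "k + l \<le> total_degree P" "(i - k) + (j - l) \<le> total_degree Q"
    using k(2) total_degree_le_iff[of P "total_degree P"] total_degree_le_iff[of Q "total_degree Q"] by auto
  thus "i + j \<le> total_degree P + total_degree Q" using k(1) l(1) by linarith
qed

lemma hcf_mult:
  assumes "total_degree P \<le> a" "total_degree Q \<le> b"
  shows "hcf (a + b) (P * Q) z = hcf a P z * hcf b Q z"
proof (rule tendsto_unique)
  show "(at_infinity :: complex filter) \<noteq> bot" by (rule trivial_limit_at_infinity)
  have "total_degree (P * Q) \<le> a + b" using total_degree_mult_le[of P Q] assms by linarith
  thus "((\<lambda>t. bieval (P * Q) (t *s z) / t ^ (a + b)) \<longlongrightarrow> hcf (a + b) (P * Q) z) at_infinity"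
    by (rule hcf_limit_line)
  have "((\<lambda>t. (bieval P (t *s z) / t ^ a) * (bieval Q (t *s z) / t ^ b)) \<longlongrightarrow> hcf a P z * hcf b Q z) at_infinity"
    by (intro tendsto_mult hcf_limit_line assms)
  thus "((\<lambda>t. bieval (P * Q) (t *s z) / t ^ (a + b)) \<longlongrightarrow> hcf a P z * hcf b Q z) at_infinity"
    by (simp add: power_add)
qed

text \<open>Both forms are nonzero polynomials, so their product is nonzero and does not vanish at
  some point.\<close>

lemma hcf_mult_nonzero:
  assumes "P \<noteq> 0" "Q \<noteq> 0"
  obtains z where "hcf (total_degree P) P z \<noteq> 0" "hcf (total_degree Q) Q z \<noteq> 0"
proof -
  obtain H where H: "bieval H = hcf (total_degree P) P"
    by (rule hcf_bipoly[of "total_degree P" P]) blast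
  obtain H' where H': "bieval H' = hcf (total_degree Q) Q"
    by (rule hcf_bipoly[of "total_degree Q" Q]) blast
  have "H \<noteq> 0" "H' \<noteq> 0" using hcf_nonzero[OF assms(1)] hcf_nonzero[OF assms(2)] H H'
    by (metis bieval_simps(1))+
  hence "H * H' \<noteq> 0" by simp
  then obtain z where "bieval (H * H') z \<noteq> 0" using bieval_eq_0_iff by blast
  thus ?thesis using that[of z] H H' by auto
qed

lemma total_degree_mult:
  assumes "P \<noteq> 0" "Q \<noteq> 0" shows "total_degree (P * Q) = total_degree P + total_degree Q"
proof (rule antisym[OF total_degree_mult_le], rule ccontr)
  assume "\<not> total_degree P + total_degree Q \<le> total_degree (P * Q)"
  hence "\<forall>z. hcf (total_degree P + total_degree Q) (P * Q) z = 0"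
    using hcf_eq_0_iff[OF total_degree_mult_le[of P Q]] by auto
  moreover obtain z where "hcf (total_degree P) P z \<noteq> 0" "hcf (total_degree Q) Q z \<noteq> 0"
    using hcf_mult_nonzero[OF assms] .
  ultimately show False using hcf_mult[of P "total_degree P" Q "total_degree Q" z] by simp
qed

section \<open>The degree reduction behind Jung's theorem\<close>

text \<open>The derivative in x. The derivative in y is \<open>pderiv\<close> on the outer
  level.\<close>

definition bidx :: "complex poly poly \<Rightarrow> complex poly poly" where
  "bidx P = map_poly pderiv P"

lemma bicoeff_bidx: "bicoeff (bidx P) i j = of_nat (Suc i) * bicoeff P (Suc i) j"
  by (simp add: bidx_def bicoeff_def coeff_map_poly coeff_pderiv)

lemma bicoeff_bidy: "bicoeff (pderiv P) i j = of_nat (Suc j) * bicoeff P i (Suc j)"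
proof -
  have "Polynomial.coeff (of_nat m * (p :: complex poly)) i = of_nat m * Polynomial.coeff p i" for m p
    by (simp add: of_nat_poly)
  thus ?thesis by (simp add: bicoeff_def coeff_pderiv del: of_nat_Suc)
qed

lemma bidx_pCons: "bidx (pCons a P) = pCons (pderiv a) (bidx P)"
  by (simp add: bidx_def map_poly_pCons)

lemma bidx_0 [simp]: "bidx 0 = 0" by (simp add: bidx_def)

lemma bidx_add: "bidx (P + Q) = bidx P + bidx Q"
  by (rule bipoly_eqI) (simp add: bicoeff_bidx algebra_simps)

lemma bidx_smult: "bidx (Polynomial.smult a P) = Polynomial.smult (pderiv a) P + Polynomial.smult a (bidx P)"
  by (induction P) (auto simp: bidx_pCons pderiv_mult)

lemma bidx_mult: "bidx (P * Q) = bidx P * Q + P * bidx Q"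
  by (induction P) (auto simp: bidx_pCons bidx_add bidx_smult algebra_simps)

text \<open>The Jacobian determinant, read as an operator: for fixed \<open>P\<close> it is a
  derivation in \<open>R\<close> that kills \<open>P\<close>.\<close>

definition jac :: "complex poly poly \<Rightarrow> complex poly poly \<Rightarrow> complex poly poly" where
  "jac P R = bidx P * pderiv R - pderiv P * bidx R"

lemma jac_add: "jac P (Q + R) = jac P Q + jac P R"
  by (simp add: jac_def bidx_add pderiv_add algebra_simps)

lemma jac_mult: "jac P (Q * R) = jac P Q * R + Q * jac P R"
  by (simp add: jac_def bidx_mult pderiv_mult algebra_simps)

lemma jac_self [simp]: "jac P P = 0" by (simp add: jac_def)

lemma jac_const [simp]: "jac P [:[:c:]:] = 0"
  by (simp add: jac_def bidx_def map_poly_pCons pderiv_pCons)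

lemma total_degree_bidx: "total_degree P \<ge> 1 \<Longrightarrow> total_degree (bidx P) \<le> total_degree P - 1"
  using total_degree_le_iff[of P "total_degree P"]
  unfolding total_degree_le_iff[of "bidx P"] by (fastforce simp: bicoeff_bidx)

lemma total_degree_bidy: "total_degree P \<ge> 1 \<Longrightarrow> total_degree (pderiv P) \<le> total_degree P - 1"
  using total_degree_le_iff[of P "total_degree P"]
  unfolding total_degree_le_iff[of "pderiv P"] by (fastforce simp: bicoeff_bidy)

lemma bider_const: "total_degree P = 0 \<Longrightarrow> bidx P = 0 \<and> pderiv P = 0"
  using total_degree_le_iff[of P 0]
  by (auto intro!: bipoly_eqI simp: bicoeff_bidx bicoeff_bidy simp del: of_nat_Suc) (metis nat.distinct(1))+

lemma total_degree_diff_le: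
  "total_degree P \<le> d \<Longrightarrow> total_degree Q \<le> d \<Longrightarrow> total_degree (P - Q) \<le> d"
  unfolding total_degree_le_iff by (metis bicoeff_simps(3) diff_self)

text \<open>Each of the two derivatives lowers a degree by one. Constant \<open>R\<close> is treated
  apart because of truncated subtraction.\<close>

lemma total_degree_jac:
  assumes "total_degree P \<ge> 2"
  shows "total_degree (jac P R) \<le> total_degree R + (total_degree P - 2)"
proof (cases "total_degree R = 0")
  case True
  thus ?thesis using bider_const[of R] by (simp add: jac_def)
next
  case False
  have "total_degree (bidx P * pderiv R) \<le> (total_degree P - 1) + (total_degree R - 1)"
    "total_degree (pderiv P * bidx R) \<le> (total_degree P - 1) + (total_degree R - 1)"
    using total_degree_mult_le[of "bidx P" "pderiv R"] total_degree_mult_le[of "pderiv P" "bidx R"]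
      total_degree_bidx[of P] total_degree_bidy[of P] total_degree_bidx[of R] total_degree_bidy[of R]
      assms False by linarith+
  hence "total_degree (jac P R) \<le> (total_degree P - 1) + (total_degree R - 1)"
    unfolding jac_def by (rule total_degree_diff_le)
  thus ?thesis using assms False by linarith
qed

section \<open>Substitution and the chain rule for the Jacobian\<close>

definition unisubst :: "complex poly poly \<Rightarrow> complex poly \<Rightarrow> complex poly poly" where
  "unisubst P a = poly (map_poly (\<lambda>c. [:[:c:]:]) a) P"

text \<open>This is G(P, Q); as in \<open>unisubst\<close>, the polynomial that receives the
  substitution is the last argument.\<close>

definition bisubst :: "complex poly poly \<Rightarrow> complex poly poly \<Rightarrow> complex poly poly \<Rightarrow> complex poly poly" where
  "bisubst P Q G = poly (map_poly (unisubst P) G) Q"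

lemma unisubst_0 [simp]: "unisubst P 0 = 0" by (simp add: unisubst_def)

lemma unisubst_pCons: "unisubst P (pCons c a) = [:[:c:]:] + P * unisubst P a"
  by (simp add: unisubst_def map_poly_pCons)

lemma bisubst_0 [simp]: "bisubst P Q 0 = 0" by (simp add: bisubst_def)

lemma bisubst_pCons: "bisubst P Q (pCons a G) = unisubst P a + Q * bisubst P Q G"
  by (simp add: bisubst_def map_poly_pCons)

lemma bieval_const [simp]: "bieval [:[:c:]:] z = c" by (simp add: bieval_def)

lemma bieval_unisubst: "bieval (unisubst P a) z = poly a (bieval P z)"
  by (induction a) (auto simp: unisubst_pCons)

lemma bieval_bisubst: "bieval (bisubst P Q G) z = bieval G (polymap P Q z)"
proof (induction G)
  case (pCons a G)
  thus ?case by (simp add: bisubst_pCons bieval_unisubst) (simp add: bieval_def polymap_def)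
qed (simp add: bieval_def)

lemma bisubst_add: "bisubst P Q (G + H) = bisubst P Q G + bisubst P Q H"
  by (subst bieval_inject[symmetric]) (simp add: fun_eq_iff bieval_bisubst)

lemma jac_unisubst: "jac P (unisubst P a) = 0"
  by (induction a) (auto simp: unisubst_pCons jac_add jac_mult jac_def[of P 0])

text \<open>Chain rule: \<open>jac P\<close> kills \<open>P\<close>, so only the derivative of
  \<open>G\<close> in its second variable survives.\<close>

lemma jac_bisubst: "jac P (bisubst P Q G) = bisubst P Q (pderiv G) * jac P Q"
proof (induction G)
  case (pCons a G)
  have "bisubst P Q (pCons 0 (pderiv G)) = Q * bisubst P Q (pderiv G)"
    by (simp add: bisubst_pCons)
  thus ?case using pCons
    by (simp add: bisubst_pCons jac_add jac_mult jac_unisubst pderiv_pCons bisubst_add algebra_simps)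
qed (simp add: jac_def)

section \<open>Weighted leading forms under differentiation, and multiplicities of their
  roots\<close>

lemma wle_pderiv: "wle n q W G \<Longrightarrow> wle n q (W - q) (pderiv G)"
  unfolding wle_def by (fastforce simp: bicoeff_bidy)

text \<open>The leading form of weight \<open>W\<close> restricted to first variable
  \<open>a\<close>, as a polynomial in the second variable. In this form one can speak of the
  multiplicity of its roots.\<close>

definition wsec :: "nat \<Rightarrow> nat \<Rightarrow> nat \<Rightarrow> complex poly poly \<Rightarrow> complex \<Rightarrow> complex poly" where
  "wsec n q W G a = (\<Sum>i\<le>W. \<Sum>j\<le>W. if n * i + q * j = W then Polynomial.monom (bicoeff G i j * a ^ i) j else 0)"

lemma poly_wsec: "poly (wsec n q W G a) b = wtop n q W G a b"
  by (auto simp: wsec_def wtop_def poly_sum poly_monom intro!: sum.cong)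

lemma coeff_wsec:
  assumes "n \<ge> 1" "q \<ge> 1"
  shows "Polynomial.coeff (wsec n q W G a) j =
     (if q * j \<le> W \<and> n dvd (W - q * j) then bicoeff G ((W - q * j) div n) j * a ^ ((W - q * j) div n) else 0)"
proof -
  let ?i = "(W - q * j) div n"
  have eq: "n * i + q * j = W \<longleftrightarrow> q * j \<le> W \<and> n dvd (W - q * j) \<and> i = ?i" for i
    using assms by auto
  have jW: "j \<le> W" if "q * j \<le> W" using that assms(2) by (metis le_trans mult_le_mono1 mult_1)
  have iW: "?i \<le> W" using div_le_dividend[of "W - q * j" n] by linarith
  have "Polynomial.coeff (wsec n q W G a) j =
     (\<Sum>i\<le>W. \<Sum>j'\<le>W. if j' = j then if n * i + q * j' = W then bicoeff G i j' * a ^ i else 0 else 0)"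
    unfolding wsec_def coeff_sum by (intro sum.cong refl) auto
  also have "\<dots> = (\<Sum>i\<le>W. if j \<le> W then if n * i + q * j = W then bicoeff G i j * a ^ i else 0 else 0)"
    by (intro sum.cong refl) (simp add: sum.delta)
  also have "\<dots> = (\<Sum>i\<le>W. if i = ?i then if q * j \<le> W \<and> n dvd (W - q * j) then bicoeff G ?i j * a ^ ?i else 0 else 0)"
    by (intro sum.cong refl) (use jW in \<open>auto simp: eq\<close>)
  also have "\<dots> = (if q * j \<le> W \<and> n dvd (W - q * j) then bicoeff G ?i j * a ^ ?i else 0)"
    using iW by (simp add: sum.delta)
  finally show ?thesis .
qed

lemma pderiv_wsec:
  assumes "n \<ge> 1" "q \<ge> 1" "q \<le> W"
  shows "pderiv (wsec n q W G a) = wsec n q (W - q) (pderiv G) a"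
proof (rule poly_eqI)
  fix j
  have "W - q - q * j = W - q * Suc j" "q * j \<le> W - q \<longleftrightarrow> q * Suc j \<le> W"
    using assms(3) by (auto simp: algebra_simps)
  thus "Polynomial.coeff (pderiv (wsec n q W G a)) j = Polynomial.coeff (wsec n q (W - q) (pderiv G) a) j"
    by (simp only: coeff_pderiv coeff_wsec[OF assms(1,2)] bicoeff_bidy) auto
qed

lemma higher_pderiv_wsec:
  assumes "n \<ge> 1" "q \<ge> 1" "m * q \<le> W"
  shows "(pderiv ^^ m) (wsec n q W G a) = wsec n q (W - m * q) ((pderiv ^^ m) G) a"
  using assms(3)
proof (induction m)
  case (Suc m)
  have "q \<le> W - m * q" using Suc.prems by simp
  from pderiv_wsec[OF assms(1,2) this] Suc show ?case by (simp add: diff_diff_eq algebra_simps)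
qed simp

lemma wle_higher_pderiv: "wle n q W G \<Longrightarrow> wle n q (W - m * q) ((pderiv ^^ m) G)"
proof (induction m)
  case (Suc m)
  have "W - Suc m * q = W - m * q - q" by simp
  with wle_pderiv[OF Suc.IH[OF Suc.prems]] show ?case by simp
qed simp

text \<open>In characteristic 0 each derivative lowers the order of a root by exactly one.\<close>

lemma poly_higher_pderiv_order:
  fixes p :: "complex poly"
  assumes "p \<noteq> 0"
  shows "poly ((pderiv ^^ Polynomial.order b p) p) b \<noteq> 0"
  using assms
proof (induction "Polynomial.order b p" arbitrary: p)
  case 0
  thus ?case by (metis funpow_0 order_root)
next
  case (Suc m)
  hence r: "poly p b = 0" by (metis Zero_not_Suc order_root)
  hence ord: "Polynomial.order b p = Suc (Polynomial.order b (pderiv p))" using order_pderiv Suc.prems by blast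
  have "pderiv p \<noteq> 0"
  proof
    assume "pderiv p = 0"
    then obtain c where "p = [:c:]" using pderiv_iszero by blast
    thus False using r Suc.prems by simp
  qed
  hence "poly ((pderiv ^^ Polynomial.order b (pderiv p)) (pderiv p)) b \<noteq> 0"
    using Suc.hyps(1)[of "pderiv p"] Suc.hyps(2) ord by simp
  thus ?case by (simp add: ord funpow_swap1)
qed

text \<open>A polynomial whose exponents lie in one residue class modulo \<open>N\<close> is invariant, up to a
  scalar, under the substitution \<open>v \<mapsto> \<zeta>v\<close> for every \<open>N\<close>-th root of unity \<open>\<zeta>\<close>.\<close>

lemma order_times_le_degree:
  fixes p :: "complex poly"
  assumes p: "p \<noteq> 0" and b: "b \<noteq> 0" and N: "N \<ge> 1"
    and res: "\<And>i j. Polynomial.coeff p i \<noteq> 0 \<Longrightarrow> Polynomial.coeff p j \<noteq> 0 \<Longrightarrow> i mod N = j mod N"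
  shows "N * Polynomial.order b p \<le> Polynomial.degree p"
proof -
  define m where "m = Polynomial.order b p"
  define A where "A = {z. z ^ N = b ^ N}"
  have cardA: "card A = N" unfolding A_def using b N by (intro card_nth_roots) auto
  have finA: "finite A" using cardA N card.infinite by force
  have "m \<le> Polynomial.order c p" if c: "c \<in> A" for c
  proof -
    define z where "z = b / c"
    have c0: "c \<noteq> 0" using c b N by (auto simp: A_def power_0_left)
    have z: "z ^ N = 1" "z \<noteq> 0" using c c0 b by (auto simp: z_def A_def power_divide)
    define d where "d = Polynomial.degree p"
    have pw: "z ^ i = z ^ (i mod N)" for i
      by (metis z(1) mult_div_mod_eq power_add power_mult power_one mult_1)
    have "pcompose p [:0, z:] = Polynomial.smult (z ^ d) p"
    proof (rule poly_eqI)
      fix i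
      have "Polynomial.coeff p i \<noteq> 0 \<Longrightarrow> z ^ i = z ^ d"
        using res[of i d] pw[of i] pw[of d] p by (simp add: d_def)
      thus "Polynomial.coeff (pcompose p [:0, z:]) i = Polynomial.coeff (Polynomial.smult (z ^ d) p) i"
        by (auto simp: coeff_pcompose_linear)
    qed
    moreover obtain r where r: "p = [:- b, 1:] ^ m * r"
      using order_1[of b p] unfolding m_def by (auto simp: dvd_def)
    have "pcompose ([:- b, 1:] ^ m * r) [:0, z:] = [:- b, z:] ^ m * pcompose r [:0, z:]"
    proof -
      have "pcompose [:- b, 1:] [:0, z:] = [:- b, z:]" by (simp add: pcompose_pCons)
      moreover have "pcompose (s ^ k) t = pcompose s t ^ k" for s t :: "complex poly" and k
        by (induction k) (auto simp: pcompose_mult pcompose_1)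
      ultimately show ?thesis by (simp add: pcompose_mult)
    qed
    ultimately have "[:- b, z:] ^ m dvd Polynomial.smult (z ^ d) p" using r by (metis dvd_triv_left)
    hence "[:- b, z:] ^ m dvd p" using z(2) by (simp add: dvd_smult_iff)
    moreover have eq: "[:- b, z:] = Polynomial.smult z [:- c, 1:]" using c0 by (simp add: z_def)
    ultimately have "[:- c, 1:] ^ m dvd p"
      unfolding eq smult_power using z(2) by (metis power_not_zero smult_dvd_iff)
    thus ?thesis using p by (simp add: order_divides)
  qed
  hence "(\<Sum>c\<in>A. m) \<le> (\<Sum>c\<in>A. Polynomial.order c p)" by (intro sum_mono)
  also have "\<dots> = (\<Sum>c\<in>A. count (proots p) c)" using p by simp
  also have "\<dots> \<le> size (proots p)"
  proof -
    have "(\<Sum>c\<in>A. count (proots p) c) \<le> (\<Sum>c\<in>A \<union> set_mset (proots p). count (proots p) c)"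
      using finA by (intro sum_mono2) auto
    also have "\<dots> = size (proots p)"
      unfolding size_multiset_overloaded_eq using finA
      by (intro sum.mono_neutral_right) (auto simp: count_eq_zero_iff)
    finally show ?thesis .
  qed
  also have "\<dots> \<le> Polynomial.degree p" by (rule size_proots_le)
  finally show ?thesis by (simp add: cardA m_def)
qed

lemma const_if_bider_0:
  assumes "bidx P = 0" "pderiv P = 0" shows "total_degree P = 0"
proof -
  have "total_degree P \<le> 0" unfolding total_degree_le_iff
  proof (intro allI impI)
    fix i j assume nz: "bicoeff P i j \<noteq> 0"
    have "i = 0"
    proof (cases i)
      case (Suc k)
      thus ?thesis using bicoeff_bidx[of P k j] assms(1) nz by (simp del: of_nat_Suc)
    qed
    moreover have "j = 0"
    proof (cases j)
      case (Suc k)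
      thus ?thesis using bicoeff_bidy[of P i k] assms(2) nz by (simp del: of_nat_Suc)
    qed
    ultimately show "i + j \<le> 0" by simp
  qed
  thus ?thesis by simp
qed

abbreviation biX :: "complex poly poly" where "biX \<equiv> bimonom 1 1 0"
abbreviation biY :: "complex poly poly" where "biY \<equiv> bimonom 1 0 1"

lemma bider_biXY: "bidx biX = 1" "bidx biY = 0" "pderiv biX = 0" "pderiv biY = 1"
proof -
  have "(1 :: complex poly poly) = bimonom 1 0 0"
    by (simp add: bimonom_def flip: one_pCons)
  hence *: "bicoeff 1 i j = (if i = 0 \<and> j = 0 then 1 else 0)" for i j
    by (metis bicoeff_simps(6))
  show "bidx biX = 1" "bidx biY = 0" "pderiv biX = 0" "pderiv biY = 1"
    by (auto intro!: bipoly_eqI simp: bicoeff_bidx bicoeff_bidy *)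
qed

lemma jac_biX: "jac P biX = - pderiv P"
  and jac_biY: "jac P biY = bidx P"
  by (simp_all add: jac_def bider_biXY del: One_nat_def)

lemma bisubst_left_inverse:
  assumes "\<And>z. polymap G1 G2 (polymap P Q z) = z"
  shows "bisubst P Q G1 = biX" "bisubst P Q G2 = biY"
proof -
  have "bieval G1 (polymap P Q z) = z $ 1" "bieval G2 (polymap P Q z) = z $ 2" for z
    using arg_cong[OF assms[of z], where f = "\<lambda>v. v $ 1"] arg_cong[OF assms[of z], where f = "\<lambda>v. v $ 2"]
    by (simp_all add: polymap_def[of G1 G2])
  thus "bisubst P Q G1 = biX" "bisubst P Q G2 = biY"
    by (simp_all add: bieval_inject[symmetric] fun_eq_iff bieval_bisubst del: One_nat_def)
qed

text \<open>If \<open>jac P Q\<close> vanished, the derivation \<open>jac P\<close> would kill every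
  polynomial in \<open>P\<close> and \<open>Q\<close>. By the left inverse x and y are such
  polynomials, so both partial derivatives of \<open>P\<close> would vanish.\<close>

lemma jac_nonzero:
  assumes "\<And>z. polymap G1 G2 (polymap P Q z) = z" "total_degree P \<noteq> 0"
  shows "jac P Q \<noteq> 0"
proof
  assume "jac P Q = 0"
  hence "jac P (bisubst P Q G) = 0" for G by (simp add: jac_bisubst)
  from this[of G1] this[of G2] have "jac P biX = 0" "jac P biY = 0"
    unfolding bisubst_left_inverse[OF assms(1)] .
  hence "pderiv P = 0" "bidx P = 0" unfolding jac_biX jac_biY by (simp_all only: neg_equal_0_iff_equal)
  from const_if_bider_0[OF this(2,1)] assms(2) show False by contradiction
qed

text \<open>If neither component of the inverse used its first argument, \<open>P\<close> could be
  replaced by \<open>Q\<close> without harming the left inverse, although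
  \<open>jac Q Q = 0\<close>. A component that does use it has weight at least \<open>n\<close> in
  \<open>degree_reduction\<close>.\<close>

lemma left_inverse_involves_first:
  assumes inv: "\<And>z. polymap G1 G2 (polymap P Q z) = z" and Q: "total_degree Q \<noteq> 0"
  shows "\<exists>G\<in>{G1, G2}. \<exists>i j. i \<ge> 1 \<and> bicoeff G i j \<noteq> 0"
proof (rule ccontr)
  assume no: "\<not> ?thesis"
  have "bieval G (polymap P Q z) = bieval G (polymap Q Q z)" if G: "G \<in> {G1, G2}" for G z
  proof -
    have 0: "bicoeff G i j = 0" if "i \<ge> 1" for i j using no G that by blast
    have N: "i \<le> total_degree G \<and> j \<le> total_degree G" if "bicoeff G i j \<noteq> 0" for i j
      using that total_degree_le_iff[of G "total_degree G"] by force
    have eq: "bicoeff G i j * u ^ i * v ^ j = bicoeff G i j * u' ^ i * v ^ j" for i j u u' v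
      using 0[of i j] by (cases i) auto
    have "bieval G w = bieval G w'" if "w $ 2 = w' $ 2" for w w'
    proof -
      have "(\<Sum>i\<le>total_degree G. \<Sum>j\<le>total_degree G. bicoeff G i j * w $ 1 ^ i * w $ 2 ^ j) =
        (\<Sum>i\<le>total_degree G. \<Sum>j\<le>total_degree G. bicoeff G i j * w' $ 1 ^ i * w' $ 2 ^ j)"
        unfolding that by (intro sum.cong refl) (rule eq)
      thus ?thesis using bieval_as_sum[of G "total_degree G", OF N] by metis
    qed
    thus ?thesis by (simp add: polymap_def)
  qed
  hence "polymap G1 G2 (polymap Q Q z) = z" for z
    using inv[of z] by (simp add: polymap_def[of G1 G2])
  hence "jac Q Q \<noteq> 0" using jac_nonzero[of G1 G2 Q Q] Q by blast
  thus False by simp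
qed

lemma hcf_eq_0_if_less:
  assumes "total_degree P < d" shows "hcf d P z = 0"
  using hcf_eq_0_iff[of P d] assms by auto

text \<open>Let \<open>W\<close> be the degree of \<open>G\<close> for the weights \<open>(n, q)\<close>, and let \<open>m\<close> be the order at
  \<open>v = b\<close> of its leading form, where \<open>(a, b)\<close> is a value of the leading forms of \<open>(P, Q)\<close>. Each
  application of \<open>jac P\<close> replaces \<open>G(P, Q)\<close> by its derivative in \<open>v\<close> and adds at most \<open>n - 2\<close>
  to the degree, so \<open>W - m q \<le> 1 + m (n - 2)\<close>. With \<open>n' = n / gcd(n, q)\<close>, the roots \<open>\<zeta> b\<close> for
  \<open>\<zeta>^n' = 1\<close> all have order \<open>m\<close>, so \<open>W \<ge> m lcm(n, q)\<close>. The two bounds contradict each other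
  unless \<open>q\<close> divides \<open>n\<close>.\<close>

theorem degree_reduction:
  assumes inv: "\<And>z. polymap G1 G2 (polymap P Q z) = z"
    and n: "total_degree P = n" "n \<ge> 2" and q: "total_degree Q = q" "q \<ge> 1" "q \<le> n"
  obtains c where "q dvd n" "c \<noteq> 0" "\<And>z. hcf n P z = c * hcf q Q z ^ (n div q)"
proof -
  have n1: "n \<ge> 1" using n by simp
  obtain G i1 j1 where G: "G \<in> {G1, G2}" and i1: "i1 \<ge> 1" "bicoeff G i1 j1 \<noteq> 0"
    using left_inverse_involves_first[OF inv] q by auto
  define S where "S = (\<lambda>(i, j). n * i + q * j) ` {(i, j). bicoeff G i j \<noteq> 0}"
  have S: "finite S" "S \<noteq> {}" using finite_bisupport[of G] i1(2) by (auto simp: S_def)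
  define W where "W = Max S"
  have W: "wle n q W G" unfolding wle_def W_def using Max_ge[OF S(1)] by (auto simp: S_def)
  obtain i0 j0 where ij0: "bicoeff G i0 j0 \<noteq> 0" "n * i0 + q * j0 = W"
    using Max_in[OF S] unfolding W_def by (auto simp: S_def)
  have "n * i1 + q * j1 \<le> W" using W i1(2) by (auto simp: wle_def)
  moreover have "n \<le> n * i1" using i1(1) by simp
  \<comment> \<open>The monomial with \<open>i1 \<ge> 1\<close> already has weight at least
    \<open>n \<ge> 2\<close>, whereas \<open>bisubst P Q G\<close> is x or y and has degree at most
    1. Leading terms must therefore cancel.\<close>
  ultimately have Wn: "W \<ge> n" by linarith
  have PQ: "P \<noteq> 0" "Q \<noteq> 0" using n q by auto
  obtain z0 where z0: "hcf n P z0 \<noteq> 0" "hcf q Q z0 \<noteq> 0"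
    using hcf_mult_nonzero[OF PQ] n(1) q(1) by metis
  define a where "a = hcf n P z0"
  define b where "b = hcf q Q z0"
  have ab: "a \<noteq> 0" "b \<noteq> 0" using z0 by (auto simp: a_def b_def)
  define R where "R k = bisubst P Q ((pderiv ^^ k) G)" for k
  define J where "J = jac P Q"
  have J: "J \<noteq> 0" unfolding J_def using jac_nonzero[OF inv] n by auto
  have "R 0 = biX \<or> R 0 = biY" using bisubst_left_inverse[OF inv] G by (auto simp: R_def)
  hence R0: "total_degree (R 0) \<le> 1" unfolding total_degree_le_iff by (auto split: if_splits)
  have lim: "((\<lambda>t. bieval (bisubst P Q H) (t *s z) / t ^ V) \<longlongrightarrow> wtop n q V H (hcf n P z) (hcf q Q z)) at_infinity"
    if "wle n q V H" for H V z
    using weighted_limit[OF that n1 q(2) filterlim_ident hcf_limit_line hcf_limit_line, of P Q z]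
    n(1) q(1) by (simp add: bieval_bisubst polymap_def)
  \<comment> \<open>If H(P, Q) has degree below \<open>V\<close>, the leading form of
    \<open>H\<close> vanishes at all values of the leading forms of \<open>P\<close> and
    \<open>Q\<close>.\<close>
  have top: "wtop n q V H (hcf n P z) (hcf q Q z) = 0"
    if "wle n q V H" "total_degree (bisubst P Q H) < V" for H V z
    using tendsto_unique[OF trivial_limit_at_infinity lim[OF that(1), of z] hcf_limit_line[of _ V z]]
      hcf_eq_0_if_less[OF that(2), of z] that(2) by simp
  define g where "g = wsec n q W G a"
  have g_coeff: "q * j \<le> W \<and> n dvd (W - q * j)" if "Polynomial.coeff g j \<noteq> 0" for j
    using that coeff_wsec[OF n1 q(2), of W G a j] by (auto simp: g_def split: if_splits)
  have "Polynomial.coeff g j0 = bicoeff G i0 j0 * a ^ i0"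
    using coeff_wsec[OF n1 q(2), of W G a j0] ij0(2) n1 by (auto simp: g_def)
  hence g0: "g \<noteq> 0" using ij0(1) ab by auto
  define m where "m = Polynomial.order b g"
  define d where "d = gcd n q"
  define n' where "n' = n div d"
  define q' where "q' = q div d"
  have d: "d \<ge> 1" using n1 by (simp add: d_def Suc_le_eq)
  have nd: "n = d * n'" "q = d * q'" by (simp_all add: d_def n'_def q'_def)
  have n'1: "n' \<ge> 1" "q' \<ge> 1" using nd n1 q(2) by (auto simp: Suc_le_eq intro!: gr0I)
  have cop: "coprime n' q'" unfolding n'_def q'_def d_def using n1 by (intro div_gcd_coprime) auto
  have res: "i mod n' = j mod n'" if "Polynomial.coeff g i \<noteq> 0" "Polynomial.coeff g j \<noteq> 0" "j \<le> i" for i j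
  proof -
    have *: "q * i \<le> W" "n dvd W - q * i" "q * j \<le> W" "n dvd W - q * j" using that g_coeff by auto
    have "(W - q * j) - (W - q * i) = q * (i - j)" using *(1,3) that(3) by (simp add: diff_mult_distrib2)
    hence "n dvd q * (i - j)" using dvd_diff_nat[OF *(4,2)] by simp
    hence "n' dvd q' * (i - j)" using nd d by (simp add: mult.assoc)
    hence "n' dvd i - j" using cop by (simp add: coprime_dvd_mult_right_iff)
    thus ?thesis using that(3) by (metis mod_eq_dvd_iff_nat)
  qed
  have deg: "n' * m \<le> Polynomial.degree g" unfolding m_def
  proof (rule order_times_le_degree[OF g0 ab(2) n'1(1)])
    fix i j assume "Polynomial.coeff g i \<noteq> 0" "Polynomial.coeff g j \<noteq> 0"
    thus "i mod n' = j mod n'" using res[of i j] res[of j i] by (cases "j \<le> i") auto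
  qed
  have "q * Polynomial.degree g \<le> W" using g_coeff[of "Polynomial.degree g"] g0 by simp
  hence Wm: "q * (n' * m) \<le> W" using deg by (meson le_trans mult_le_mono2)
  have "m \<le> n' * m" using n'1 by simp
  hence "m * q \<le> q * (n' * m)" by (metis mult.commute mult_le_mono2)
  hence mq: "m * q \<le> W" using Wm by linarith
  have "poly ((pderiv ^^ m) g) b \<noteq> 0" unfolding m_def by (rule poly_higher_pderiv_order[OF g0])
  hence nz: "wtop n q (W - m * q) ((pderiv ^^ m) G) a b \<noteq> 0"
    unfolding g_def higher_pderiv_wsec[OF n1 q(2) mq] poly_wsec .
  have degR: "W - m * q \<le> total_degree (R m)"
    using nz top[OF wle_higher_pderiv[OF W], of m z0] unfolding R_def a_def b_def by linarith
  have Rnz: "R m \<noteq> 0"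
  proof
    assume "R m = 0"
    hence "((\<lambda>t. 0) \<longlongrightarrow> wtop n q (W - m * q) ((pderiv ^^ m) G) a b) (at_infinity :: complex filter)"
      using lim[OF wle_higher_pderiv[OF W], of m z0] unfolding R_def a_def b_def by simp
    thus False using nz by (simp add: tendsto_const_iff trivial_limit_at_infinity)
  qed
  have "R k \<noteq> 0 \<Longrightarrow> total_degree (R k) \<le> 1 + k * (n - 2)" for k
  proof (induction k)
    case 0
    thus ?case using R0 by simp
  next
    case (Suc k)
    have eq: "jac P (R k) = R (Suc k) * J" unfolding R_def J_def by (simp add: jac_bisubst)
    have "jac P 0 = 0" by (simp add: jac_def)
    hence "R k \<noteq> 0" using eq Suc.prems J by force
    hence "total_degree (R k) \<le> 1 + k * (n - 2)" using Suc.IH by blast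
    moreover have "total_degree (R (Suc k)) \<le> total_degree (jac P (R k))"
      unfolding eq using total_degree_mult[OF Suc.prems J] by simp
    moreover have "total_degree (jac P (R k)) \<le> total_degree (R k) + (n - 2)"
      using total_degree_jac[of P "R k"] n by simp
    ultimately show ?case by simp
  qed
  from this[OF Rnz] degR have WR: "W \<le> 1 + m * (n - 2) + m * q" by linarith
  \<comment> \<open>\<open>m = 0\<close> would give W \<le> 1, against W \<ge> n \<ge> 2.\<close>
  have m1: "m \<ge> 1" using WR Wn n(2) by (cases m) auto
  \<comment> \<open>Otherwise q' \<ge> 2, so lcm(n, q) \<ge> 2n, and also q \<le> n - 1. The two
    bounds on W then give 2nm \<le> 1 + m(n - 2) + m(n - 1), which is impossible for m \<ge>
    1.\<close>
  have qn: "q dvd n"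
  proof (rule ccontr)
    assume nd': "\<not> q dvd n"
    have "q' \<noteq> 1" using nd nd' by auto
    hence q'2: "q' \<ge> 2" using n'1 by linarith
    have "q \<noteq> n" using nd' by auto
    hence qln: "q + 1 \<le> n" using q(3) by linarith
    have "q * (n' * m) = n * q' * m" using nd by (metis mult.assoc mult.commute)
    moreover have "n * q' * m \<ge> n * 2 * m" using q'2 by (intro mult_le_mono) auto
    ultimately have "n * 2 * m \<le> 1 + m * (n - 2) + m * q" using Wm WR by linarith
    moreover have "m * (n - 2) + m * 2 = m * n" using n(2) by (metis add_mult_distrib2 le_add_diff_inverse2)
    moreover have "m * q + m \<le> m * n" using qln by (metis add_mult_distrib2 mult.right_neutral mult_le_mono2)
    moreover have "n * 2 * m = m * n + m * n" by simp
    ultimately show False using m1 by linarith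
  qed
  define k where "k = n div q"
  have nk: "n = q * k" using qn by (simp add: k_def)
  define M where "M = k * i0 + j0"
  have WM: "W = q * M" using ij0(2) nk by (simp add: M_def algebra_simps)
  have MW: "M \<le> W" using WM q(2) by simp
  have cond: "n * i + q * j = W \<longleftrightarrow> k * i \<le> M \<and> j = M - k * i" for i j
  proof -
    have "n * i + q * j = W \<longleftrightarrow> q * (k * i + j) = q * M" using nk WM by (simp add: algebra_simps)
    also have "\<dots> \<longleftrightarrow> k * i + j = M" using q(2) by simp
    finally show ?thesis by auto
  qed
  \<comment> \<open>With n = q k the leading form of \<open>G\<close> is v^M \<rho>(u / v^k). It
    vanishes at the leading forms of \<open>P\<close> and \<open>Q\<close>, so the quotient of the
    form of \<open>P\<close> by the k-th power of the form of \<open>Q\<close> takes only values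
    that are roots of \<open>\<rho>\<close>.\<close>
  define \<rho> where "\<rho> = (\<Sum>i\<le>W. Polynomial.monom (if k * i \<le> M then bicoeff G i (M - k * i) else 0) i)"
  have i0W: "i0 \<le> W" using wle_bound[OF W n1 q(2) ij0(1)] by simp
  have "Polynomial.coeff \<rho> i0 = (if k * i0 \<le> M then bicoeff G i0 (M - k * i0) else 0)"
    using i0W by (simp add: \<rho>_def coeff_sum)
  hence \<rho>0: "\<rho> \<noteq> 0" using ij0(1) by (auto simp: M_def)
  have id: "wtop n q W G u v = v ^ M * poly \<rho> (u / v ^ k)" if v: "v \<noteq> 0" for u v
  proof -
    have "wtop n q W G u v = (\<Sum>i\<le>W. if k * i \<le> M then bicoeff G i (M - k * i) * u ^ i * v ^ (M - k * i) else 0)"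
      unfolding wtop_def
    proof (intro sum.cong refl)
      fix i assume "i \<in> {..W}"
      have "(\<Sum>j\<le>W. if n * i + q * j = W then bicoeff G i j * u ^ i * v ^ j else 0) =
        (\<Sum>j\<le>W. if j = M - k * i then if k * i \<le> M then bicoeff G i (M - k * i) * u ^ i * v ^ (M - k * i) else 0 else 0)"
        by (intro sum.cong refl) (auto simp: cond)
      thus "(\<Sum>j\<le>W. if n * i + q * j = W then bicoeff G i j * u ^ i * v ^ j else 0) =
        (if k * i \<le> M then bicoeff G i (M - k * i) * u ^ i * v ^ (M - k * i) else 0)"
        using le_trans[OF diff_le_self[of M "k * i"] MW] by (simp add: sum.delta)
    qed
    also have "\<dots> = (\<Sum>i\<le>W. v ^ M * ((if k * i \<le> M then bicoeff G i (M - k * i) else 0) * (u / v ^ k) ^ i))"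
    proof (intro sum.cong refl)
      fix i assume "i \<in> {..W}"
      show "(if k * i \<le> M then bicoeff G i (M - k * i) * u ^ i * v ^ (M - k * i) else 0) =
        v ^ M * ((if k * i \<le> M then bicoeff G i (M - k * i) else 0) * (u / v ^ k) ^ i)"
      proof (cases "k * i \<le> M")
        case True
        have "v ^ M = (v ^ k) ^ i * v ^ (M - k * i)"
          using True by (metis le_add_diff_inverse power_add power_mult)
        thus ?thesis using True v by (simp add: power_divide)
      qed simp
    qed
    also have "\<dots> = v ^ M * poly \<rho> (u / v ^ k)"
      by (simp add: \<rho>_def poly_sum poly_monom sum_distrib_left)
    finally show ?thesis .
  qed
  obtain Hn where Hn: "bieval Hn = hcf n P" by (metis hcf_bipoly)
  obtain Hq where Hq: "bieval Hq = hcf q Q" by (metis hcf_bipoly)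
  define Rt where "Rt = {r. poly \<rho> r = 0}"
  have Rt: "finite Rt" unfolding Rt_def by (rule poly_roots_finite[OF \<rho>0])
  have ev: "bieval (Hn - [:[:r:]:] * Hq ^ k) z = hcf n P z - r * hcf q Q z ^ k" for r z
    by (simp only: bieval_simps bieval_const Hn Hq)
  have ev_prod: "bieval (prod F A) z = (\<Prod>x\<in>A. bieval (F x) z)" for F z and A :: "complex set"
    by (induction A rule: infinite_finite_induct) auto
  \<comment> \<open>Every point makes one factor vanish; \<open>Hq\<close> takes care of the points
    where the quotient is undefined. The product is thus the zero polynomial, and one single factor
    must be zero: the quotient is constant.\<close>
  have "bieval (Hq * (\<Prod>r\<in>Rt. Hn - [:[:r:]:] * Hq ^ k)) z = 0" for z
  proof (cases "hcf q Q z = 0")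
    case False
    let ?r = "hcf n P z / hcf q Q z ^ k"
    have "total_degree (bisubst P Q G) < W" using R0 Wn n(2) by (simp add: R_def)
    from top[OF W this, of z] False have "?r \<in> Rt" by (simp add: id Rt_def)
    moreover have "bieval (Hn - [:[:?r:]:] * Hq ^ k) z = 0" unfolding ev using False by simp
    ultimately have "bieval (\<Prod>r\<in>Rt. Hn - [:[:r:]:] * Hq ^ k) z = 0"
      unfolding ev_prod by (intro prod_zero[OF Rt]) blast
    thus ?thesis by (simp only: bieval_simps mult_zero_right)
  qed (simp only: bieval_simps Hq mult_zero_left)
  hence "Hq * (\<Prod>r\<in>Rt. Hn - [:[:r:]:] * Hq ^ k) = 0"
    by (intro iffD1[OF bieval_eq_0_iff] allI)
  moreover have "Hq \<noteq> 0" using z0(2) Hq by (metis bieval_simps(1))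
  ultimately have "(\<Prod>r\<in>Rt. Hn - [:[:r:]:] * Hq ^ k) = 0"
    using no_zero_divisors by metis
  hence "\<exists>r\<in>Rt. Hn - [:[:r:]:] * Hq ^ k = 0" by (rule iffD1[OF prod_zero_iff[OF Rt]])
  then obtain r where r: "Hn - [:[:r:]:] * Hq ^ k = 0" by (rule bexE)
  have *: "hcf n P z = r * hcf q Q z ^ k" for z
    using ev[of r z] unfolding r by (simp only: bieval_simps) (metis eq_iff_diff_eq_0)
  have r0: "r \<noteq> 0" using *[of z0] z0 by auto
  show ?thesis by (rule that[OF qn r0]) (unfold k_def[symmetric], rule *)
qed

section \<open>Polynomial self-maps of the plane\<close>

lemma bipoly_over_iff: "P \<in> bipoly_over K \<longleftrightarrow> (\<forall>i j. bicoeff P i j \<in> K)"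
  by (simp add: bipoly_over_def bicoeff_def)

lemma bipoly_over_UNIV [simp]: "P \<in> bipoly_over UNIV" by (simp add: bipoly_over_iff)

lemma bicoeff_const: "bicoeff [:[:c:]:] i j = (if i = 0 \<and> j = 0 then c else 0)"
  by (auto simp: bicoeff_def coeff_pCons split: nat.splits)

lemma bicoeff_1: "bicoeff 1 i j = (if i = 0 \<and> j = 0 then 1 else 0)"
  using bicoeff_const[of 1] by (simp add: one_pCons)

context
  fixes K assumes K: "cfield K"
begin

lemma bipoly_over_0: "0 \<in> bipoly_over K"
  and bipoly_over_1: "1 \<in> bipoly_over K"
  and bipoly_over_const: "c \<in> K \<Longrightarrow> [:[:c:]:] \<in> bipoly_over K"
  and bipoly_over_monom: "c \<in> K \<Longrightarrow> bimonom c i j \<in> bipoly_over K"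
  and bipoly_over_add: "P \<in> bipoly_over K \<Longrightarrow> Q \<in> bipoly_over K \<Longrightarrow> P + Q \<in> bipoly_over K"
  and bipoly_over_diff: "P \<in> bipoly_over K \<Longrightarrow> Q \<in> bipoly_over K \<Longrightarrow> P - Q \<in> bipoly_over K"
  using K by (auto simp: bipoly_over_iff bicoeff_1 bicoeff_const intro: cfield_intros)

lemma bipoly_over_mult: "P \<in> bipoly_over K \<Longrightarrow> Q \<in> bipoly_over K \<Longrightarrow> P * Q \<in> bipoly_over K"
  by (auto simp: bipoly_over_iff bicoeff_mult intro!: cfield_sum cfield_mult K)

lemma bipoly_over_power: "P \<in> bipoly_over K \<Longrightarrow> P ^ n \<in> bipoly_over K"
  by (induction n) (auto intro: bipoly_over_1 bipoly_over_mult)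

lemma unisubst_over:
  assumes "\<And>i. Polynomial.coeff a i \<in> K" "P \<in> bipoly_over K"
  shows "unisubst P a \<in> bipoly_over K"
  using assms(1)
proof (induction a)
  case (pCons c a)
  have "c \<in> K" using pCons.prems[of 0] by simp
  moreover have "Polynomial.coeff a i \<in> K" for i using pCons.prems[of "Suc i"] by simp
  ultimately show ?case using pCons.IH assms(2)
    by (auto simp: unisubst_pCons intro!: bipoly_over_add bipoly_over_const bipoly_over_mult)
qed (auto intro: bipoly_over_0)

lemma bisubst_over:
  assumes "G \<in> bipoly_over K" "P \<in> bipoly_over K" "Q \<in> bipoly_over K"
  shows "bisubst P Q G \<in> bipoly_over K"
  using assms(1)
proof (induction G)
  case (pCons a G)
  have "Polynomial.coeff a i \<in> K" for i
    using pCons.prems unfolding bipoly_over_def mem_Collect_eq by (metis coeff_pCons_0)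
  moreover have "G \<in> bipoly_over K" unfolding bipoly_over_def
  proof (intro CollectI allI)
    fix i j show "Polynomial.coeff (Polynomial.coeff G j) i \<in> K"
      using pCons.prems unfolding bipoly_over_def mem_Collect_eq by (metis coeff_pCons_Suc)
  qed
  ultimately show ?case using pCons.IH assms(2,3)
    by (auto simp: bisubst_pCons intro!: bipoly_over_add unisubst_over bipoly_over_mult)
qed (auto intro: bipoly_over_0)

end

section \<open>Degrees of substitutions and of composed maps\<close>

lemma total_degree_add_le:
  "total_degree P \<le> d \<Longrightarrow> total_degree Q \<le> d \<Longrightarrow> total_degree (P + Q) \<le> d"
  unfolding total_degree_le_iff by (metis bicoeff_simps(2) add_0)

lemma total_degree_sum_le:
  "(\<And>x. x \<in> A \<Longrightarrow> total_degree (F x) \<le> d) \<Longrightarrow> total_degree (sum F A) \<le> d"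
  by (induction A rule: infinite_finite_induct) (auto intro: total_degree_add_le)

lemma total_degree_const [simp]: "total_degree [:[:c:]:] = 0"
  using total_degree_le_iff[of "[:[:c:]:]" 0] by (auto simp: bicoeff_const split: if_splits)

lemma total_degree_1 [simp]: "total_degree 1 = 0"
  using total_degree_const[of 1] by (simp add: one_pCons)

lemma total_degree_power_le: "total_degree (P ^ n) \<le> n * total_degree P"
proof (induction n)
  case (Suc n)
  thus ?case using total_degree_mult_le[of P "P ^ n"] by simp
qed simp

lemma total_degree_bimonom_le: "total_degree (bimonom c i j) \<le> i + j"
  unfolding total_degree_le_iff by auto

lemma polymap_nth [simp]: "polymap P Q z $ 1 = bieval P z" "polymap P Q z $ 2 = bieval Q z"
  by (simp_all add: polymap_def)

lemma bisubst_as_sum: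
  "bisubst P Q G = (\<Sum>i\<le>total_degree G. \<Sum>j\<le>total_degree G. [:[:bicoeff G i j:]:] * P ^ i * Q ^ j)"
proof -
  have eq: "bieval G w = (\<Sum>i\<le>total_degree G. \<Sum>j\<le>total_degree G. bicoeff G i j * w $ 1 ^ i * w $ 2 ^ j)" for w
    by (rule bieval_as_sum) (use total_degree_le_iff[of G "total_degree G"] in force)
  have "bieval (bisubst P Q G) z =
      bieval (\<Sum>i\<le>total_degree G. \<Sum>j\<le>total_degree G. [:[:bicoeff G i j:]:] * P ^ i * Q ^ j) z" for z
    unfolding bieval_bisubst eq
    by (simp only: bieval_simps bieval_const polymap_nth)
  thus ?thesis by (subst bieval_inject[symmetric]) (rule ext)
qed

lemma total_degree_bisubst_le:
  assumes "total_degree P \<le> d" "total_degree Q \<le> d" "total_degree G \<le> n"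
  shows "total_degree (bisubst P Q G) \<le> n * d"
  unfolding bisubst_as_sum
proof (intro total_degree_sum_le)
  fix i j
  show "total_degree ([:[:bicoeff G i j:]:] * P ^ i * Q ^ j) \<le> n * d"
  proof (cases "bicoeff G i j = 0")
    case False
    hence ij: "i + j \<le> n" using total_degree_le_iff[of G n] assms(3) by blast
    have "total_degree ([:[:bicoeff G i j:]:] * P ^ i * Q ^ j) \<le> total_degree ([:[:bicoeff G i j:]:] * P ^ i) + total_degree (Q ^ j)"
      by (rule total_degree_mult_le)
    also have "total_degree ([:[:bicoeff G i j:]:] * P ^ i) \<le> total_degree [:[:bicoeff G i j:]:] + total_degree (P ^ i)"
      by (rule total_degree_mult_le)
    also have "total_degree [:[:bicoeff G i j:]:] = 0" by simp
    also have "total_degree (P ^ i) \<le> i * d"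
      using total_degree_power_le[of P i] assms(1) by (meson le_trans mult_le_mono2)
    also have "total_degree (Q ^ j) \<le> j * d"
      using total_degree_power_le[of Q j] assms(2) by (meson le_trans mult_le_mono2)
    also have "0 + i * d + j * d = (i + j) * d" by (simp add: algebra_simps)
    also have "\<dots> \<le> n * d" using ij by simp
    finally show ?thesis by simp
  qed simp
qed

lemma vec2_eqI: "(v :: 'a ^ 2) $ 1 = w $ 1 \<Longrightarrow> v $ 2 = w $ 2 \<Longrightarrow> v = w"
  by (simp add: vec_eq_iff forall_2)

lemma polymap_comp:
  "polymap G H \<circ> polymap P Q = polymap (bisubst P Q G) (bisubst P Q H)"
  by (auto simp: fun_eq_iff bieval_bisubst intro!: vec2_eqI)

lemma polymap_XY: "polymap biX biY = id"
  by (auto simp: fun_eq_iff intro!: vec2_eqI simp del: One_nat_def)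

lemma defined_overE:
  assumes "defined_over K F"
  obtains P Q where "P \<in> bipoly_over K" "Q \<in> bipoly_over K" "F = polymap P Q"
  using assms by (auto simp: defined_over_def)

lemma defined_over_polymap: "P \<in> bipoly_over K \<Longrightarrow> Q \<in> bipoly_over K \<Longrightarrow> defined_over K (polymap P Q)"
  by (auto simp: defined_over_def)

lemma defined_over_comp:
  assumes "cfield K" "defined_over K F" "defined_over K G" shows "defined_over K (F \<circ> G)"
proof -
  obtain P Q where F: "P \<in> bipoly_over K" "Q \<in> bipoly_over K" "F = polymap P Q"
    using assms(2) by (rule defined_overE)
  obtain A B where G: "A \<in> bipoly_over K" "B \<in> bipoly_over K" "G = polymap A B"
    using assms(3) by (rule defined_overE)
  show ?thesis unfolding F(3) G(3) polymap_comp
    by (intro defined_over_polymap bisubst_over assms(1) F G)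
qed

lemma defined_over_id: "cfield K \<Longrightarrow> defined_over K id"
  unfolding polymap_XY[symmetric] by (intro defined_over_polymap bipoly_over_monom cfield_1)

lemma defined_over_mono: "K \<subseteq> L \<Longrightarrow> defined_over K F \<Longrightarrow> defined_over L F"
  unfolding defined_over_def bipoly_over_def by blast

lemma map_degree_comp_le:
  assumes "defined_over UNIV F" "defined_over UNIV G"
  shows "map_degree (F \<circ> G) \<le> map_degree F * map_degree G"
proof -
  obtain P Q where F: "F = polymap P Q" using assms(1) by (rule defined_overE)
  obtain A B where G: "G = polymap A B" using assms(2) by (rule defined_overE)
  show ?thesis unfolding F G polymap_comp map_degree_polymap
    by (intro max.boundedI total_degree_bisubst_le) auto
qed

text \<open>\<open>t\<close> is the degree \<open>n\<close> part of \<open>F\<close>, which is zero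
  when \<open>n\<close> exceeds the degree. Being a relation with free \<open>n\<close>, it can
  describe a composite before its exact degree is known.\<close>

definition topf :: "nat \<Rightarrow> (complex ^ 2 \<Rightarrow> complex ^ 2) \<Rightarrow> (complex ^ 2 \<Rightarrow> complex ^ 2) \<Rightarrow> bool" where
  "topf n F t \<longleftrightarrow> (\<exists>P Q. F = polymap P Q \<and> total_degree P \<le> n \<and> total_degree Q \<le> n \<and>
     t = (\<lambda>z. vector [hcf n P z, hcf n Q z]))"

lemma topf_exists:
  assumes "defined_over UNIV F" "map_degree F \<le> n" obtains t where "topf n F t"
proof -
  obtain P Q where F: "F = polymap P Q" using assms(1) by (rule defined_overE)
  have "topf n F (\<lambda>z. vector [hcf n P z, hcf n Q z])"
    unfolding topf_def using assms(2) F by (auto simp: map_degree_polymap)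
  thus ?thesis by (rule that)
qed

lemma tendsto_vec2:
  fixes f :: "'a \<Rightarrow> complex ^ 2"
  assumes "((\<lambda>t. f t $ 1) \<longlongrightarrow> l $ 1) F" "((\<lambda>t. f t $ 2) \<longlongrightarrow> l $ 2) F"
  shows "(f \<longlongrightarrow> l) F"
proof (rule vec_tendstoI)
  fix i :: 2 show "((\<lambda>t. f t $ i) \<longlongrightarrow> l $ i) F"
    using exhaust_2[of i] assms by auto
qed

lemma topf_limit:
  fixes S :: "'a \<Rightarrow> complex"
  assumes "topf n F t" "filterlim S at_infinity \<F>" "(w \<longlongrightarrow> w0) \<F>"
  shows "((\<lambda>x. inverse (S x ^ n) *s F (S x *s w x)) \<longlongrightarrow> t w0) \<F>"
proof -
  obtain P Q where P: "F = polymap P Q" "total_degree P \<le> n" "total_degree Q \<le> n"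
     "t = (\<lambda>z. vector [hcf n P z, hcf n Q z])" using assms(1) by (auto simp: topf_def)
  show ?thesis
  proof (rule tendsto_vec2)
    show "((\<lambda>x. (inverse (S x ^ n) *s F (S x *s w x)) $ 1) \<longlongrightarrow> t w0 $ 1) \<F>"
      using hcf_limit[OF P(2) assms(2,3)] by (simp add: P divide_inverse mult.commute)
    show "((\<lambda>x. (inverse (S x ^ n) *s F (S x *s w x)) $ 2) \<longlongrightarrow> t w0 $ 2) \<F>"
      using hcf_limit[OF P(3) assms(2,3)] by (simp add: P divide_inverse mult.commute)
  qed
qed

lemma topf_unique:
  assumes "topf n F t" "topf n F s" shows "t = s"
proof
  fix z
  show "t z = s z"
    using tendsto_unique[OF trivial_limit_at_infinity topf_limit[OF assms(1) filterlim_ident tendsto_const]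
      topf_limit[OF assms(2) filterlim_ident tendsto_const]] .
qed

lemma topf_defined: "topf n F t \<Longrightarrow> defined_over UNIV F"
  by (auto simp: topf_def intro!: defined_over_polymap)

text \<open>Write F(G(T z)) = F(S w) with S = T^m and w = T^(-m) G(T z), which tends to
  \<open>s z\<close>; then \<open>topf_limit\<close> applies. The composed form may be zero, and
  this is exactly the case in which the degree drops. The condition \<open>m \<ge> 1\<close> makes S
  tend to infinity.\<close>

lemma topf_comp:
  assumes F: "topf n F t" and G: "topf m G s" and m: "m \<ge> 1"
  shows "topf (n * m) (F \<circ> G) (\<lambda>z. t (s z))"
proof -
  have dF: "map_degree F \<le> n" using F by (auto simp: topf_def map_degree_polymap)
  have dG: "map_degree G \<le> m" using G by (auto simp: topf_def map_degree_polymap)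
  have "defined_over UNIV (F \<circ> G)" using topf_defined[OF F] topf_defined[OF G] cfield_UNIV
    by (intro defined_over_comp)
  moreover have "map_degree (F \<circ> G) \<le> n * m"
    using map_degree_comp_le[OF topf_defined[OF F] topf_defined[OF G]] mult_le_mono[OF dF dG] by linarith
  ultimately obtain r where r: "topf (n * m) (F \<circ> G) r" by (rule topf_exists)
  have "r z = t (s z)" for z
  proof (rule tendsto_unique[OF trivial_limit_at_infinity topf_limit[OF r filterlim_ident tendsto_const]])
    let ?w = "\<lambda>T :: complex. inverse (T ^ m) *s G (T *s z)"
    have w: "(?w \<longlongrightarrow> s z) at_infinity" using topf_limit[OF G filterlim_ident tendsto_const] .
    have S: "filterlim (\<lambda>T :: complex. T ^ m) at_infinity at_infinity"
      using m by (intro filterlim_power_at_infinity filterlim_ident) auto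
    show "((\<lambda>x. inverse (x ^ (n * m)) *s (F \<circ> G) (x *s z)) \<longlongrightarrow> t (s z)) at_infinity"
    proof (rule Lim_transform_eventually[OF topf_limit[OF F S w]])
      have "eventually (\<lambda>x :: complex. x \<noteq> 0) at_infinity"
        by (rule eventually_not_equal_at_infinity)
      thus "eventually (\<lambda>x. inverse ((x ^ m) ^ n) *s F (x ^ m *s (inverse (x ^ m) *s G (x *s z))) =
          inverse (x ^ (n * m)) *s (F \<circ> G) (x *s z)) at_infinity"
        by eventually_elim (simp add: vector_smult_assoc power_mult[symmetric] mult.commute)
    qed
  qed
  hence "r = (\<lambda>z. t (s z))" by auto
  thus ?thesis using r by simp
qed

lemma topf_degree_le: "topf n F t \<Longrightarrow> map_degree F \<le> n"
  by (auto simp: topf_def map_degree_polymap)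

lemma topf_degree_eq:
  assumes "topf n F t" "t z \<noteq> 0" "n \<ge> 1" shows "map_degree F = n"
proof -
  obtain P Q where P: "F = polymap P Q" "total_degree P \<le> n" "total_degree Q \<le> n"
     "t = (\<lambda>z. vector [hcf n P z, hcf n Q z])" using assms(1) by (auto simp: topf_def)
  have "hcf n P z \<noteq> 0 \<or> hcf n Q z \<noteq> 0" using assms(2) by (auto simp: P intro!: vec2_eqI)
  hence "\<not> total_degree P < n \<or> \<not> total_degree Q < n"
    using hcf_eq_0_if_less[of P n z] hcf_eq_0_if_less[of Q n z] by auto
  thus ?thesis using P by (auto simp: map_degree_polymap)
qed

lemma topf_zero_if_less:
  assumes "topf n F t" "map_degree F < n" shows "t z = 0"
proof (rule ccontr)
  assume "t z \<noteq> 0"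
  from topf_degree_eq[OF assms(1) this] assms(2) show False by simp
qed

section \<open>Leading forms of plane automorphisms\<close>

lemma hcf_add: "hcf d (P + Q) z = hcf d P z + hcf d Q z"
  unfolding hcf_def wtop_def sum.distrib[symmetric] by (intro sum.cong refl) (auto simp: algebra_simps)

lemma hcf_diff: "hcf d (P - Q) z = hcf d P z - hcf d Q z"
  unfolding hcf_def wtop_def sum_subtractf[symmetric] by (intro sum.cong refl) (auto simp: algebra_simps)

lemma hcf_0 [simp]: "hcf d 0 z = 0"
  by (auto simp: hcf_def wtop_def intro!: sum.neutral)

lemma hcf_sum: "hcf d (sum F A) z = (\<Sum>x\<in>A. hcf d (F x) z)"
  by (induction A rule: infinite_finite_induct) (auto simp: hcf_add)

lemma hcf_scale: "hcf d ([:[:c:]:] * P) z = c * hcf d P z"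
proof -
  have "bicoeff ([:[:c:]:] * P) i j = c * bicoeff P i j" for i j
    by (simp add: bicoeff_def)
  thus ?thesis unfolding hcf_def wtop_def sum_distrib_left
    by (intro sum.cong refl) (auto simp: algebra_simps)
qed

lemma hcf_zero_1: "hcf 0 1 z = 1"
  by (simp add: hcf_def wtop_def bicoeff_1)

lemma hcf_power:
  assumes "total_degree P \<le> d" shows "hcf (n * d) (P ^ n) z = hcf d P z ^ n"
proof (induction n)
  case (Suc n)
  have "total_degree (P ^ n) \<le> n * d" using total_degree_power_le[of P n] assms by (meson le_trans mult_le_mono2)
  from hcf_mult[OF assms this] Suc show ?case by simp
qed (simp add: hcf_zero_1)

lemma unisubst_add: "unisubst Q (a + b) = unisubst Q a + unisubst Q b"
  by (subst bieval_inject[symmetric]) (simp add: fun_eq_iff bieval_unisubst)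

lemma unisubst_monom: "unisubst Q (Polynomial.monom c k) = [:[:c:]:] * Q ^ k"
  by (subst bieval_inject[symmetric]) (simp only: fun_eq_iff bieval_unisubst poly_monom bieval_simps bieval_const simp_thms)

lemma unisubst_as_sum:
  "unisubst Q p = (\<Sum>i\<le>Polynomial.degree p. [:[:Polynomial.coeff p i:]:] * Q ^ i)"
  by (subst bieval_inject[symmetric])
    (simp only: fun_eq_iff bieval_unisubst bieval_simps bieval_const poly_altdef simp_thms)

lemma total_degree_scale_le: "total_degree ([:[:c:]:] * P) \<le> total_degree P"
  using total_degree_mult_le[of "[:[:c:]:]" P] by simp

lemma total_degree_power_le': "total_degree P \<le> d \<Longrightarrow> total_degree (P ^ n) \<le> n * d"
  using total_degree_power_le[of P n] by (meson le_trans mult_le_mono2)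

lemma total_degree_unisubst_le:
  assumes "total_degree Q \<le> d" shows "total_degree (unisubst Q p) \<le> Polynomial.degree p * d"
  unfolding unisubst_as_sum
proof (intro total_degree_sum_le)
  fix i assume "i \<in> {..Polynomial.degree p}"
  have "total_degree ([:[:Polynomial.coeff p i:]:] * Q ^ i) \<le> i * d"
    using total_degree_scale_le total_degree_power_le'[OF assms] by (meson le_trans)
  also have "\<dots> \<le> Polynomial.degree p * d" using \<open>i \<in> _\<close> by simp
  finally show "total_degree ([:[:Polynomial.coeff p i:]:] * Q ^ i) \<le> Polynomial.degree p * d" .
qed

lemma hcf_unisubst:
  assumes "total_degree Q \<le> d" "d \<ge> 1"
  shows "hcf (Polynomial.degree p * d) (unisubst Q p) z = Polynomial.lead_coeff p * hcf d Q z ^ Polynomial.degree p"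
proof -
  let ?k = "Polynomial.degree p"
  have "hcf (?k * d) ([:[:Polynomial.coeff p i:]:] * Q ^ i) z =
      (if i = ?k then Polynomial.lead_coeff p * hcf d Q z ^ ?k else 0)" if "i \<le> ?k" for i
  proof (cases "i = ?k")
    case True
    thus ?thesis using hcf_power[OF assms(1), of ?k z] by (simp only: hcf_scale if_True simp_thms)
  next
    case False
    have "total_degree (Q ^ i) \<le> i * d" by (rule total_degree_power_le'[OF assms(1)])
    also have "i * d < ?k * d" using False that assms(2) by simp
    finally show ?thesis using False hcf_eq_0_if_less by (simp only: hcf_scale if_False mult_zero_right)
  qed
  hence "(\<Sum>i\<le>?k. hcf (?k * d) ([:[:Polynomial.coeff p i:]:] * Q ^ i) z) =
      (\<Sum>i\<le>?k. if i = ?k then Polynomial.lead_coeff p * hcf d Q z ^ ?k else 0)" by (intro sum.cong) auto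
  thus ?thesis unfolding unisubst_as_sum hcf_sum by (simp add: sum.delta)
qed

lemma total_degree_unisubst:
  assumes "total_degree Q \<ge> 1"
  shows "total_degree (unisubst Q p) = Polynomial.degree p * total_degree Q"
proof (cases "Polynomial.degree p = 0")
  case True
  thus ?thesis using total_degree_unisubst_le[of Q "total_degree Q" p] by simp
next
  case False
  have Q: "Q \<noteq> 0" using assms by auto
  obtain z where "hcf (total_degree Q) Q z \<noteq> 0" using hcf_nonzero[OF Q] .
  hence "hcf (Polynomial.degree p * total_degree Q) (unisubst Q p) z \<noteq> 0"
    using hcf_unisubst[OF order_refl assms, of p z] False by auto
  hence "\<not> total_degree (unisubst Q p) < Polynomial.degree p * total_degree Q"
    using hcf_eq_0_if_less by blast
  thus ?thesis using total_degree_unisubst_le[of Q "total_degree Q" p] by simp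
qed

section \<open>Left invertible maps and division of one component by the other\<close>

definition linv :: "(complex ^ 2 \<Rightarrow> complex ^ 2) \<Rightarrow> bool" where
  "linv F \<longleftrightarrow> (\<exists>G. defined_over UNIV G \<and> G \<circ> F = id)"

lemma linv_comp: "linv F \<Longrightarrow> linv G \<Longrightarrow> linv (F \<circ> G)"
  unfolding linv_def
proof (elim exE conjE)
  fix A B assume A: "defined_over UNIV A" "A \<circ> F = id" and B: "defined_over UNIV B" "B \<circ> G = id"
  have "(B \<circ> A) \<circ> (F \<circ> G) = B \<circ> (A \<circ> F) \<circ> G" by (simp add: o_assoc)
  hence "(B \<circ> A) \<circ> (F \<circ> G) = id" using A(2) B(2) by simp
  thus "\<exists>Ga. defined_over UNIV Ga \<and> Ga \<circ> (F \<circ> G) = id"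
    using defined_over_comp[OF cfield_UNIV B(1) A(1)] by blast
qed

lemma linv_polymapD:
  assumes "linv (polymap P Q)"
  obtains G1 G2 where "\<And>z. polymap G1 G2 (polymap P Q z) = z"
proof -
  obtain G where G: "defined_over UNIV G" "G \<circ> polymap P Q = id" using assms by (auto simp: linv_def)
  obtain G1 G2 where "G = polymap G1 G2" using G(1) by (rule defined_overE)
  thus ?thesis using that[of G1 G2] fun_cong[OF G(2)] by simp
qed

lemma linv_swap: "linv (polymap P Q) \<Longrightarrow> linv (polymap Q P)"
proof -
  assume a: "linv (polymap P Q)"
  let ?S = "polymap biY biX"
  have "?S \<circ> ?S = id" by (auto simp: fun_eq_iff intro!: vec2_eqI simp del: One_nat_def)
  hence "linv ?S" unfolding linv_def using defined_over_polymap[of biY UNIV biX] by auto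
  moreover have "polymap Q P = ?S \<circ> polymap P Q"
    by (auto simp: fun_eq_iff intro!: vec2_eqI simp del: One_nat_def)
  ultimately show ?thesis using linv_comp a by simp
qed

lemma linv_shift:
  assumes "linv (polymap P Q)" shows "linv (polymap (P - unisubst Q p) Q)"
proof -
  let ?E = "\<lambda>p. polymap (biX - unisubst biY p) biY"
  have "?E (- p) \<circ> ?E p = id"
    by (auto simp: fun_eq_iff bieval_unisubst intro!: vec2_eqI simp del: One_nat_def)
  hence "linv (?E p)" unfolding linv_def using defined_over_polymap[of "biX - unisubst biY (- p)" UNIV biY] by auto
  moreover have "polymap (P - unisubst Q p) Q = ?E p \<circ> polymap P Q"
    by (auto simp: fun_eq_iff bieval_unisubst intro!: vec2_eqI simp del: One_nat_def)
  ultimately show ?thesis using linv_comp assms by simp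
qed

lemma bieval_if_total_degree_0: "total_degree P = 0 \<Longrightarrow> bieval P z = bicoeff P 0 0"
  using bieval_as_sum[of P 0 z] total_degree_le_iff[of P 0] by force

text \<open>A constant component makes the Jacobian vanish, so by \<open>jac_nonzero\<close> the
  other component is constant as well, and the map is not injective.\<close>

lemma linv_degree_pos:
  assumes "linv (polymap P Q)" shows "total_degree P \<ge> 1" "total_degree Q \<ge> 1"
proof -
  have *: "total_degree Q \<ge> 1" if lin: "linv (polymap P Q)" for P Q
  proof (rule ccontr)
    assume "\<not> total_degree Q \<ge> 1"
    hence Q: "total_degree Q = 0" by simp
    obtain G1 G2 where G: "\<And>z. polymap G1 G2 (polymap P Q z) = z" using linv_polymapD[OF lin] by blast
    have "jac P Q = 0" using bider_const[OF Q] by (simp add: jac_def)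
    hence P: "total_degree P = 0" using jac_nonzero[OF G] by blast
    have "polymap P Q 0 = polymap P Q (vector [1, 1])"
      by (rule vec2_eqI) (simp_all add: bieval_if_total_degree_0[OF P] bieval_if_total_degree_0[OF Q])
    hence "(0 :: complex ^ 2) = vector [1, 1]" using G by metis
    from arg_cong[OF this, where f = "\<lambda>v. v $ 1"] show False by simp
  qed
  show "total_degree Q \<ge> 1" using *[OF assms] .
  show "total_degree P \<ge> 1" using *[OF linv_swap[OF assms]] .
qed

text \<open>Subtracting \<open>c\<close> times the power of \<open>Q\<close> kills the top degree of
  \<open>P\<close>, so \<open>c\<close> is the quotient of two corresponding coefficients and lies
  in \<open>K\<close>.\<close>

lemma degree_reduction_over:
  assumes K: "cfield K" and inv: "linv (polymap P Q)"
    and over: "P \<in> bipoly_over K" "Q \<in> bipoly_over K"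
    and n: "total_degree P \<ge> 2" and q: "total_degree Q \<le> total_degree P"
  obtains c where "c \<in> K" "c \<noteq> 0" "total_degree Q dvd total_degree P"
    "\<And>z. hcf (total_degree P) P z = c * hcf (total_degree Q) Q z ^ (total_degree P div total_degree Q)"
proof -
  let ?n = "total_degree P" and ?q = "total_degree Q"
  let ?k = "?n div ?q"
  obtain G1 G2 where G: "\<And>z. polymap G1 G2 (polymap P Q z) = z" using linv_polymapD[OF inv] by blast
  obtain c where c: "?q dvd ?n" "c \<noteq> 0" "\<And>z. hcf ?n P z = c * hcf ?q Q z ^ ?k"
    using degree_reduction[OF G refl n refl linv_degree_pos(2)[OF inv] q] by blast
  have nk: "?k * ?q = ?n" using c(1) by simp
  define R where "R = P - [:[:c:]:] * Q ^ ?k"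
  have "hcf ?n R z = 0" for z
    using hcf_power[of Q ?q ?k z] c(3)[of z] by (simp only: R_def hcf_diff hcf_scale nk) simp
  moreover have "total_degree R \<le> ?n"
    unfolding R_def using total_degree_power_le'[of Q ?q ?k] total_degree_scale_le[of c "Q ^ ?k"]
    by (intro total_degree_diff_le) (auto simp: nk)
  ultimately have R: "total_degree R \<le> ?n - 1" using hcf_eq_0_iff[of R ?n] n by auto
  have P0: "P \<noteq> 0" using n by auto
  obtain i j where ij: "bicoeff P i j \<noteq> 0" "i + j = ?n" using total_degree_attained[OF P0] .
  have "bicoeff R i j = 0" using R ij(2) n total_degree_le_iff[of R "?n - 1"] by fastforce
  hence eq: "bicoeff P i j = c * bicoeff (Q ^ ?k) i j"
    by (simp add: R_def) (simp add: bicoeff_def)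
  hence "c = bicoeff P i j / bicoeff (Q ^ ?k) i j" using ij(1) by auto
  moreover have "bicoeff P i j \<in> K" "bicoeff (Q ^ ?k) i j \<in> K"
    using over bipoly_over_power[OF K over(2)] by (auto simp: bipoly_over_iff)
  ultimately have "c \<in> K" using cfield_divide[OF K] by simp
  thus ?thesis using that c by blast
qed

text \<open>Division with remainder: multiples of powers of \<open>Q\<close> are subtracted as long
  as \<open>degree_reduction_over\<close> applies. For deg Q = 1 the remainder cannot drop below
  degree 1, since components of an invertible map are not constant; hence the strict bound only from
  degree 2 on.\<close>

lemma jung_division:
  assumes K: "cfield K" and inv: "linv (polymap P Q)"
    and over: "P \<in> bipoly_over K" "Q \<in> bipoly_over K"
  shows "\<exists>p. (\<forall>i. Polynomial.coeff p i \<in> K) \<and> total_degree (P - unisubst Q p) \<le> total_degree Q \<and>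
    (total_degree Q \<ge> 2 \<longrightarrow> total_degree (P - unisubst Q p) < total_degree Q)"
    using inv over(1)
  proof (induction "total_degree P" arbitrary: P rule: less_induct)
    case less
    let ?n = "total_degree P" and ?q = "total_degree Q"
    show ?case
    proof (cases "?n < ?q \<or> (?n \<le> ?q \<and> ?q = 1)")
      case True
      thus ?thesis using cfield_0[OF K] by (intro exI[of _ 0]) auto
    next
      case False
      hence n: "?n \<ge> 2" "?q \<le> ?n" using linv_degree_pos[OF less.prems(1)] by auto
      obtain c where c: "c \<in> K" "c \<noteq> 0" "?q dvd ?n" "\<And>z. hcf ?n P z = c * hcf ?q Q z ^ (?n div ?q)"
        using degree_reduction_over[OF K less.prems over(2) n] by blast
      let ?k = "?n div ?q"
      have nk: "?k * ?q = ?n" using c(3) by simp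
      define m where "m = Polynomial.monom c ?k"
      define R where "R = P - unisubst Q m"
      have R': "R = P - [:[:c:]:] * Q ^ ?k" by (simp only: R_def m_def unisubst_monom)
      have "hcf ?n R z = 0" for z
        using hcf_power[of Q ?q ?k z] c(4)[of z] by (simp only: R' hcf_diff hcf_scale nk) simp
      moreover have "total_degree R \<le> ?n"
        unfolding R' using total_degree_power_le'[of Q ?q ?k] total_degree_scale_le[of c "Q ^ ?k"]
        by (intro total_degree_diff_le) (auto simp: nk)
      ultimately have R: "total_degree R < ?n" using hcf_eq_0_iff[of R ?n] n by auto
      have mK: "Polynomial.coeff m i \<in> K" for i using c(1) cfield_0[OF K] by (simp add: m_def)
      have "R \<in> bipoly_over K"
        unfolding R_def by (intro bipoly_over_diff K less.prems(2) unisubst_over mK over(2))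
      moreover have "linv (polymap R Q)" unfolding R_def by (rule linv_shift[OF less.prems(1)])
      ultimately obtain p where p: "\<And>i. Polynomial.coeff p i \<in> K"
          "total_degree (R - unisubst Q p) \<le> ?q" "?q \<ge> 2 \<Longrightarrow> total_degree (R - unisubst Q p) < ?q"
        using less.hyps[OF R] by blast
      have "R - unisubst Q p = P - unisubst Q (m + p)" by (simp add: R_def unisubst_add)
      moreover have "Polynomial.coeff (m + p) i \<in> K" for i using mK p(1) cfield_add[OF K] by simp
      ultimately show ?thesis using p(2,3) by (intro exI[of _ "m + p"]) auto
    qed
  qed

definition lf :: "complex ^ 2 \<Rightarrow> complex ^ 2 \<Rightarrow> complex" where
  "lf l z = l $ 1 * z $ 1 + l $ 2 * z $ 2"

text \<open>For nonzero vectors, \<open>cross v w = 0\<close> says that \<open>v\<close> and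
  \<open>w\<close> represent the same point at infinity.\<close>

definition cross :: "complex ^ 2 \<Rightarrow> complex ^ 2 \<Rightarrow> complex" where
  "cross v w = v $ 1 * w $ 2 - v $ 2 * w $ 1"

lemma hcf_1: "hcf 1 Q z = lf (vector [bicoeff Q 1 0, bicoeff Q 0 1]) z"
  by (simp add: hcf_def wtop_def lf_def atMost_Suc)

text \<open>Dividing \<open>P\<close> by \<open>Q\<close> leaves a remainder \<open>R\<close> of
  smaller degree than \<open>Q\<close>, and (Q, R) satisfies the hypotheses again. The leading form
  of \<open>Q\<close> is a multiple of a power of that of \<open>R\<close>, and the descent ends at
  degree 1, where the form is linear.\<close>

lemma lower_top_form:
  assumes "linv (polymap P Q)" "total_degree Q < total_degree P"
  shows "\<exists>l c. l \<noteq> 0 \<and> c \<noteq> 0 \<and> (\<forall>z. hcf (total_degree Q) Q z = c * lf l z ^ total_degree Q)"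
  using assms
proof (induction "total_degree Q" arbitrary: P Q rule: less_induct)
  case less
  let ?q = "total_degree Q"
  have q1: "?q \<ge> 1" by (rule linv_degree_pos(2)[OF less.prems(1)])
  hence Q0: "Q \<noteq> 0" by auto
  show ?case
  proof (cases "?q = 1")
    case True
    let ?l = "vector [bicoeff Q 1 0, bicoeff Q 0 1] :: complex ^ 2"
    obtain z where "hcf 1 Q z \<noteq> 0" using hcf_nonzero[OF Q0] True by metis
    moreover have "lf 0 z = 0" by (simp add: lf_def)
    ultimately have "?l \<noteq> 0" unfolding hcf_1 by metis
    thus ?thesis unfolding True hcf_1 by (intro exI[of _ ?l] exI[of _ 1]) simp
  next
    case False
    hence q2: "?q \<ge> 2" using q1 by simp
    obtain p where "?q \<ge> 2 \<longrightarrow> total_degree (P - unisubst Q p) < ?q"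
      using jung_division[OF cfield_UNIV less.prems(1) bipoly_over_UNIV bipoly_over_UNIV]
      by (elim exE conjE)
    hence p: "total_degree (P - unisubst Q p) < ?q" using q2 by (rule mp)
    define R where "R = P - unisubst Q p"
    have R: "linv (polymap Q R)" unfolding R_def by (rule linv_swap[OF linv_shift[OF less.prems(1)]])
    obtain l c where lc: "l \<noteq> 0" "c \<noteq> 0" "\<And>z. hcf (total_degree R) R z = c * lf l z ^ total_degree R"
      using less.hyps[of R Q] p R by (auto simp: R_def)
    obtain c' where c': "c' \<noteq> 0" "total_degree R dvd ?q"
        "\<And>z. hcf ?q Q z = c' * hcf (total_degree R) R z ^ (?q div total_degree R)"
      using degree_reduction_over[OF cfield_UNIV R bipoly_over_UNIV bipoly_over_UNIV q2] p
      by (auto simp: R_def)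
    have "hcf ?q Q z = c' * c ^ (?q div total_degree R) * lf l z ^ ?q" for z
      using c'(2) by (simp add: c'(3) lc(3) power_mult_distrib power_mult[symmetric])
    moreover have "c' * c ^ (?q div total_degree R) \<noteq> 0" using c'(1) lc(2) by simp
    ultimately show ?thesis using lc(1) by blast
  qed
qed

definition in_K2 :: "complex set \<Rightarrow> complex ^ 2 \<Rightarrow> bool" where
  "in_K2 K v \<longleftrightarrow> v $ 1 \<in> K \<and> v $ 2 \<in> K"

text \<open>Geometrically: the line at infinity is contracted to a single \<open>K\<close>-rational
  point. If the two degrees differ, this point lies on an axis. If they agree, the leading forms are
  proportional with a factor \<open>a\<close> in \<open>K\<close>, and replacing \<open>P\<close> by
  P - aQ reduces to different degrees.\<close>

lemma top_form_rank_one: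
  assumes K: "cfield K" and inv: "linv (polymap P Q)"
    and over: "P \<in> bipoly_over K" "Q \<in> bipoly_over K"
    and n: "n = max (total_degree P) (total_degree Q)" "n \<ge> 2"
  shows "\<exists>v l c. v \<noteq> 0 \<and> in_K2 K v \<and> l \<noteq> 0 \<and> c \<noteq> 0 \<and> topf n (polymap P Q) (\<lambda>z. (c * lf l z ^ n) *s v)"
proof -
  have topfI: "topf n (polymap P Q) t" if "\<And>z. t z $ 1 = hcf n P z" "\<And>z. t z $ 2 = hcf n Q z" for t
    unfolding topf_def using n that by (intro exI[of _ P] exI[of _ Q]) (auto simp: fun_eq_iff intro!: vec2_eqI)
  have bigger: "\<exists>l c. l \<noteq> 0 \<and> c \<noteq> 0 \<and> (\<forall>z. hcf (total_degree P) P z = c * lf l z ^ total_degree P)"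
    if inv: "linv (polymap P Q)" and deg: "total_degree Q < total_degree P" and n: "total_degree P \<ge> 2" for P Q
  proof -
    obtain l c where lc: "l \<noteq> 0" "c \<noteq> 0" "\<And>z. hcf (total_degree Q) Q z = c * lf l z ^ total_degree Q"
      using lower_top_form[OF inv deg] by blast
    obtain c' where c': "c' \<noteq> 0" "total_degree Q dvd total_degree P"
        "\<And>z. hcf (total_degree P) P z = c' * hcf (total_degree Q) Q z ^ (total_degree P div total_degree Q)"
      using degree_reduction_over[OF cfield_UNIV inv bipoly_over_UNIV bipoly_over_UNIV n] deg by auto
    have "hcf (total_degree P) P z = c' * c ^ (total_degree P div total_degree Q) * lf l z ^ total_degree P" for z
      using c'(2) by (simp add: c'(3) lc(3) power_mult_distrib power_mult[symmetric])
    moreover have "c' * c ^ (total_degree P div total_degree Q) \<noteq> 0" using c'(1) lc(2) by simp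
    ultimately show ?thesis using lc(1) by blast
  qed
  consider "total_degree Q < total_degree P" | "total_degree P < total_degree Q" | "total_degree P = total_degree Q"
    by linarith
  thus ?thesis
  proof cases
    case 1
    hence nP: "n = total_degree P" using n by simp
    obtain l c where lc: "l \<noteq> 0" "c \<noteq> 0" "\<And>z. hcf n P z = c * lf l z ^ n"
      using bigger[OF inv 1] n(2) nP by blast
    let ?v = "vector [1, 0] :: complex ^ 2"
    have "topf n (polymap P Q) (\<lambda>z. (c * lf l z ^ n) *s ?v)"
      using lc(3) hcf_eq_0_if_less[of Q n] 1 nP by (intro topfI) auto
    moreover have "?v \<noteq> 0" by (metis vector_2(1) zero_index zero_neq_one)
    moreover have "in_K2 K ?v" using K by (simp add: in_K2_def cfield_0 cfield_1)
    ultimately show ?thesis using lc by blast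
  next
    case 2
    hence nQ: "n = total_degree Q" using n by simp
    obtain l c where lc: "l \<noteq> 0" "c \<noteq> 0" "\<And>z. hcf n Q z = c * lf l z ^ n"
      using bigger[OF linv_swap[OF inv] 2] n(2) nQ by blast
    let ?v = "vector [0, 1] :: complex ^ 2"
    have "topf n (polymap P Q) (\<lambda>z. (c * lf l z ^ n) *s ?v)"
      using lc(3) hcf_eq_0_if_less[of P n] 2 nQ by (intro topfI) auto
    moreover have "?v \<noteq> 0" by (metis vector_2(2) zero_index zero_neq_one)
    moreover have "in_K2 K ?v" using K by (simp add: in_K2_def cfield_0 cfield_1)
    ultimately show ?thesis using lc by blast
  next
    case 3
    hence nPQ: "total_degree P = n" "total_degree Q = n" using n by auto
    obtain a where a: "a \<in> K" "a \<noteq> 0" and "\<And>z. hcf (total_degree P) P z =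
        a * hcf (total_degree Q) Q z ^ (total_degree P div total_degree Q)"
      by (rule degree_reduction_over[OF K inv over]) (use n(2) nPQ in auto)
    hence a': "hcf n P z = a * hcf n Q z" for z using n(2) by (simp add: nPQ)
    define R where "R = P - unisubst Q [:0, a:]"
    have u: "unisubst Q [:0, a:] = [:[:a:]:] * Q" by (simp add: unisubst_pCons)
    have "total_degree R \<le> n"
      unfolding R_def u using total_degree_scale_le[of a Q] nPQ by (intro total_degree_diff_le) auto
    moreover have "hcf n R z = 0" for z using a'[of z] by (simp only: R_def u hcf_diff hcf_scale) simp
    ultimately have R: "total_degree R < total_degree Q" using hcf_eq_0_iff[of R n] n(2) nPQ(2) by auto
    have "linv (polymap Q R)" unfolding R_def by (rule linv_swap[OF linv_shift[OF inv]])
    then obtain l c where lc: "l \<noteq> 0" "c \<noteq> 0" "\<And>z. hcf n Q z = c * lf l z ^ n"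
      using bigger[of Q R, OF _ R] n(2) unfolding nPQ by blast
    let ?v = "vector [a, 1] :: complex ^ 2"
    have "topf n (polymap P Q) (\<lambda>z. (c * lf l z ^ n) *s ?v)"
      using lc(3) a' by (intro topfI) auto
    moreover have "?v \<noteq> 0" by (metis vector_2(2) zero_index zero_neq_one)
    moreover have "in_K2 K ?v" using K a by (simp add: in_K2_def cfield_1)
    ultimately show ?thesis using lc by blast
  qed
qed

section \<open>Automorphisms: affine maps, triangular maps, directions\<close>

lemma aut_bij:
  assumes "F \<in> Aut_A2 K" shows "bij F"
  using assms unfolding Aut_A2_def by (auto intro: o_bij)

lemma aut_defined: "F \<in> Aut_A2 K \<Longrightarrow> defined_over K F"
  by (simp add: Aut_A2_def)

lemma autI:
  assumes "defined_over K F" "defined_over K G" "\<And>z. G (F z) = z" "\<And>z. F (G z) = z"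
  shows "F \<in> Aut_A2 K" and "inv F = G"
proof -
  have "G \<circ> F = id" "F \<circ> G = id" using assms(3,4) by (auto simp: fun_eq_iff)
  thus "F \<in> Aut_A2 K" "inv F = G" using assms(1,2) by (auto simp: Aut_A2_def intro: inv_unique_comp)
qed

lemma aut_inv_eq:
  assumes "F \<in> Aut_A2 K"
  shows "inv F (F z) = z" "F (inv F z) = z"
  using bij_is_inj[OF aut_bij[OF assms]] bij_is_surj[OF aut_bij[OF assms]] by (simp_all add: surj_f_inv_f)

lemma aut_inv:
  assumes "F \<in> Aut_A2 K" shows "inv F \<in> Aut_A2 K"
proof -
  obtain G where G: "defined_over K G" "G \<circ> F = id" "F \<circ> G = id" using assms by (auto simp: Aut_A2_def)
  hence "inv F = G" by (intro inv_unique_comp)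
  thus ?thesis using G assms by (auto simp: Aut_A2_def)
qed

lemma aut_inv_inv: "F \<in> Aut_A2 K \<Longrightarrow> inv (inv F) = F"
  using inv_inv_eq aut_bij by blast

lemma aut_comp:
  assumes "cfield K" "F \<in> Aut_A2 K" "G \<in> Aut_A2 K" shows "F \<circ> G \<in> Aut_A2 K"
proof (rule autI(1))
  show "defined_over K (F \<circ> G)" "defined_over K (inv G \<circ> inv F)"
    using assms aut_inv aut_defined by (auto intro!: defined_over_comp)
qed (use assms in \<open>simp_all add: aut_inv_eq\<close>)

lemma aut_inv_comp: "F \<in> Aut_A2 K \<Longrightarrow> G \<in> Aut_A2 L \<Longrightarrow> inv (F \<circ> G) = inv G \<circ> inv F"
  by (intro o_inv_distrib aut_bij)

lemma aut_id: "cfield K \<Longrightarrow> id \<in> Aut_A2 K"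
  by (rule autI(1)[of K id id]) (auto intro: defined_over_id)

lemma aut_mono: "K \<subseteq> L \<Longrightarrow> F \<in> Aut_A2 K \<Longrightarrow> F \<in> Aut_A2 L"
  unfolding Aut_A2_def using defined_over_mono by blast

lemma aut_UNIV: "F \<in> Aut_A2 K \<Longrightarrow> F \<in> Aut_A2 UNIV"
  by (rule aut_mono) auto

lemma aut_linv: "F \<in> Aut_A2 UNIV \<Longrightarrow> linv F"
  unfolding Aut_A2_def linv_def by blast

lemma aut_degree_pos:
  assumes "F \<in> Aut_A2 UNIV" shows "map_degree F \<ge> 1"
proof -
  obtain P Q where F: "F = polymap P Q" using aut_defined[OF assms] by (rule defined_overE)
  show ?thesis using linv_degree_pos[of P Q] aut_linv[OF assms] by (simp add: F map_degree_polymap)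
qed

lemma aut_comp_degree_le:
  "F \<in> Aut_A2 UNIV \<Longrightarrow> G \<in> Aut_A2 UNIV \<Longrightarrow> map_degree (F \<circ> G) \<le> map_degree F * map_degree G"
  by (intro map_degree_comp_le aut_defined)

lemma map_degree_id: "map_degree id = 1"
proof -
  have "map_degree id \<le> 1" using total_degree_bimonom_le[of 1 1 0] total_degree_bimonom_le[of 1 0 1]
    unfolding polymap_XY[symmetric] map_degree_polymap by simp
  thus ?thesis using aut_degree_pos[OF aut_id[OF cfield_UNIV]] by simp
qed

subsection \<open>Affine automorphisms\<close>

definition affmap :: "complex \<Rightarrow> complex \<Rightarrow> complex \<Rightarrow> complex \<Rightarrow> complex \<Rightarrow> complex \<Rightarrow> complex ^ 2 \<Rightarrow> complex ^ 2" where
  "affmap a b e c d f z = vector [a * z $ 1 + b * z $ 2 + e, c * z $ 1 + d * z $ 2 + f]"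

lemma affmap_nth [simp]:
  "affmap a b e c d f z $ 1 = a * z $ 1 + b * z $ 2 + e"
  "affmap a b e c d f z $ 2 = c * z $ 1 + d * z $ 2 + f"
  by (simp_all add: affmap_def)

definition afform :: "complex \<Rightarrow> complex \<Rightarrow> complex \<Rightarrow> complex poly poly" where
  "afform a b e = bimonom a 1 0 + bimonom b 0 1 + bimonom e 0 0"

lemma bieval_afform [simp]: "bieval (afform a b e) z = a * z $ 1 + b * z $ 2 + e"
  by (simp add: afform_def)

lemma total_degree_afform: "total_degree (afform a b e) \<le> 1"
  unfolding afform_def
  by (intro total_degree_add_le) (rule order_trans[OF total_degree_bimonom_le], simp)+

lemma afform_over: "cfield K \<Longrightarrow> a \<in> K \<Longrightarrow> b \<in> K \<Longrightarrow> e \<in> K \<Longrightarrow> afform a b e \<in> bipoly_over K"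
  unfolding afform_def by (intro bipoly_over_add bipoly_over_monom)

lemma affmap_polymap: "affmap a b e c d f = polymap (afform a b e) (afform c d f)"
  by (auto simp: fun_eq_iff intro!: vec2_eqI)

lemma affmap_degree: "map_degree (affmap a b e c d f) \<le> 1"
  using total_degree_afform by (simp add: affmap_polymap map_degree_polymap)

lemma affmap_defined:
  "cfield K \<Longrightarrow> a \<in> K \<Longrightarrow> b \<in> K \<Longrightarrow> e \<in> K \<Longrightarrow> c \<in> K \<Longrightarrow> d \<in> K \<Longrightarrow> f \<in> K \<Longrightarrow> defined_over K (affmap a b e c d f)"
  unfolding affmap_polymap by (intro defined_over_polymap afform_over)

lemma degree_le_1_form:
  assumes "total_degree P \<le> 1"
  shows "P = afform (bicoeff P 1 0) (bicoeff P 0 1) (bicoeff P 0 0)"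
proof (rule bipoly_eqI)
  fix i j
  have "bicoeff P i j = 0" if "i + j > 1"
    using that assms unfolding total_degree_le_iff by fastforce
  moreover have "i + j > 1 \<or> (i = 0 \<and> j = 0) \<or> (i = 1 \<and> j = 0) \<or> (i = 0 \<and> j = 1)" by linarith
  ultimately show "bicoeff P i j = bicoeff (afform (bicoeff P 1 0) (bicoeff P 0 1) (bicoeff P 0 0)) i j"
    by (auto simp: afform_def)
qed

lemma affmapE:
  assumes "defined_over K F" "map_degree F \<le> 1"
  obtains a b e c d f where "F = affmap a b e c d f" "{a, b, e, c, d, f} \<subseteq> K"
proof -
  obtain P Q where P: "P \<in> bipoly_over K" "Q \<in> bipoly_over K" "F = polymap P Q"
    using assms(1) by (rule defined_overE)
  have "total_degree P \<le> 1" "total_degree Q \<le> 1" using assms(2) P(3) by (auto simp: map_degree_polymap)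
  from this[THEN degree_le_1_form] have
    "F = affmap (bicoeff P 1 0) (bicoeff P 0 1) (bicoeff P 0 0) (bicoeff Q 1 0) (bicoeff Q 0 1) (bicoeff Q 0 0)"
    unfolding affmap_polymap P(3) by metis
  thus ?thesis by (rule that) (use P in \<open>auto simp: bipoly_over_iff\<close>)
qed

lemma affmap_aut:
  assumes K: "cfield K" "{a, b, e, c, d, f} \<subseteq> K" and det: "a * d - b * c \<noteq> 0"
  shows "affmap a b e c d f \<in> Aut_A2 K" "map_degree (inv (affmap a b e c d f)) \<le> 1"
proof -
  define D where "D = a * d - b * c"
  have D: "D \<noteq> 0" "D \<in> K" using det K by (auto simp: D_def intro!: cfield_diff cfield_mult)
  let ?G = "affmap (d / D) (- b / D) ((b * f - d * e) / D) (- c / D) (a / D) ((c * e - a * f) / D)"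
  have G: "defined_over K ?G" using K D
    by (intro affmap_defined) (auto intro!: cfield_divide cfield_diff cfield_mult cfield_minus)
  have F: "defined_over K (affmap a b e c d f)" using K by (intro affmap_defined) auto
  have div: "x / D * u + y / D * v + w / D = r" if "x * u + y * v + w = r * D" for x y u v w r
    using that D(1) by (simp add: add_divide_distrib[symmetric] eq_divide_eq)
  have GF: "?G (affmap a b e c d f z) = z" for z
    by (rule vec2_eqI; unfold affmap_nth, rule div) (simp_all add: D_def algebra_simps)
  have div': "x * (p / D * u + q / D * v + r / D) + y * (p' / D * u + q' / D * v + r' / D) + w = k"
    if "x * (p * u + q * v + r) + y * (p' * u + q' * v + r') + w * D = k * D" for x y p q r p' q' r' u v w k
  proof -
    have "x * (p / D * u + q / D * v + r / D) + y * (p' / D * u + q' / D * v + r' / D) + w =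
      (x * (p * u + q * v + r) + y * (p' * u + q' * v + r') + w * D) / D"
      using D(1) by (simp add: add_divide_distrib distrib_left)
    thus ?thesis using that D(1) by simp
  qed
  have FG: "affmap a b e c d f (?G z) = z" for z
    by (rule vec2_eqI; unfold affmap_nth, rule div') (simp_all add: D_def algebra_simps)
  show "affmap a b e c d f \<in> Aut_A2 K" by (rule autI(1)[OF F G GF FG])
  show "map_degree (inv (affmap a b e c d f)) \<le> 1"
    unfolding autI(2)[OF F G GF FG] by (rule affmap_degree)
qed

lemma affmap_inj_det:
  assumes "inj (affmap a b e c d f)" shows "a * d - b * c \<noteq> 0"
proof
  assume D: "a * d - b * c = 0"
  have "\<exists>w :: complex ^ 2. w \<noteq> 0 \<and> a * w $ 1 + b * w $ 2 = 0 \<and> c * w $ 1 + d * w $ 2 = 0"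
  proof -
    have nz: "vector [x, y] \<noteq> (0 :: complex ^ 2)" if "x \<noteq> 0 \<or> y \<noteq> 0" for x y
      using that by (metis vector_2 zero_index)
    consider "a \<noteq> 0 \<or> b \<noteq> 0" | "c \<noteq> 0 \<or> d \<noteq> 0" | "a = 0" "b = 0" "c = 0" "d = 0" by blast
    thus ?thesis
    proof cases
      case 1
      have "(vector [- b, a] :: complex ^ 2) \<noteq> 0" using 1 by (intro nz) auto
      thus ?thesis using D by (intro exI[of _ "vector [- b, a]"]) (simp add: algebra_simps)
    next
      case 2
      have "(vector [d, - c] :: complex ^ 2) \<noteq> 0" using 2 by (intro nz) auto
      thus ?thesis using D by (intro exI[of _ "vector [d, - c]"]) (simp add: algebra_simps)
    next
      case 3
      thus ?thesis using nz[of 1 0] by (intro exI[of _ "vector [1, 0]"]) simp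
    qed
  qed
  then obtain w :: "complex ^ 2" where w: "w \<noteq> 0" "a * w $ 1 + b * w $ 2 = 0" "c * w $ 1 + d * w $ 2 = 0" by blast
  have "affmap a b e c d f w = affmap a b e c d f 0" by (rule vec2_eqI) (simp_all add: w)
  thus False using assms w(1) by (auto dest: injD)
qed

lemma affine_aut:
  assumes "cfield K" "defined_over K F" "map_degree F \<le> 1" "inj F"
  shows "F \<in> Aut_A2 K" "map_degree (inv F) \<le> 1"
proof -
  obtain a b e c d f where F: "F = affmap a b e c d f" "{a, b, e, c, d, f} \<subseteq> K"
    using assms(2,3) by (rule affmapE)
  show "F \<in> Aut_A2 K" "map_degree (inv F) \<le> 1"
    using affmap_aut[OF assms(1) F(2)] affmap_inj_det assms(4) F(1) by blast+
qed

lemma affine_inv: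
  assumes "F \<in> Aut_A2 UNIV" "map_degree F \<le> 1" shows "map_degree (inv F) \<le> 1"
  using affine_aut(2)[OF cfield_UNIV aut_defined[OF assms(1)] assms(2)] aut_bij[OF assms(1)] by (auto simp: bij_def)

lemma nonaffine_inv:
  assumes "F \<in> Aut_A2 UNIV" "map_degree F \<ge> 2" shows "map_degree (inv F) \<ge> 2"
  using affine_inv[OF aut_inv[OF assms(1)]] aut_inv_inv[OF assms(1)] assms(2) by fastforce

text \<open>The linear part, for affine \<open>A\<close>; it describes the action of
  \<open>A\<close> on points at infinity.\<close>

definition lin :: "(complex ^ 2 \<Rightarrow> complex ^ 2) \<Rightarrow> complex ^ 2 \<Rightarrow> complex ^ 2" where
  "lin A z = A z - A 0"

lemma lin_affmap: "lin (affmap a b e c d f) z = affmap a b 0 c d 0 z"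
  by (rule vec2_eqI) (simp_all add: lin_def)

lemma topf_affine:
  assumes "A \<in> Aut_A2 UNIV" "map_degree A \<le> 1" shows "topf 1 A (lin A)"
proof -
  obtain a b e c d f where F: "A = affmap a b e c d f"
    using affmapE[OF aut_defined[OF assms(1)] assms(2)] by metis
  have "hcf 1 (afform a b e) z = a * z $ 1 + b * z $ 2" for a b e z
    unfolding hcf_1 lf_def by (simp add: afform_def)
  thus ?thesis unfolding F affmap_polymap topf_def using total_degree_afform
    by (intro exI conjI) (auto simp: lin_affmap[unfolded affmap_polymap] fun_eq_iff intro!: vec2_eqI)
qed

lemma lin_scale:
  assumes "A \<in> Aut_A2 UNIV" "map_degree A \<le> 1" shows "lin A (s *s z) = s *s lin A z"
proof -
  obtain a b e c d f where F: "A = affmap a b e c d f"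
    using affmapE[OF aut_defined[OF assms(1)] assms(2)] by metis
  show ?thesis unfolding F lin_affmap by (rule vec2_eqI) (simp_all add: algebra_simps)
qed

lemma lin_nonzero:
  assumes "A \<in> Aut_A2 UNIV" "v \<noteq> 0" shows "lin A v \<noteq> 0"
  using aut_bij[OF assms(1)] assms(2) unfolding lin_def bij_def by (auto dest: injD)

lemma lin_comp:
  assumes "A \<in> Aut_A2 UNIV" "map_degree A \<le> 1" "B \<in> Aut_A2 UNIV" "map_degree B \<le> 1"
  shows "lin (A \<circ> B) z = lin A (lin B z)"
proof -
  obtain a b e c d f where F: "A = affmap a b e c d f"
    using affmapE[OF aut_defined[OF assms(1)] assms(2)] by metis
  obtain a' b' e' c' d' f' where G: "B = affmap a' b' e' c' d' f'"
    using affmapE[OF aut_defined[OF assms(3)] assms(4)] by metis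
  show ?thesis unfolding F G by (rule vec2_eqI) (simp_all add: lin_def algebra_simps)
qed

lemma lin_cross:
  assumes "A \<in> Aut_A2 UNIV" "map_degree A \<le> 1"
  shows "cross (lin A v) (lin A w) = 0 \<longleftrightarrow> cross v w = 0"
proof -
  obtain a b e c d f where F: "A = affmap a b e c d f"
    using affmapE[OF aut_defined[OF assms(1)] assms(2)] by metis
  have "a * d - b * c \<noteq> 0"
    using affmap_inj_det[of a b e c d f] bij_is_inj[OF aut_bij[OF assms(1)]] F by simp
  moreover have "cross (lin A v) (lin A w) = (a * d - b * c) * cross v w"
    unfolding F lin_affmap cross_def by (simp add: algebra_simps)
  ultimately show ?thesis by simp
qed

subsection \<open>The direction of a non-affine automorphism\<close>

text \<open>The kernel of \<open>l\<close> is the point at infinity where \<open>F\<close> is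
  indeterminate; all other points at infinity go to the class of \<open>v\<close>.\<close>

definition XDL :: "(complex ^ 2 \<Rightarrow> complex ^ 2) \<Rightarrow> nat \<Rightarrow> complex \<Rightarrow> complex ^ 2 \<Rightarrow> complex ^ 2 \<Rightarrow> bool" where
  "XDL F n c l v \<longleftrightarrow> n \<ge> 2 \<and> v \<noteq> 0 \<and> l \<noteq> 0 \<and> c \<noteq> 0 \<and> topf n F (\<lambda>z. (c * lf l z ^ n) *s v)"

text \<open>\<open>v\<close> represents the point at infinity onto which the line at infinity is contracted by \<open>F\<close>.\<close>

definition XD :: "(complex ^ 2 \<Rightarrow> complex ^ 2) \<Rightarrow> complex ^ 2 \<Rightarrow> bool" where
  "XD F v \<longleftrightarrow> (\<exists>n c l. XDL F n c l v)"

lemma lf_surj: "l \<noteq> 0 \<Longrightarrow> \<exists>z. lf l z = 1"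
proof -
  assume "l \<noteq> 0"
  hence "l $ 1 \<noteq> 0 \<or> l $ 2 \<noteq> 0" using vec2_eqI[of l 0] by auto
  thus ?thesis
  proof
    assume "l $ 1 \<noteq> 0"
    thus ?thesis by (intro exI[of _ "vector [1 / l $ 1, 0]"]) (simp add: lf_def)
  next
    assume "l $ 2 \<noteq> 0"
    thus ?thesis by (intro exI[of _ "vector [0, 1 / l $ 2]"]) (simp add: lf_def)
  qed
qed

lemma lf_scale: "lf l (s *s z) = s * lf l z" by (simp add: lf_def algebra_simps)

lemma XDL_degree: "XDL F n c l v \<Longrightarrow> map_degree F = n"
proof -
  assume X: "XDL F n c l v"
  obtain z where "lf l z = 1" using lf_surj X by (auto simp: XDL_def)
  hence nz: "(c * lf l z ^ n) *s v \<noteq> 0" using X by (simp add: XDL_def)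
  have t: "topf n F (\<lambda>z. (c * lf l z ^ n) *s v)" "n \<ge> 1" using X by (auto simp: XDL_def)
  show ?thesis using topf_degree_eq[where z = z, OF t(1) _ t(2)] nz by simp
qed

lemma XD_degree: "XD F v \<Longrightarrow> map_degree F \<ge> 2"
  using XDL_degree by (auto simp: XD_def XDL_def)

lemma XD_nonzero: "XD F v \<Longrightarrow> v \<noteq> 0" by (auto simp: XD_def XDL_def)

lemma XDE:
  assumes "XD F v" obtains c l where "XDL F (map_degree F) c l v"
  using assms XDL_degree unfolding XD_def by metis

lemma XD_exists:
  assumes K: "cfield K" and F: "F \<in> Aut_A2 UNIV" "defined_over K F" "map_degree F \<ge> 2"
  obtains v where "in_K2 K v" "XD F v"
proof -
  obtain P Q where P: "P \<in> bipoly_over K" "Q \<in> bipoly_over K" "F = polymap P Q"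
    using F(2) by (rule defined_overE)
  show ?thesis
    using top_form_rank_one[OF K _ P(1,2) refl] aut_linv[OF F(1)] F(3) that
    unfolding P(3) XD_def XDL_def map_degree_polymap by blast
qed

lemma XD_exists_UNIV:
  assumes "F \<in> Aut_A2 UNIV" "map_degree F \<ge> 2" obtains v where "XD F v"
  using XD_exists[OF cfield_UNIV assms(1) aut_defined[OF assms(1)] assms(2)] by metis

lemma parallel_iff:
  assumes "v \<noteq> 0" shows "cross v w = 0 \<longleftrightarrow> (\<exists>s. w = s *s v)"
proof
  assume c: "cross v w = 0"
  have "v $ 1 \<noteq> 0 \<or> v $ 2 \<noteq> 0" using assms vec2_eqI[of v 0] by auto
  thus "\<exists>s. w = s *s v"
  proof
    assume "v $ 1 \<noteq> 0"
    thus ?thesis using c by (intro exI[of _ "w $ 1 / v $ 1"] vec2_eqI) (auto simp: cross_def field_simps)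
  next
    assume "v $ 2 \<noteq> 0"
    thus ?thesis using c by (intro exI[of _ "w $ 2 / v $ 2"] vec2_eqI) (auto simp: cross_def field_simps)
  qed
qed (auto simp: cross_def)

lemma cross_swap: "cross v w = 0 \<longleftrightarrow> cross w v = 0"
  by (auto simp: cross_def algebra_simps)

lemma cross_self [simp]: "cross v v = 0" by (simp add: cross_def)

lemma cross_trans:
  assumes "v \<noteq> 0" "cross u v = 0" "cross v w = 0" shows "cross u w = 0"
proof -
  obtain s where "w = s *s v" using parallel_iff[OF assms(1)] assms(3) by blast
  moreover obtain r where "u = r *s v" using parallel_iff[OF assms(1)] assms(2) cross_swap by blast
  ultimately show ?thesis by (simp add: cross_def)
qed

lemma XD_parallel:
  assumes "XD F v" "w \<noteq> 0" "cross v w = 0" shows "XD F w"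
proof -
  obtain s where s: "w = s *s v" using parallel_iff[OF XD_nonzero[OF assms(1)]] assms(3) by blast
  have s0: "s \<noteq> 0" using s assms(2) by auto
  obtain n c l where X: "XDL F n c l v" using assms(1) by (auto simp: XD_def)
  have "(c * lf l z ^ n) *s v = (c / s * lf l z ^ n) *s w" for z
    unfolding s using s0 by (simp add: vector_smult_assoc)
  hence "XDL F n (c / s) l w" using X s0 assms(2) by (simp add: XDL_def)
  thus ?thesis by (auto simp: XD_def)
qed

lemma XD_unique:
  assumes "XD F v" "XD F w" shows "cross v w = 0"
proof -
  obtain c l where v: "XDL F (map_degree F) c l v" using assms(1) by (rule XDE)
  obtain c' l' where w: "XDL F (map_degree F) c' l' w" using assms(2) by (rule XDE)
  let ?n = "map_degree F"
  have eq: "(c * lf l z ^ ?n) *s v = (c' * lf l' z ^ ?n) *s w" for z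
    by (rule fun_cong[OF topf_unique[of ?n F "\<lambda>z. (c * lf l z ^ ?n) *s v" "\<lambda>z. (c' * lf l' z ^ ?n) *s w"]])
      (use v w in \<open>auto simp: XDL_def\<close>)
  obtain z where z: "lf l z = 1" using lf_surj v by (auto simp: XDL_def)
  have "c *s v = (c' * lf l' z ^ ?n) *s w" using eq[of z] z by simp
  hence "v = (inverse c * (c' * lf l' z ^ ?n)) *s w"
    using v by (metis XDL_def vector_smult_assoc vector_smult_lid left_inverse)
  thus ?thesis by (metis XD_nonzero assms(2) cross_swap parallel_iff)
qed

text \<open>If \<open>l\<close> did not vanish at \<open>v'\<close>, the leading forms of
  \<open>F\<close> and its inverse would compose to something nonzero, and the identity would have
  degree n m \<ge> 4. So the indeterminacy point of \<open>F\<close> is the direction of its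
  inverse.\<close>

lemma XDL_inv:
  assumes F: "F \<in> Aut_A2 UNIV" and X: "XDL F n c l v" and X': "XD (inv F) v'"
  shows "lf l v' = 0"
proof (rule ccontr)
  assume nz: "lf l v' \<noteq> 0"
  obtain m c' l' where Y: "XDL (inv F) m c' l' v'" using X' by (auto simp: XD_def)
  have nm: "n \<ge> 2" "m \<ge> 2" using X Y by (auto simp: XDL_def)
  have "topf (n * m) (F \<circ> inv F) (\<lambda>z. (c * lf l ((c' * lf l' z ^ m) *s v') ^ n) *s v)"
    using X Y nm unfolding XDL_def by (intro topf_comp) auto
  moreover have "F \<circ> inv F = id" using aut_inv_eq[OF F] by auto
  ultimately have top: "topf (n * m) id (\<lambda>z. (c * lf l ((c' * lf l' z ^ m) *s v') ^ n) *s v)" by simp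
  have less: "map_degree id < n * m"
  proof -
    have "2 * 2 \<le> n * m" by (intro mult_le_mono nm)
    thus ?thesis by (simp add: map_degree_id)
  qed
  have 0: "(c * lf l ((c' * lf l' z ^ m) *s v') ^ n) *s v = 0" for z
    using topf_zero_if_less[OF top less] .
  obtain z where "lf l' z = 1" using lf_surj Y by (auto simp: XDL_def)
  thus False using 0[of z] X Y nz by (simp add: XDL_def lf_scale)
qed

text \<open>By \<open>XDL_inv\<close> the kernel of the linear form \<open>l\<close> of
  \<open>F\<close> is spanned by \<open>v'\<close>. Hence \<open>l\<close> does not vanish at
  \<open>w\<close>, and the composed leading form is nonzero.\<close>

theorem XD_comp:
  assumes F: "F \<in> Aut_A2 UNIV" and X: "XD F v" "XD (inv F) v'" "XD G w" and nc: "cross v' w \<noteq> 0"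
  shows "map_degree (F \<circ> G) = map_degree F * map_degree G" "XD (F \<circ> G) v"
proof -
  obtain n c l where XF: "XDL F n c l v" using X(1) by (auto simp: XD_def)
  obtain m c' l' where XG: "XDL G m c' l' w" using X(3) by (auto simp: XD_def)
  have lv': "lf l v' = 0" by (rule XDL_inv[OF F XF X(2)])
  have l0: "l \<noteq> 0" "c \<noteq> 0" "c' \<noteq> 0" using XF XG by (auto simp: XDL_def)
  have lw: "lf l w \<noteq> 0"
  proof
    assume lw: "lf l w = 0"
    have "l $ 1 * cross v' w = w $ 2 * lf l v' - v' $ 2 * lf l w"
      "l $ 2 * cross v' w = v' $ 1 * lf l w - w $ 1 * lf l v'"
      by (simp_all add: lf_def cross_def algebra_simps)
    hence "l = 0" using nc lv' lw by (intro vec2_eqI) auto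
    thus False using l0 by simp
  qed
  have nm: "n \<ge> 2" "m \<ge> 2" using XF XG by (auto simp: XDL_def)
  have "topf (n * m) (F \<circ> G) (\<lambda>z. (c * lf l ((c' * lf l' z ^ m) *s w) ^ n) *s v)"
    using XF XG nm unfolding XDL_def by (intro topf_comp) auto
  moreover have "c * lf l ((c' * lf l' z ^ m) *s w) ^ n = (c * c' ^ n * lf l w ^ n) * lf l' z ^ (n * m)" for z
    by (simp add: lf_scale power_mult_distrib power_mult[symmetric] mult.commute[of n m] algebra_simps)
  moreover have "2 \<le> n * m" using mult_le_mono[OF nm] by simp
  ultimately have "XDL (F \<circ> G) (n * m) (c * c' ^ n * lf l w ^ n) l' v"
    using XF XG lw by (simp add: XDL_def)
  thus "map_degree (F \<circ> G) = map_degree F * map_degree G" "XD (F \<circ> G) v"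
    using XDL_degree[OF XF] XDL_degree[OF XG] XDL_degree by (auto simp: XD_def)
qed

lemma XD_aff_left:
  assumes A: "A \<in> Aut_A2 UNIV" "map_degree A \<le> 1" and X: "XD F v"
  shows "XD (A \<circ> F) (lin A v)" "map_degree (A \<circ> F) = map_degree F"
proof -
  obtain n c l where XF: "XDL F n c l v" using X by (auto simp: XD_def)
  have "topf (1 * n) (A \<circ> F) (\<lambda>z. lin A ((c * lf l z ^ n) *s v))"
    using XF unfolding XDL_def by (intro topf_comp topf_affine A) auto
  hence "XDL (A \<circ> F) n c l (lin A v)" using XF lin_nonzero[OF A(1)] by (simp add: XDL_def lin_scale[OF A])
  thus "XD (A \<circ> F) (lin A v)" "map_degree (A \<circ> F) = map_degree F"
    using XDL_degree XF by (auto simp: XD_def)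
qed

lemma XD_aff_right:
  assumes A: "A \<in> Aut_A2 UNIV" "map_degree A \<le> 1" and X: "XD F v"
  shows "XD (F \<circ> A) v" "map_degree (F \<circ> A) = map_degree F"
proof -
  obtain n c l where XF: "XDL F n c l v" using X by (auto simp: XD_def)
  obtain a b e g d f where F: "A = affmap a b e g d f"
    using affmapE[OF aut_defined[OF A(1)] A(2)] by metis
  let ?l = "vector [l $ 1 * a + l $ 2 * g, l $ 1 * b + l $ 2 * d] :: complex ^ 2"
  have eq: "lf l (lin A z) = lf ?l z" for z
    unfolding F lin_affmap by (simp add: lf_def algebra_simps)
  have "topf (n * 1) (F \<circ> A) (\<lambda>z. (c * lf l (lin A z) ^ n) *s v)"
    using XF unfolding XDL_def by (intro topf_comp topf_affine A) auto
  moreover have "?l \<noteq> 0"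
  proof
    assume l0: "?l = 0"
    obtain z where z: "lf l z = 1" using lf_surj XF by (auto simp: XDL_def)
    have "lin A (inv A (z + A 0)) = z" using aut_inv_eq[OF A(1)] by (simp add: lin_def)
    hence "lf ?l (inv A (z + A 0)) = 1" using eq z by metis
    thus False unfolding l0 by (simp add: lf_def)
  qed
  ultimately have "XDL (F \<circ> A) n c ?l v" using XF by (simp add: XDL_def eq)
  thus "XD (F \<circ> A) v" "map_degree (F \<circ> A) = map_degree F"
    using XDL_degree XF by (auto simp: XD_def)
qed

subsection \<open>Triangular maps\<close>

text \<open>A shear along \<open>v\<close>: points move along \<open>v\<close> by an amount
  depending on the linear form that vanishes on \<open>v\<close>. For fixed \<open>v\<close> these
  maps compose by adding the polynomials.\<close>

definition tri :: "complex ^ 2 \<Rightarrow> complex poly \<Rightarrow> complex ^ 2 \<Rightarrow> complex ^ 2" where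
  "tri v p z = z + poly p (cross v z) *s v"

lemma cross_tri: "cross v (tri v p z) = cross v z"
  by (simp add: tri_def cross_def algebra_simps)

lemma tri_tri: "tri v p (tri v q z) = tri v (p + q) z"
  unfolding tri_def[of v p "tri v q z"] cross_tri by (simp add: tri_def vector_sadd_rdistrib)

lemma tri_0: "tri v 0 z = z" by (simp add: tri_def)

lemma tri_polymap:
  "tri v p = polymap (biX + [:[:v $ 1:]:] * unisubst (afform (- v $ 2) (v $ 1) 0) p)
     (biY + [:[:v $ 2:]:] * unisubst (afform (- v $ 2) (v $ 1) 0) p)"
proof -
  have c: "cross v z = - v $ 2 * z $ 1 + v $ 1 * z $ 2 + 0" for z by (simp add: cross_def)
  show ?thesis
    by (rule ext, rule vec2_eqI)
      (simp_all only: tri_def polymap_nth bieval_simps bieval_const bieval_unisubst bieval_afform c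
        vector_add_component vector_smult_component power_one_right power_0 mult_1 mult_1_right mult.commute)
qed

lemma tri_aut:
  assumes "cfield K" "in_K2 K v" "\<And>i. Polynomial.coeff p i \<in> K"
  shows "tri v p \<in> Aut_A2 K" "inv (tri v p) = tri v (- p)"
proof -
  have d: "defined_over K (tri v p)" if "\<And>i. Polynomial.coeff p i \<in> K" for p
    unfolding tri_polymap using assms(1,2) that
    by (intro defined_over_polymap bipoly_over_add bipoly_over_mult bipoly_over_const bipoly_over_monom unisubst_over afform_over)
      (auto simp: in_K2_def cfield_1 cfield_0 intro: cfield_minus)
  have d': "defined_over K (tri v (- p))" using assms(1,3) by (intro d) (auto intro: cfield_minus)
  show "tri v p \<in> Aut_A2 K" "inv (tri v p) = tri v (- p)"
    using autI[OF d[OF assms(3)] d'] by (auto simp: tri_tri tri_0)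
qed

lemma tri_aut_UNIV: "tri v p \<in> Aut_A2 UNIV" "inv (tri v p) = tri v (- p)"
  using tri_aut[OF cfield_UNIV] by (auto simp: in_K2_def)

lemma hcf_bimonom_less: "i + j < d \<Longrightarrow> hcf d (bimonom c i j) z = 0"
  using total_degree_bimonom_le[of c i j] by (intro hcf_eq_0_if_less) linarith

lemma tri_degree:
  assumes v: "v \<noteq> 0"
  shows tri_degree_le: "map_degree (tri v p) \<le> max 1 (Polynomial.degree p)"
    and tri_degree_eq: "Polynomial.degree p \<ge> 2 \<Longrightarrow> map_degree (tri v p) = Polynomial.degree p"
    and tri_XD: "Polynomial.degree p \<ge> 2 \<Longrightarrow> XD (tri v p) v"
proof -
  let ?C = "afform (- v $ 2) (v $ 1) 0"
  let ?k = "Polynomial.degree p"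
  let ?U = "unisubst ?C p"
  have U: "total_degree ?U \<le> ?k" using total_degree_unisubst_le[of ?C 1 p] total_degree_afform by simp
  have le: "total_degree (bimonom 1 i j + [:[:c:]:] * ?U) \<le> max 1 ?k" if "i + j \<le> 1" for i j c
    using total_degree_bimonom_le[of 1 i j] total_degree_scale_le[of c ?U] U that
    by (intro total_degree_add_le) auto
  show "map_degree (tri v p) \<le> max 1 ?k"
    unfolding tri_polymap map_degree_polymap by (intro max.boundedI le) auto
  assume k: "?k \<ge> 2"
  let ?l = "vector [- v $ 2, v $ 1] :: complex ^ 2"
  have "hcf ?k ?U z = Polynomial.lead_coeff p * lf ?l z ^ ?k" for z
    using hcf_unisubst[of ?C 1 p z] total_degree_afform unfolding hcf_1 by (simp add: afform_def)
  hence h: "hcf ?k (bimonom 1 i j + [:[:c:]:] * ?U) z = c * (Polynomial.lead_coeff p * lf ?l z ^ ?k)" if "i + j \<le> 1" for i j c z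
    using hcf_bimonom_less[of i j ?k 1 z] that k by (simp only: hcf_add hcf_scale) simp
  have "topf ?k (tri v p) (\<lambda>z. (Polynomial.lead_coeff p * lf ?l z ^ ?k) *s v)"
    unfolding tri_polymap topf_def
  proof (intro exI conjI)
    show "total_degree (biX + [:[:v $ 1:]:] * ?U) \<le> ?k" using le[of 1 0 "v $ 1"] k by simp
    show "total_degree (biY + [:[:v $ 2:]:] * ?U) \<le> ?k" using le[of 0 1 "v $ 2"] k by simp
    show "(\<lambda>z. (Polynomial.lead_coeff p * lf ?l z ^ ?k) *s v) = (\<lambda>z. vector
       [hcf ?k (biX + [:[:v $ 1:]:] * ?U) z, hcf ?k (biY + [:[:v $ 2:]:] * ?U) z])"
      using h[of 1 0 "v $ 1"] h[of 0 1 "v $ 2"] by (intro ext vec2_eqI) (simp_all add: mult.commute)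
  qed simp
  moreover have "Polynomial.lead_coeff p \<noteq> 0" using k by auto
  moreover have "?l \<noteq> 0" using v by (metis neg_equal_0_iff_equal vec2_eqI vector_2 zero_index)
  ultimately have X: "XDL (tri v p) ?k (Polynomial.lead_coeff p) ?l v" using k v by (simp add: XDL_def)
  show "map_degree (tri v p) = Polynomial.degree p" by (rule XDL_degree[OF X])
  show "XD (tri v p) v" using X by (auto simp: XD_def)
qed

lemma tri_affine_lin:
  assumes "v \<noteq> 0" shows "lin (tri v p) v = v"
  by (simp add: lin_def tri_def) (simp add: cross_def)

section \<open>Jung's theorem and conjugation to regular automorphisms\<close>

text \<open>Composition with \<open>tri v p\<close> removes the first triangular factor of
  \<open>F\<close>. What remains is affine or has a direction other than \<open>v\<close>, so
  writing the factor back multiplies degrees and cancels nothing.\<close>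

definition redn :: "complex set \<Rightarrow> complex ^ 2 \<Rightarrow> complex poly \<Rightarrow> (complex ^ 2 \<Rightarrow> complex ^ 2) \<Rightarrow> bool" where
  "redn K v p F \<longleftrightarrow> (\<forall>i. Polynomial.coeff p i \<in> K) \<and> Polynomial.degree p \<ge> 2 \<and>
     map_degree (tri v p \<circ> F) * Polynomial.degree p = map_degree F \<and>
     (map_degree (tri v p \<circ> F) \<le> 1 \<or> (\<exists>w. XD (tri v p \<circ> F) w \<and> cross v w \<noteq> 0))"

lemma vec2_nonzeroD: "v \<noteq> (0 :: complex ^ 2) \<Longrightarrow> v $ 1 \<noteq> 0 \<or> v $ 2 \<noteq> 0"
  using vec2_eqI[of v 0] by auto

lemma dual_basis:
  assumes K: "cfield K" and v: "in_K2 K v" "v \<noteq> 0"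
  obtains m u where "in_K2 K m" "in_K2 K u" "lf m v = 1" "lf m u = 0" "cross v u = 1"
    "\<And>z. z = lf m z *s v + cross v z *s u"
proof (cases "v $ 1 = 0")
  case False
  let ?m = "vector [1 / v $ 1, 0] :: complex ^ 2" and ?u = "vector [0, 1 / v $ 1] :: complex ^ 2"
  show ?thesis
  proof (rule that[of ?m ?u])
    fix z show "z = lf ?m z *s v + cross v z *s ?u"
      using False by (intro vec2_eqI) (simp_all add: lf_def cross_def diff_divide_distrib)
  qed (use False v K in \<open>auto simp: in_K2_def lf_def cross_def intro!: cfield_divide cfield_0 cfield_1\<close>)
next
  case True
  hence v2: "v $ 2 \<noteq> 0" using vec2_nonzeroD v by blast
  let ?m = "vector [0, 1 / v $ 2] :: complex ^ 2" and ?u = "vector [- 1 / v $ 2, 0] :: complex ^ 2"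
  show ?thesis
  proof (rule that[of ?m ?u])
    fix z show "z = lf ?m z *s v + cross v z *s ?u"
      using True v2 by (intro vec2_eqI) (simp_all add: lf_def cross_def)
  qed (use True v2 v K in \<open>auto simp: in_K2_def lf_def cross_def intro!: cfield_divide cfield_0 cfield_1 cfield_minus\<close>)
qed

lemma total_degree_lincomb:
  "total_degree P \<le> d \<Longrightarrow> total_degree Q \<le> d \<Longrightarrow> total_degree ([:[:a:]:] * P + [:[:b:]:] * Q) \<le> d"
  using total_degree_scale_le by (intro total_degree_add_le) (meson le_trans)+

text \<open>In the basis \<open>v\<close>, \<open>u\<close> the leading form of \<open>F\<close>
  lies along \<open>v\<close>, so the \<open>v\<close> component has degree \<open>n\<close> and the
  \<open>u\<close> component a smaller degree \<open>q\<close>. Dividing the first by the second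
  yields \<open>p\<close>. If q \<ge> 2, the remainder has degree below \<open>q\<close> and the
  direction becomes \<open>u\<close>; if q = 1, the rest is affine.\<close>

theorem triangular_reduction:
  assumes K: "cfield K" and F: "F \<in> Aut_A2 UNIV" "defined_over K F" and v: "in_K2 K v" "XD F v"
  shows "\<exists>p. redn K v p F"
proof -
  have v0: "v \<noteq> 0" by (rule XD_nonzero[OF v(2)])
  obtain m u where mu: "in_K2 K m" "in_K2 K u" "lf m v = 1" "lf m u = 0" "cross v u = 1"
    "\<And>z. z = lf m z *s v + cross v z *s u" using dual_basis[OF K v(1) v0] by metis
  obtain P Q where P: "P \<in> bipoly_over K" "Q \<in> bipoly_over K" "F = polymap P Q"
    using F(2) by (rule defined_overE)
  define n where "n = map_degree F"
  obtain c l where X: "XDL F n c l v" unfolding n_def using v(2) by (rule XDE)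
  have n2: "n \<ge> 2" using X by (simp add: XDL_def)
  have PQn: "total_degree P \<le> n" "total_degree Q \<le> n" by (auto simp: n_def P(3) map_degree_polymap)
  have "topf n F (\<lambda>z. vector [hcf n P z, hcf n Q z])" unfolding topf_def P(3) using PQn by blast
  from topf_unique[OF this] X have "(\<lambda>z. vector [hcf n P z, hcf n Q z]) = (\<lambda>z. (c * lf l z ^ n) *s v)"
    by (simp add: XDL_def)
  from fun_cong[OF this] have top: "vector [hcf n P z, hcf n Q z] = (c * lf l z ^ n) *s v" for z .
  have hP: "hcf n P z = c * lf l z ^ n * v $ 1" for z using arg_cong[OF top[of z], where f = "\<lambda>v. v $ 1"] by simp
  have hQ: "hcf n Q z = c * lf l z ^ n * v $ 2" for z using arg_cong[OF top[of z], where f = "\<lambda>v. v $ 2"] by simp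
  define P1 where "P1 = [:[:m $ 1:]:] * P + [:[:m $ 2:]:] * Q"
  define Q1 where "Q1 = [:[:- v $ 2:]:] * P + [:[:v $ 1:]:] * Q"
  have mvK: "m $ 1 \<in> K" "m $ 2 \<in> K" "- v $ 2 \<in> K" "v $ 1 \<in> K"
    using v(1) mu(1) cfield_minus[OF K] by (auto simp: in_K2_def)
  have over: "P1 \<in> bipoly_over K" "Q1 \<in> bipoly_over K" unfolding P1_def Q1_def
    by (intro bipoly_over_add bipoly_over_mult bipoly_over_const K P mvK)+
  have evP: "bieval P1 z = lf m (F z)" and evQ: "bieval Q1 z = cross v (F z)" for z
    by (simp_all only: P1_def Q1_def bieval_simps bieval_const lf_def cross_def P(3) polymap_nth) simp
  have deg1: "total_degree P1 \<le> n" "total_degree Q1 \<le> n"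
    unfolding P1_def Q1_def by (intro total_degree_lincomb PQn)+
  have h1: "hcf n P1 z = c * lf l z ^ n" for z
  proof -
    have "hcf n P1 z = c * lf l z ^ n * lf m v"
      by (simp only: P1_def hcf_add hcf_scale hP hQ lf_def) (simp add: algebra_simps)
    thus ?thesis by (simp add: mu(3))
  qed
  have h2: "hcf n Q1 z = 0" for z
    by (simp only: Q1_def hcf_add hcf_scale hP hQ) (simp add: algebra_simps)
  have Q1n: "total_degree Q1 < n" using hcf_eq_0_iff[OF deg1(2)] h2 n2 by auto
  have P1n: "total_degree P1 = n"
  proof (rule ccontr)
    assume "total_degree P1 \<noteq> n"
    hence "hcf n P1 z = 0" for z using deg1(1) by (intro hcf_eq_0_if_less) simp
    moreover obtain z where "lf l z = 1" using lf_surj X by (auto simp: XDL_def)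
    ultimately show False using h1[of z] X by (simp add: XDL_def)
  qed
  have "linv (affmap (m $ 1) (m $ 2) 0 (- v $ 2) (v $ 1) 0)"
  proof -
    have "m $ 1 * v $ 1 - m $ 2 * (- v $ 2) \<noteq> 0" using mu(3) by (simp add: lf_def algebra_simps)
    from affmap_aut(1)[OF cfield_UNIV _ this] show ?thesis by (intro aut_linv) auto
  qed
  moreover have "affmap (m $ 1) (m $ 2) 0 (- v $ 2) (v $ 1) 0 \<circ> F = polymap P1 Q1"
    by (intro ext vec2_eqI) (simp_all add: evP evQ lf_def cross_def)
  ultimately have lin: "linv (polymap P1 Q1)" using linv_comp aut_linv[OF F(1)] by metis
  define q where "q = total_degree Q1"
  have q1: "q \<ge> 1" using linv_degree_pos(2)[OF lin] by (simp add: q_def)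
  obtain p0 where p0: "\<And>i. Polynomial.coeff p0 i \<in> K" "total_degree (P1 - unisubst Q1 p0) \<le> q"
    "q \<ge> 2 \<Longrightarrow> total_degree (P1 - unisubst Q1 p0) < q"
    using jung_division[OF K lin over] unfolding q_def by metis
  define P2 where "P2 = P1 - unisubst Q1 p0"
  have dU: "total_degree (unisubst Q1 p0) = Polynomial.degree p0 * q"
    using total_degree_unisubst q1 by (simp add: q_def)
  \<comment> \<open>The remainder has degree at most \<open>q < n\<close>, so the degree
    \<open>n\<close> of \<open>P1\<close> comes from \<open>unisubst Q1 p0\<close> alone.\<close>
  have dn: "Polynomial.degree p0 * q = n"
  proof (rule antisym)
    have "unisubst Q1 p0 = P1 - P2" by (simp add: P2_def)
    hence "total_degree (unisubst Q1 p0) \<le> n"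
      using total_degree_diff_le[of P1 n P2] deg1(1) p0(2) Q1n by (simp add: P2_def q_def)
    thus "Polynomial.degree p0 * q \<le> n" using dU by simp
    have "P1 = P2 + unisubst Q1 p0" by (simp add: P2_def)
    hence "n \<le> max q (Polynomial.degree p0 * q)"
      using total_degree_add_le[of P2 "max q (Polynomial.degree p0 * q)" "unisubst Q1 p0"] dU p0(2) P1n
      by (simp add: P2_def)
    thus "n \<le> Polynomial.degree p0 * q" using Q1n by (simp add: q_def max_def split: if_splits)
  qed
  have degp: "Polynomial.degree p0 \<ge> 2"
  proof (rule ccontr)
    assume "\<not> 2 \<le> Polynomial.degree p0"
    hence "Polynomial.degree p0 * q \<le> 1 * q" by (intro mult_le_mono1) simp
    thus False using dn Q1n unfolding q_def by linarith
  qed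
  define p where "p = - p0"
  define E where "E = tri v p \<circ> F"
  have E: "E = polymap ([:[:v $ 1:]:] * P2 + [:[:u $ 1:]:] * Q1) ([:[:v $ 2:]:] * P2 + [:[:u $ 2:]:] * Q1)"
  proof
    fix z
    have "F z = bieval P1 z *s v + bieval Q1 z *s u" using mu(6)[of "F z"] by (simp add: evP evQ)
    hence "E z = bieval P2 z *s v + bieval Q1 z *s u"
      by (simp add: E_def p_def tri_def P2_def bieval_unisubst evQ vector_ssub_ldistrib vector_sadd_rdistrib algebra_simps)
    thus "E z = polymap ([:[:v $ 1:]:] * P2 + [:[:u $ 1:]:] * Q1) ([:[:v $ 2:]:] * P2 + [:[:u $ 2:]:] * Q1) z"
      by (intro vec2_eqI) (simp_all only: polymap_nth bieval_simps bieval_const vector_add_component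
        vector_smult_component mult.commute)
  qed
  have Eaut: "E \<in> Aut_A2 UNIV" unfolding E_def by (intro aut_comp cfield_UNIV tri_aut_UNIV F(1))
  have P2q: "total_degree P2 \<le> q" using p0(2) by (simp add: P2_def)
  have topE: "topf q E (\<lambda>z. vector [v $ 1 * hcf q P2 z + u $ 1 * hcf q Q1 z, v $ 2 * hcf q P2 z + u $ 2 * hcf q Q1 z])"
  proof -
    let ?A = "[:[:v $ 1:]:] * P2 + [:[:u $ 1:]:] * Q1" and ?B = "[:[:v $ 2:]:] * P2 + [:[:u $ 2:]:] * Q1"
    have "total_degree Q1 \<le> q" by (simp add: q_def)
    hence "total_degree ?A \<le> q" "total_degree ?B \<le> q" by (intro total_degree_lincomb P2q, assumption)+
    hence "topf q E (\<lambda>z. vector [hcf q ?A z, hcf q ?B z])" unfolding E topf_def by blast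
    thus ?thesis by (simp only: hcf_add hcf_scale)
  qed
  have degE: "map_degree E \<le> q" by (rule topf_degree_le[OF topE])
  have dir: "map_degree E = q \<and> (map_degree E \<le> 1 \<or> (\<exists>w. XD E w \<and> cross v w \<noteq> 0))"
  proof (cases "q = 1")
    case True
    thus ?thesis using degE aut_degree_pos[OF Eaut] by simp
  next
    case False
    hence q2: "q \<ge> 2" using q1 by simp
    obtain l' c' where lc: "l' \<noteq> 0" "c' \<noteq> 0" "\<And>z. hcf q Q1 z = c' * lf l' z ^ q"
      using lower_top_form[OF lin] Q1n P1n unfolding q_def by blast
    have "hcf q P2 z = 0" for z using p0(3)[OF q2] by (intro hcf_eq_0_if_less) (simp add: P2_def)
    hence "(\<lambda>z. vector [v $ 1 * hcf q P2 z + u $ 1 * hcf q Q1 z, v $ 2 * hcf q P2 z + u $ 2 * hcf q Q1 z])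
       = (\<lambda>z. (c' * lf l' z ^ q) *s u)"
      by (intro ext vec2_eqI) (simp_all add: lc(3))
    moreover have "u \<noteq> 0" using mu(5) by (auto simp: cross_def)
    ultimately have X': "XDL E q c' l' u" using topE q2 lc by (simp add: XDL_def)
    hence "XD E u" by (auto simp: XD_def)
    moreover have "cross v u \<noteq> 0" using mu(5) by simp
    ultimately show ?thesis using XDL_degree[OF X'] by blast
  qed
  have "redn K v p F"
    unfolding redn_def E_def[symmetric]
  proof (intro conjI allI)
    show "Polynomial.coeff p i \<in> K" for i using p0(1) cfield_minus[OF K] by (simp add: p_def)
    show "2 \<le> Polynomial.degree p" using degp by (simp add: p_def)
    have "map_degree E = q" using dir by blast
    thus "map_degree E * Polynomial.degree p = map_degree F" using dn by (simp add: p_def n_def mult.commute)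
    show "map_degree E \<le> 1 \<or> (\<exists>w. XD E w \<and> cross v w \<noteq> 0)" using dir by blast
  qed
  thus ?thesis by blast
qed

lemma tri_cancel: "tri v (- p) \<circ> (tri v p \<circ> F) = F" "tri v p \<circ> (tri v (- p) \<circ> F) = F"
  by (simp_all add: fun_eq_iff tri_tri tri_0)

text \<open>The inverse also has coefficients in \<open>K\<close>: triangular factors over
  \<open>K\<close> are removed until an affine map over \<open>K\<close> remains, and all these
  factors have inverses over \<open>K\<close>.\<close>

theorem aut_over:
  assumes K: "cfield K" and F: "F \<in> Aut_A2 UNIV" "defined_over K F"
  shows "F \<in> Aut_A2 K"
  using F
proof (induction "map_degree F" arbitrary: F rule: less_induct)
  case less
  show ?case
  proof (cases "map_degree F \<le> 1")
    case True
    thus ?thesis using affine_aut(1)[OF K less.prems(2)] bij_is_inj[OF aut_bij[OF less.prems(1)]] by blast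
  next
    case False
    hence "map_degree F \<ge> 2" by simp
    then obtain v where v: "in_K2 K v" "XD F v" using XD_exists[OF K less.prems] by metis
    obtain p where p: "redn K v p F" using triangular_reduction[OF K less.prems v] by blast
    let ?E = "tri v p \<circ> F"
    have tK: "tri v p \<in> Aut_A2 K" "tri v (- p) \<in> Aut_A2 K"
      using p cfield_minus[OF K] by (auto simp: redn_def intro!: tri_aut K v)
    have E: "?E \<in> Aut_A2 UNIV" by (intro aut_comp cfield_UNIV tri_aut_UNIV less.prems)
    have "map_degree ?E < map_degree F"
    proof -
      have "map_degree ?E * 1 < map_degree ?E * Polynomial.degree p"
        using p aut_degree_pos[OF E] by (intro mult_strict_left_mono) (auto simp: redn_def)
      moreover have "map_degree ?E * Polynomial.degree p = map_degree F" using p by (simp add: redn_def)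
      ultimately show ?thesis by linarith
    qed
    moreover have "defined_over K ?E" by (intro defined_over_comp K aut_defined tK less.prems)
    ultimately have "?E \<in> Aut_A2 K" using less.hyps E by blast
    from aut_comp[OF K tK(2) this] show ?thesis by (simp only: tri_cancel)
  qed
qed

text \<open>Non-cancellation is a condition on \<open>v'\<close> and \<open>w\<close> that is
  symmetric under passing to inverses, so \<open>XD_comp\<close> applies to the inverse as
  well.\<close>

lemma XD_comp_inv:
  assumes F: "F \<in> Aut_A2 UNIV" and G: "G \<in> Aut_A2 UNIV"
    and X: "XD F v" "XD (inv F) v'" "XD G w" "XD (inv G) w'" and nc: "cross v' w \<noteq> 0"
  shows "map_degree (F \<circ> G) = map_degree F * map_degree G" "XD (F \<circ> G) v" "XD (inv (F \<circ> G)) w'"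
proof -
  show "map_degree (F \<circ> G) = map_degree F * map_degree G" "XD (F \<circ> G) v"
    using XD_comp[OF F X(1-3) nc] by auto
  show "XD (inv (F \<circ> G)) w'"
    unfolding aut_inv_comp[OF F G]
    by (rule XD_comp(2)[OF aut_inv[OF G] X(4) _ X(2)])
      (use X(3) nc in \<open>simp_all add: aut_inv_inv[OF G] cross_swap\<close>)
qed

lemma XD_inv_exists:
  assumes "F \<in> Aut_A2 UNIV" "XD F v" obtains v' where "XD (inv F) v'"
  using XD_exists_UNIV[OF aut_inv[OF assms(1)]] nonaffine_inv[OF assms(1) XD_degree[OF assms(2)]] by metis

lemma tri_XD_both:
  assumes "v \<noteq> 0" "Polynomial.degree p \<ge> 2"
  shows "XD (tri v p) v" "XD (inv (tri v p)) v" "map_degree (tri v p) = Polynomial.degree p"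
  using tri_XD[OF assms] tri_XD[OF assms(1), of "- p"] tri_degree_eq[OF assms] assms(2)
  by (simp_all add: tri_aut_UNIV(2))

text \<open>The direction \<open>y\<close> at the far end is the same for all \<open>s\<close> of
  degree at least 2. It can be computed with one triangular factor and used with another.\<close>

lemma tri_comp_directions:
  assumes v: "v \<noteq> 0" and g: "g \<in> Aut_A2 UNIV"
    and dir: "map_degree g \<le> 1 \<or> (\<exists>w. XD g w \<and> cross v w \<noteq> 0)"
  obtains y where "\<And>s. Polynomial.degree s \<ge> 2 \<Longrightarrow> XD (tri v s \<circ> g) v \<and> XD (inv (tri v s \<circ> g)) y \<and>
      map_degree (tri v s \<circ> g) = Polynomial.degree s * map_degree g"
    "map_degree g \<ge> 2 \<Longrightarrow> XD (inv g) y" "map_degree g \<le> 1 \<Longrightarrow> y = lin (inv g) v"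
proof (cases "map_degree g \<le> 1")
  case True
  have "XD (tri v s \<circ> g) v \<and> XD (inv (tri v s \<circ> g)) (lin (inv g) v) \<and>
      map_degree (tri v s \<circ> g) = Polynomial.degree s * map_degree g" if s: "Polynomial.degree s \<ge> 2" for s
  proof (intro conjI)
    show "XD (tri v s \<circ> g) v" using XD_aff_right(1)[OF g True] tri_XD[OF v s] .
    show "map_degree (tri v s \<circ> g) = Polynomial.degree s * map_degree g"
      using XD_aff_right(2)[OF g True tri_XD[OF v s]] True aut_degree_pos[OF g] tri_XD_both(3)[OF v s] by simp
    show "XD (inv (tri v s \<circ> g)) (lin (inv g) v)"
      unfolding aut_inv_comp[OF tri_aut_UNIV(1) g]
      using XD_aff_left(1)[OF aut_inv[OF g] affine_inv[OF g True]] tri_XD_both(2)[OF v s] .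
  qed
  thus ?thesis using that True by auto
next
  case False
  then obtain w where w: "XD g w" "cross v w \<noteq> 0" using dir by blast
  obtain y where y: "XD (inv g) y" using XD_inv_exists[OF g w(1)] .
  have "XD (tri v s \<circ> g) v \<and> XD (inv (tri v s \<circ> g)) y \<and>
      map_degree (tri v s \<circ> g) = Polynomial.degree s * map_degree g" if s: "Polynomial.degree s \<ge> 2" for s
    using XD_comp_inv[OF tri_aut_UNIV(1) g tri_XD_both(1,2)[OF v s] w(1) y w(2)] tri_XD_both(3)[OF v s] by simp
  thus ?thesis using that y False by auto
qed

text \<open>Induction over the removed triangular factors: a reduced product stays reduced when it
  is inverted, so both degrees are the same product of degrees of factors.\<close>

theorem map_degree_inv:
  assumes F: "F \<in> Aut_A2 UNIV"
  shows "map_degree (inv F) = map_degree F"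
  using F
proof (induction "map_degree F" arbitrary: F rule: less_induct)
  case less
  show ?case
  proof (cases "map_degree F \<le> 1")
    case True
    thus ?thesis using affine_inv[OF less.prems] aut_degree_pos[OF less.prems] aut_degree_pos[OF aut_inv[OF less.prems]] by simp
  next
    case False
    hence "map_degree F \<ge> 2" by simp
    then obtain v where v: "XD F v" using XD_exists_UNIV[OF less.prems] by metis
    have v0: "v \<noteq> 0" by (rule XD_nonzero[OF v])
    obtain p where p: "redn UNIV v p F"
      using triangular_reduction[OF cfield_UNIV less.prems aut_defined[OF less.prems] _ v] by (auto simp: in_K2_def)
    define E where "E = tri v p \<circ> F"
    have E: "E \<in> Aut_A2 UNIV" unfolding E_def by (intro aut_comp cfield_UNIV tri_aut_UNIV less.prems)
    have p2: "Polynomial.degree p \<ge> 2" using p by (simp add: redn_def)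
    have dF: "map_degree F = map_degree E * Polynomial.degree p" using p by (simp add: redn_def E_def)
    have "map_degree E * 1 < map_degree E * Polynomial.degree p"
      using p2 aut_degree_pos[OF E] by (intro mult_strict_left_mono) auto
    hence IH: "map_degree (inv E) = map_degree E" using less.hyps[OF _ E] dF by simp
    have "F = tri v (- p) \<circ> E" by (simp add: E_def tri_cancel)
    hence iF: "inv F = inv E \<circ> tri v p" using aut_inv_comp[OF tri_aut_UNIV(1) E] tri_aut_UNIV(2)[of v "- p"] by simp
    show ?thesis
    proof (cases "map_degree E \<le> 1")
      case True
      show ?thesis unfolding iF dF
        using XD_aff_left(2)[OF aut_inv[OF E] affine_inv[OF E True] tri_XD_both(1)[OF v0 p2]]
          tri_XD_both(3)[OF v0 p2] True aut_degree_pos[OF E] by simp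
    next
      case False
      then obtain w where w: "XD E w" "cross v w \<noteq> 0" using p by (auto simp: redn_def E_def)
      obtain w' where w': "XD (inv E) w'" using XD_inv_exists[OF E w(1)] .
      have "map_degree (inv E \<circ> tri v p) = map_degree (inv E) * map_degree (tri v p)"
        by (rule XD_comp(1)[OF aut_inv[OF E] w' _ tri_XD_both(1)[OF v0 p2]])
          (use w(1) in \<open>simp add: aut_inv_inv[OF E]\<close>, use w(2) cross_swap in blast)
      thus ?thesis unfolding iF dF using IH tri_XD_both(3)[OF v0 p2] by simp
    qed
  qed
qed

section \<open>Regular automorphisms and conjugation to them\<close>

definition regular :: "(complex ^ 2 \<Rightarrow> complex ^ 2) \<Rightarrow> bool" where
  "regular f \<longleftrightarrow> (\<exists>v v'. XD f v \<and> XD (inv f) v' \<and> cross v v' \<noteq> 0)"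

lemma not_regularI:
  assumes "XD f x" "XD (inv f) y" "cross x y = 0" shows "\<not> regular f"
proof
  assume "regular f"
  then obtain v v' where v: "XD f v" "XD (inv f) v'" "cross v v' \<noteq> 0" by (auto simp: regular_def)
  have "cross v x = 0" "cross y v' = 0" using XD_unique v assms by blast+
  hence "cross v v' = 0" using cross_trans[OF XD_nonzero[OF assms(1)]] cross_trans[OF XD_nonzero[OF assms(2)]] assms(3) by blast
  thus False using v(3) by simp
qed

lemma regular_cross: "regular f \<Longrightarrow> XD f x \<Longrightarrow> XD (inv f) y \<Longrightarrow> cross x y \<noteq> 0"
  using not_regularI by blast

lemma affine_preserving_direction:
  assumes v: "v \<noteq> 0" and E: "E = affmap a b e c d g" and par: "cross v (lin E v) = 0"
  obtains \<alpha> \<beta> where "\<And>w. cross v (E w) = \<alpha> * cross v w + \<beta>"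
proof -
  have z: "(v $ 1 * c - v $ 2 * a) * v $ 1 + (v $ 1 * d - v $ 2 * b) * v $ 2 = 0"
    using par unfolding E lin_affmap cross_def by (simp add: algebra_simps)
  have "\<exists>\<alpha>. v $ 1 * d - v $ 2 * b = \<alpha> * v $ 1 \<and> v $ 1 * c - v $ 2 * a = - \<alpha> * v $ 2"
  proof (cases "v $ 1 = 0")
    case False
    hence "v $ 1 * c - v $ 2 * a = - ((v $ 1 * d - v $ 2 * b) / v $ 1) * v $ 2"
      using z by (simp add: eq_neg_iff_add_eq_0 add_divide_eq_iff)
    thus ?thesis using False by (intro exI[of _ "(v $ 1 * d - v $ 2 * b) / v $ 1"]) simp
  next
    case True
    hence "v $ 2 \<noteq> 0" using vec2_nonzeroD[OF v] by simp
    thus ?thesis using True z by (intro exI[of _ a]) simp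
  qed
  then obtain \<alpha> where \<alpha>: "v $ 1 * d - v $ 2 * b = \<alpha> * v $ 1" "v $ 1 * c - v $ 2 * a = - \<alpha> * v $ 2" by blast
  have "cross v (E w) = \<alpha> * cross v w + (v $ 1 * g - v $ 2 * e)" for w
  proof -
    have "cross v (E w) = (v $ 1 * c - v $ 2 * a) * w $ 1 + (v $ 1 * d - v $ 2 * b) * w $ 2 + (v $ 1 * g - v $ 2 * e)"
      unfolding E cross_def by (simp add: algebra_simps)
    thus ?thesis unfolding \<alpha> cross_def by (simp add: algebra_simps)
  qed
  thus ?thesis using that by blast
qed

text \<open>\<open>E\<close> preserves the lines parallel to \<open>v\<close>, so the form
  \<open>cross v\<close> goes to an affine function of itself under \<open>f\<close>. Along the
  iteration it keeps degree at most 1; each step adds \<open>p\<close> of such a function, and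
  degrees do not multiply. The induction therefore also records the degree of \<open>cross v\<close>
  on the iterates.\<close>

lemma triangular_bounded:
  assumes v: "v \<noteq> 0" and E: "E \<in> Aut_A2 UNIV" "map_degree E \<le> 1" and par: "cross v (lin E v) = 0"
    and f: "f = tri v p \<circ> E"
  shows "map_degree (f ^^ n) \<le> max 1 (Polynomial.degree p)"
proof -
  obtain a b e c d g where EA: "E = affmap a b e c d g"
    using affmapE[OF aut_defined[OF E(1)] E(2)] by metis
  obtain \<alpha> \<beta> where ab: "\<And>w. cross v (E w) = \<alpha> * cross v w + \<beta>"
    using affine_preserving_direction[OF v EA par] by metis
  let ?k = "max 1 (Polynomial.degree p)"
  have "\<exists>P Q. f ^^ n = polymap P Q \<and> total_degree P \<le> ?k \<and> total_degree Q \<le> ?k \<and>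
     total_degree ([:[:- v $ 2:]:] * P + [:[:v $ 1:]:] * Q) \<le> 1"
  proof (induction n)
    case 0
    have "total_degree biX \<le> 1" "total_degree biY \<le> 1" using total_degree_bimonom_le[of 1] by (metis add_0_right add_0 total_degree_bimonom_le)+
    thus ?case using polymap_XY by (intro exI[of _ biX] exI[of _ biY] conjI total_degree_lincomb) (auto simp: id_def)
  next
    case (Suc n)
    then obtain P Q where PQ: "f ^^ n = polymap P Q" "total_degree P \<le> ?k" "total_degree Q \<le> ?k"
       "total_degree ([:[:- v $ 2:]:] * P + [:[:v $ 1:]:] * Q) \<le> 1" by blast
    define C where "C = [:[:\<alpha>:]:] * ([:[:- v $ 2:]:] * P + [:[:v $ 1:]:] * Q) + [:[:\<beta>:]:]"
    have C: "total_degree C \<le> 1" unfolding C_def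
      using PQ(4) total_degree_scale_le by (intro total_degree_add_le) (auto intro: le_trans)
    have evC: "bieval C z = cross v (E (polymap P Q z))" for z
      unfolding ab C_def by (simp only: bieval_simps bieval_const cross_def polymap_nth) simp
    define U where "U = unisubst C p"
    have U: "total_degree U \<le> ?k" using total_degree_unisubst_le[OF C, of p] by (simp add: U_def)
    define P' where "P' = [:[:a:]:] * P + [:[:b:]:] * Q + [:[:e:]:]"
    define Q' where "Q' = [:[:c:]:] * P + [:[:d:]:] * Q + [:[:g:]:]"
    have P'k: "total_degree P' \<le> ?k" "total_degree Q' \<le> ?k" unfolding P'_def Q'_def
      by (rule total_degree_add_le[OF total_degree_lincomb[OF PQ(2,3)]], simp)+
    have EP: "E (polymap P Q z) = polymap P' Q' z" for z
      by (rule vec2_eqI) (simp_all only: P'_def Q'_def EA affmap_nth polymap_nth bieval_simps bieval_const)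
    have fz: "(f ^^ Suc n) z = polymap (P' + [:[:v $ 1:]:] * U) (Q' + [:[:v $ 2:]:] * U) z" for z
    proof -
      have "(f ^^ Suc n) z = tri v p (E (polymap P Q z))" by (simp add: PQ(1)) (simp add: f)
      also have "\<dots> = polymap P' Q' z + bieval U z *s v"
        by (simp only: tri_def U_def bieval_unisubst evC EP)
      also have "\<dots> = polymap (P' + [:[:v $ 1:]:] * U) (Q' + [:[:v $ 2:]:] * U) z"
        by (rule vec2_eqI) (simp_all only: polymap_nth bieval_simps bieval_const vector_add_component
          vector_smult_component mult.commute)
      finally show ?thesis .
    qed
    have "[:[:- v $ 2:]:] * (P' + [:[:v $ 1:]:] * U) + [:[:v $ 1:]:] * (Q' + [:[:v $ 2:]:] * U) = C"
    proof (subst bieval_inject[symmetric], rule ext)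
      fix z
      have "bieval ([:[:- v $ 2:]:] * (P' + [:[:v $ 1:]:] * U) + [:[:v $ 1:]:] * (Q' + [:[:v $ 2:]:] * U)) z
        = cross v (polymap P' Q' z)"
        by (simp only: bieval_simps bieval_const cross_def polymap_nth) (simp add: algebra_simps)
      thus "bieval ([:[:- v $ 2:]:] * (P' + [:[:v $ 1:]:] * U) + [:[:v $ 1:]:] * (Q' + [:[:v $ 2:]:] * U)) z = bieval C z"
        by (simp only: evC EP)
    qed
    hence "total_degree ([:[:- v $ 2:]:] * (P' + [:[:v $ 1:]:] * U) + [:[:v $ 1:]:] * (Q' + [:[:v $ 2:]:] * U)) \<le> 1"
      using C by simp
    moreover have "total_degree (P' + [:[:v $ 1:]:] * U) \<le> ?k" "total_degree (Q' + [:[:v $ 2:]:] * U) \<le> ?k"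
      using P'k U total_degree_scale_le by (meson total_degree_add_le le_trans)+
    moreover have "f ^^ Suc n = polymap (P' + [:[:v $ 1:]:] * U) (Q' + [:[:v $ 2:]:] * U)"
      by (rule ext) (rule fz)
    ultimately show ?case by blast
  qed
  thus ?thesis by (auto simp: map_degree_polymap)
qed

lemma tri_minus_eq: "inv (tri v p) = tri v (- p)" by (rule tri_aut_UNIV(2))

text \<open>\<open>f\<close> begins and ends with a triangular factor along the same
  \<open>v\<close>, or it is affine up to one such factor and then has bounded degrees. In the first
  case f = \<open>tri v (- p) \<circ> m \<circ> tri v p'\<close>, and conjugating by the factor of
  smaller degree merges the two into \<open>tri v (p' - p)\<close>, whose degree is at most the
  larger one. The smaller factor is gained.\<close>

lemma conjugation_step:
  assumes K: "cfield K" and f: "f \<in> Aut_A2 K" and v: "in_K2 K v" "XD f v" "XD (inv f) v"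
  shows "(\<exists>B. \<forall>n. map_degree (f ^^ n) \<le> B) \<or>
    (\<exists>p. (\<forall>i. Polynomial.coeff p i \<in> K) \<and> Polynomial.degree p \<ge> 2 \<and>
       map_degree (tri v p \<circ> f \<circ> tri v (- p)) * Polynomial.degree p \<le> map_degree f)"
proof -
  have v0: "v \<noteq> 0" by (rule XD_nonzero[OF v(2)])
  have fU: "f \<in> Aut_A2 UNIV" by (rule aut_UNIV[OF f])
  obtain p where p: "redn K v p f" using triangular_reduction[OF K fU aut_defined[OF f] v(1,2)] by blast
  let ?k = "Polynomial.degree p"
  define E where "E = tri v p \<circ> f"
  have tK: "tri v p \<in> Aut_A2 K" using p by (auto simp: redn_def intro!: tri_aut K v)
  have E: "E \<in> Aut_A2 K" unfolding E_def by (intro aut_comp K tK f)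
  have EU: "E \<in> Aut_A2 UNIV" by (rule aut_UNIV[OF E])
  have k2: "?k \<ge> 2" using p by (simp add: redn_def)
  have df: "map_degree f = map_degree E * ?k" using p by (simp add: redn_def E_def)
  have fE: "f = tri v (- p) \<circ> E" by (simp add: E_def tri_cancel)
  have dir: "map_degree E \<le> 1 \<or> (\<exists>w. XD E w \<and> cross v w \<noteq> 0)" using p by (simp add: redn_def E_def)
  obtain y where y: "\<And>s. Polynomial.degree s \<ge> 2 \<Longrightarrow> XD (inv (tri v s \<circ> E)) y"
     "map_degree E \<ge> 2 \<Longrightarrow> XD (inv E) y" "map_degree E \<le> 1 \<Longrightarrow> y = lin (inv E) v"
    using tri_comp_directions[OF v0 EU dir] by metis
  have "XD (inv f) y" using y(1)[of "- p"] k2 unfolding fE by simp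
  hence yv: "cross y v = 0" using XD_unique v(3) by blast
  show ?thesis
  proof (cases "map_degree E \<le> 1")
    case True
    \<comment> \<open>The inverse of \<open>f\<close> contracts to \<open>y\<close>, which is
      parallel to \<open>v\<close>; so the linear part of \<open>E\<close> preserves the direction
      \<open>v\<close>.\<close>
    have "lin E y = v" unfolding y(3)[OF True]
      using lin_comp[OF EU True aut_inv[OF EU] affine_inv[OF EU True], of v] aut_inv_eq[OF EU]
      by (simp add: lin_def o_def)
    hence "cross (lin E y) (lin E v) = cross v (lin E v)" by simp
    hence "cross v (lin E v) = 0" using lin_cross[OF EU True] yv by metis
    from triangular_bounded[OF v0 EU True this fE] show ?thesis by blast
  next
    case False
    hence E2: "map_degree E \<ge> 2" by simp
    have "cross v y = 0" using yv cross_swap by blast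
    have iE: "inv E \<in> Aut_A2 K" "inv E \<in> Aut_A2 UNIV" using aut_inv[OF E] aut_inv[OF EU] by auto
    have XiE: "XD (inv E) v" by (rule XD_parallel[OF y(2)[OF E2] v0 yv])
    obtain p' where p': "redn K v p' (inv E)"
      using triangular_reduction[OF K iE(2) aut_defined[OF iE(1)] v(1) XiE] by blast
    let ?k' = "Polynomial.degree p'"
    define m' where "m' = tri v p' \<circ> inv E"
    have m'U: "m' \<in> Aut_A2 UNIV" unfolding m'_def by (intro aut_comp cfield_UNIV tri_aut_UNIV iE)
    define m where "m = inv m'"
    have mU: "m \<in> Aut_A2 UNIV" unfolding m_def by (rule aut_inv[OF m'U])
    have k'2: "?k' \<ge> 2" using p' by (simp add: redn_def)
    have dE: "map_degree E = map_degree m * ?k'"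
      using p' map_degree_inv[OF EU] map_degree_inv[OF m'U] by (simp add: redn_def m'_def m_def)
    have "m = E \<circ> tri v (- p')" unfolding m_def m'_def
      using aut_inv_comp[OF tri_aut_UNIV(1) iE(2)] by (simp add: aut_inv_inv[OF EU] tri_minus_eq)
    hence Em: "E = m \<circ> tri v p'" by (auto simp: fun_eq_iff tri_tri tri_0)
    have fm: "f = tri v (- p) \<circ> m \<circ> tri v p'" unfolding fE Em by (simp add: o_assoc)
    have dfm: "map_degree f = map_degree m * ?k' * ?k" using df dE by simp
    have tle: "map_degree (tri v (p' - p)) \<le> max ?k ?k'"
      using tri_degree_le[OF v0, of "p' - p"] degree_diff_le_max[of p' p] k2 by (simp add: max_def split: if_splits)
    have pK: "\<forall>i. Polynomial.coeff p i \<in> K" "\<forall>i. Polynomial.coeff p' i \<in> K" using p p' by (auto simp: redn_def)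
    show ?thesis
    proof (cases "?k \<le> ?k'")
      case True
      have "tri v p \<circ> f \<circ> tri v (- p) = m \<circ> tri v (p' - p)"
        unfolding fm by (auto simp: fun_eq_iff tri_tri tri_0)
      hence "map_degree (tri v p \<circ> f \<circ> tri v (- p)) \<le> map_degree m * map_degree (tri v (p' - p))"
        using aut_comp_degree_le[OF mU tri_aut_UNIV(1)] by simp
      also have "\<dots> \<le> map_degree m * ?k'" using tle True by (intro mult_le_mono2) simp
      finally have "map_degree (tri v p \<circ> f \<circ> tri v (- p)) * ?k \<le> map_degree f"
        unfolding dfm by (rule mult_le_mono1)
      thus ?thesis using pK k2 by blast
    next
      case False
      have "tri v p' \<circ> f \<circ> tri v (- p') = tri v (p' - p) \<circ> m"
        unfolding fm by (auto simp: fun_eq_iff tri_tri tri_0)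
      hence "map_degree (tri v p' \<circ> f \<circ> tri v (- p')) \<le> map_degree (tri v (p' - p)) * map_degree m"
        using aut_comp_degree_le[OF tri_aut_UNIV(1) mU] by simp
      also have "\<dots> \<le> ?k * map_degree m" using tle False by (intro mult_le_mono1) simp
      finally have "map_degree (tri v p' \<circ> f \<circ> tri v (- p')) * ?k' \<le> ?k * map_degree m * ?k'"
        by (rule mult_le_mono1)
      hence "map_degree (tri v p' \<circ> f \<circ> tri v (- p')) * ?k' \<le> map_degree f"
        unfolding dfm by (simp add: algebra_simps)
      thus ?thesis using pK k'2 by blast
    qed
  qed
qed

lemma conj_power:
  assumes "h \<in> Aut_A2 K" shows "(h \<circ> f \<circ> inv h) ^^ n = h \<circ> (f ^^ n) \<circ> inv h"
proof
  fix z
  define F where "F = h \<circ> f \<circ> inv h"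
  have F: "F w = h (f (inv h w))" for w by (simp add: F_def)
  have "(F ^^ n) z = h ((f ^^ n) (inv h z))"
    by (induction n) (simp_all add: F aut_inv_eq[OF assms])
  thus "((h \<circ> f \<circ> inv h) ^^ n) z = (h \<circ> (f ^^ n) \<circ> inv h) z" by (simp add: F_def)
qed

lemma aut_power: "cfield K \<Longrightarrow> f \<in> Aut_A2 K \<Longrightarrow> f ^^ n \<in> Aut_A2 K"
  by (induction n) (auto intro: aut_id aut_comp simp del: id_apply)

text \<open>Each conjugation by a triangular map of degree k divides the degree by at least k and
  multiplies the degree of the conjugator by at most k. This keeps the product of degrees below
  \<open>map_degree f\<close> and is the source of the final bound.\<close>

theorem conjugate_to_regular:
  assumes K: "cfield K" and f: "f \<in> Aut_A2 K"
  shows "(\<exists>B. \<forall>n. map_degree (f ^^ n) \<le> B) \<or>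
    (\<exists>h\<in>Aut_A2 K. \<exists>f0\<in>Aut_A2 K. f = h \<circ> f0 \<circ> inv h \<and> regular f0 \<and> map_degree h * map_degree f0 \<le> map_degree f)"
  using f
proof (induction "map_degree f" arbitrary: f rule: less_induct)
  case less
  have fU: "f \<in> Aut_A2 UNIV" by (rule aut_UNIV[OF less.prems])
  show ?case
  proof (cases "map_degree f \<le> 1")
    case True
    have "map_degree (f ^^ n) \<le> 1" for n
    proof (induction n)
      case (Suc n)
      have "map_degree (f \<circ> f ^^ n) \<le> map_degree f * map_degree (f ^^ n)"
        by (intro aut_comp_degree_le fU aut_power cfield_UNIV)
      also have "\<dots> \<le> 1 * 1" using Suc True by (intro mult_le_mono)
      finally show ?case by (simp only: funpow.simps mult_1)
    qed (simp add: map_degree_id[unfolded id_def] id_def)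
    thus ?thesis by blast
  next
    case False
    hence f2: "map_degree f \<ge> 2" by simp
    obtain v where v: "in_K2 K v" "XD f v" using XD_exists[OF K fU aut_defined[OF less.prems] f2] by metis
    have v0: "v \<noteq> 0" by (rule XD_nonzero[OF v(2)])
    show ?thesis
    proof (cases "regular f")
      case True
      have "f = id \<circ> f \<circ> inv id" by simp
      moreover have "map_degree id * map_degree f \<le> map_degree f" by (simp add: map_degree_id)
      ultimately show ?thesis using True aut_id[OF K] less.prems by blast
    next
      case False
      obtain v' where v': "XD (inv f) v'" using XD_inv_exists[OF fU v(2)] .
      have "cross v v' = 0" using False v(2) v' unfolding regular_def by blast
      hence vi: "XD (inv f) v" using XD_parallel[OF v' v0] cross_swap by blast
      show ?thesis
      proof (cases "\<exists>B. \<forall>n. map_degree (f ^^ n) \<le> B")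
        case False
        then obtain p where p: "\<And>i. Polynomial.coeff p i \<in> K" "Polynomial.degree p \<ge> 2"
           "map_degree (tri v p \<circ> f \<circ> tri v (- p)) * Polynomial.degree p \<le> map_degree f"
          using conjugation_step[OF K less.prems v vi] by blast
        define e where "e = tri v (- p)"
        define f1 where "f1 = tri v p \<circ> f \<circ> e"
        have eK: "e \<in> Aut_A2 K" "tri v p \<in> Aut_A2 K"
          unfolding e_def using p(1) cfield_minus[OF K] by (auto intro!: tri_aut K v)
        have ie: "inv e = tri v p" unfolding e_def tri_minus_eq by simp
        have f1K: "f1 \<in> Aut_A2 K" unfolding f1_def by (intro aut_comp K eK less.prems)
        have f1d: "map_degree f1 * Polynomial.degree p \<le> map_degree f" using p(3) by (simp add: f1_def e_def)
        have fe: "f = e \<circ> f1 \<circ> inv e"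
          using aut_inv_eq[OF eK(1)] by (auto simp: fun_eq_iff f1_def ie)
        have f1pos: "map_degree f1 \<ge> 1" by (rule aut_degree_pos[OF aut_UNIV[OF f1K]])
        have "map_degree f1 * 1 < map_degree f1 * Polynomial.degree p"
          using p(2) f1pos by (intro mult_strict_left_mono) auto
        hence "map_degree f1 < map_degree f" using f1d by linarith
        from less.hyps[OF this f1K] show ?thesis
        proof
          assume "\<exists>B. \<forall>n. map_degree (f1 ^^ n) \<le> B"
          then obtain B where B: "\<And>n. map_degree (f1 ^^ n) \<le> B" by blast
          have "map_degree (f ^^ n) \<le> map_degree e * B * map_degree (inv e)" for n
          proof -
            have 1: "f1 ^^ n \<in> Aut_A2 UNIV" "e \<in> Aut_A2 UNIV" "inv e \<in> Aut_A2 UNIV"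
              using aut_power[OF K f1K] eK(1) aut_inv[OF eK(1)] by (auto intro: aut_UNIV)
            have "map_degree (e \<circ> f1 ^^ n \<circ> inv e) \<le> map_degree (e \<circ> f1 ^^ n) * map_degree (inv e)"
              by (intro aut_comp_degree_le aut_comp cfield_UNIV 1)
            also have "\<dots> \<le> map_degree e * map_degree (f1 ^^ n) * map_degree (inv e)"
              by (intro mult_le_mono1 aut_comp_degree_le 1)
            also have "\<dots> \<le> map_degree e * B * map_degree (inv e)"
              by (intro mult_le_mono1 mult_le_mono2 B)
            finally show ?thesis unfolding fe conj_power[OF eK(1)] .
          qed
          thus ?thesis by blast
        next
          assume "\<exists>h\<in>Aut_A2 K. \<exists>f0\<in>Aut_A2 K. f1 = h \<circ> f0 \<circ> inv h \<and> regular f0 \<and> map_degree h * map_degree f0 \<le> map_degree f1"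
          then obtain h f0 where h: "h \<in> Aut_A2 K" "f0 \<in> Aut_A2 K" "f1 = h \<circ> f0 \<circ> inv h" "regular f0"
            "map_degree h * map_degree f0 \<le> map_degree f1" by blast
          have "f = (e \<circ> h) \<circ> f0 \<circ> inv (e \<circ> h)"
            unfolding aut_inv_comp[OF eK(1) h(1)] fe h(3) by (simp add: o_assoc)
          moreover have "map_degree (e \<circ> h) * map_degree f0 \<le> map_degree f"
          proof -
            have "map_degree (e \<circ> h) \<le> map_degree e * map_degree h"
              by (intro aut_comp_degree_le aut_UNIV[OF eK(1)] aut_UNIV[OF h(1)])
            also have "map_degree e \<le> Polynomial.degree p"
              unfolding e_def using tri_degree_le[OF v0, of "- p"] p(2) by simp
            finally have "map_degree (e \<circ> h) \<le> Polynomial.degree p * map_degree h" by simp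
            hence "map_degree (e \<circ> h) * map_degree f0 \<le> Polynomial.degree p * (map_degree h * map_degree f0)"
              by (metis mult.assoc mult_le_mono1)
            also have "\<dots> \<le> Polynomial.degree p * map_degree f1" by (intro mult_le_mono2 h(5))
            also have "\<dots> \<le> map_degree f" using f1d by (simp add: mult.commute)
            finally show ?thesis .
          qed
          moreover have "e \<circ> h \<in> Aut_A2 K" by (intro aut_comp K eK h)
          ultimately show ?thesis using h(2,4) by blast
        qed
      qed blast
    qed
  qed
qed

section \<open>Conjugacies between regular automorphisms\<close>

text \<open>No cancellation occurs at either end of
  \<open>inv \<phi> \<circ> g \<circ> \<phi>\<close>, so this map and its inverse both begin with
  \<open>inv \<phi>\<close> and have the same direction.\<close>

lemma conjugate_not_regular:
  assumes g: "g \<in> Aut_A2 UNIV" and \<phi>: "\<phi> \<in> Aut_A2 UNIV"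
    and X: "XD g u" "XD (inv g) u'" "XD \<phi> x" and nc: "cross x u \<noteq> 0" "cross x u' \<noteq> 0"
  shows "\<not> regular (inv \<phi> \<circ> g \<circ> \<phi>)"
proof -
  obtain x' where x': "XD (inv \<phi>) x'" using XD_inv_exists[OF \<phi> X(3)] .
  have i\<phi>: "inv \<phi> \<in> Aut_A2 UNIV" by (rule aut_inv[OF \<phi>])
  have g\<phi>: "g \<circ> \<phi> \<in> Aut_A2 UNIV" by (intro aut_comp cfield_UNIV g \<phi>)
  have 1: "XD (g \<circ> \<phi>) u" "XD (inv (g \<circ> \<phi>)) x'"
    using XD_comp_inv(2,3)[OF g \<phi> X(1,2,3) x'] nc(2) cross_swap by blast+
  have "XD (inv (inv \<phi>)) x" using X(3) by (simp add: aut_inv_inv[OF \<phi>])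
  hence "XD (inv \<phi> \<circ> (g \<circ> \<phi>)) x'" "XD (inv (inv \<phi> \<circ> (g \<circ> \<phi>))) x'"
    using XD_comp_inv(2,3)[OF i\<phi> g\<phi> x' _ 1 nc(1)] by blast+
  hence "\<not> regular (inv \<phi> \<circ> (g \<circ> \<phi>))" by (rule not_regularI) simp
  thus ?thesis by (simp add: o_assoc)
qed

lemma conjugate_affine_not_regular:
  assumes g: "g \<in> Aut_A2 UNIV" and \<phi>: "\<phi> \<in> Aut_A2 UNIV" "map_degree \<phi> \<le> 1"
    and X: "XD g u" "XD (inv g) u'" and par: "cross u u' = 0"
  shows "\<not> regular (inv \<phi> \<circ> g \<circ> \<phi>)"
proof (rule not_regularI)
  have i\<phi>: "inv \<phi> \<in> Aut_A2 UNIV" "map_degree (inv \<phi>) \<le> 1" using aut_inv[OF \<phi>(1)] affine_inv[OF \<phi>] by auto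
  have *: "XD (inv \<phi> \<circ> k \<circ> \<phi>) (lin (inv \<phi>) w)" if "XD k w" for k w
  proof -
    have "XD (inv \<phi> \<circ> (k \<circ> \<phi>)) (lin (inv \<phi>) w)"
      by (intro XD_aff_left(1) i\<phi> XD_aff_right(1) \<phi> that)
    thus ?thesis by (simp add: o_assoc)
  qed
  show "XD (inv \<phi> \<circ> g \<circ> \<phi>) (lin (inv \<phi>) u)" by (rule *[OF X(1)])
  have "inv (inv \<phi> \<circ> g \<circ> \<phi>) = inv \<phi> \<circ> (inv g \<circ> \<phi>)"
    using aut_inv_comp[of "inv \<phi> \<circ> g" UNIV \<phi> UNIV] aut_inv_comp[OF i\<phi>(1) g] aut_comp[OF cfield_UNIV i\<phi>(1) g] \<phi>(1)
    by (simp add: aut_inv_inv[OF \<phi>(1)])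
  thus "XD (inv (inv \<phi> \<circ> g \<circ> \<phi>)) (lin (inv \<phi>) u')" using *[OF X(2)] by (simp add: o_assoc)
  show "cross (lin (inv \<phi>) u) (lin (inv \<phi>) u') = 0" using lin_cross[OF i\<phi>] par by blast
qed

text \<open>If \<open>\<phi>\<close> and \<open>g\<close> have the same direction, then a triangular map that reduces \<open>g\<close> also
  reduces the conjugacy \<open>\<phi>\<close>: otherwise the two triangular factors would not cancel in
  \<open>\<phi>\<inverse> g \<phi>\<close>, and this map would not be regular.\<close>

lemma common_reduction:
  assumes g: "g \<in> Aut_A2 UNIV" "regular g" and \<phi>: "\<phi> \<in> Aut_A2 UNIV" and v: "XD g v" "XD \<phi> v"
    and reg: "regular (inv \<phi> \<circ> g \<circ> \<phi>)"
    and p: "Polynomial.degree p \<ge> 2"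
      "map_degree (tri v p \<circ> g) \<le> 1 \<or> (\<exists>w. XD (tri v p \<circ> g) w \<and> cross v w \<noteq> 0)"
  shows "map_degree (tri v p \<circ> \<phi>) * Polynomial.degree p = map_degree \<phi>"
    "map_degree (tri v p \<circ> \<phi>) \<le> 1 \<or> (\<exists>w. XD (tri v p \<circ> \<phi>) w \<and> cross v w \<noteq> 0)"
proof -
  have v0: "v \<noteq> 0" by (rule XD_nonzero[OF v(1)])
  obtain r where r: "redn UNIV v r \<phi>"
    using triangular_reduction[OF cfield_UNIV \<phi> aut_defined[OF \<phi>] _ v(2)] by (auto simp: in_K2_def)
  define \<phi>1 where "\<phi>1 = tri v r \<circ> \<phi>"
  have \<phi>1: "\<phi>1 \<in> Aut_A2 UNIV" unfolding \<phi>1_def by (intro aut_comp cfield_UNIV tri_aut_UNIV \<phi>)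
  have r2: "Polynomial.degree r \<ge> 2" using r by (simp add: redn_def)
  have dir\<phi>: "map_degree \<phi>1 \<le> 1 \<or> (\<exists>w. XD \<phi>1 w \<and> cross v w \<noteq> 0)" using r by (simp add: redn_def \<phi>1_def)
  define \<gamma> where "\<gamma> = tri v p \<circ> g"
  have \<gamma>: "\<gamma> \<in> Aut_A2 UNIV" unfolding \<gamma>_def by (intro aut_comp cfield_UNIV tri_aut_UNIV g)
  \<comment> \<open>Otherwise \<open>tri v r \<circ> g \<circ> tri v (- r)\<close>, written
    \<open>g2\<close> below, still has a triangular factor along \<open>v\<close> at both ends. Then
    neither it nor its conjugate by \<open>\<phi>1\<close>, whose direction is not \<open>v\<close>,
    is regular; but that conjugate is \<open>inv \<phi> \<circ> g \<circ> \<phi>\<close>.\<close>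
  have dp: "Polynomial.degree (p - r) \<le> 1"
  proof (rule ccontr)
    assume "\<not> Polynomial.degree (p - r) \<le> 1"
    hence t2: "Polynomial.degree (r - p) \<ge> 2" by (simp add: degree_minus[of "p - r", symmetric] del: degree_minus)
    obtain y where y: "\<And>s. Polynomial.degree s \<ge> 2 \<Longrightarrow> XD (tri v s \<circ> \<gamma>) v \<and> XD (inv (tri v s \<circ> \<gamma>)) y"
      using tri_comp_directions[OF v0 \<gamma> p(2)[folded \<gamma>_def]] by metis
    have "g = tri v (- p) \<circ> \<gamma>" by (simp add: \<gamma>_def tri_cancel)
    hence "XD (inv g) y" using y[of "- p"] p(1) by simp
    hence cvy: "cross v y \<noteq> 0" using regular_cross[OF g(2) v(1)] by blast
    define a where "a = tri v (r - p) \<circ> \<gamma>"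
    have a: "a \<in> Aut_A2 UNIV" unfolding a_def by (intro aut_comp cfield_UNIV tri_aut_UNIV \<gamma>)
    have Xa: "XD a v" "XD (inv a) y" using y[OF t2] by (auto simp: a_def)
    define g2 where "g2 = a \<circ> tri v (- r)"
    have g2: "g2 \<in> Aut_A2 UNIV" unfolding g2_def by (intro aut_comp cfield_UNIV tri_aut_UNIV a)
    have r2': "Polynomial.degree (- r) \<ge> 2" using r2 by simp
    have "cross y v \<noteq> 0" using cvy cross_swap by blast
    hence Xg2: "XD g2 v" "XD (inv g2) v" unfolding g2_def
      using XD_comp_inv(2,3)[OF a tri_aut_UNIV(1) Xa tri_XD_both(1,2)[OF v0 r2']] by blast+
    have eq: "inv \<phi>1 \<circ> g2 \<circ> \<phi>1 = inv \<phi> \<circ> g \<circ> \<phi>"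
    proof
      fix z
      have "inv \<phi>1 = inv \<phi> \<circ> tri v (- r)"
        unfolding \<phi>1_def using aut_inv_comp[OF tri_aut_UNIV(1) \<phi>] by (simp add: tri_minus_eq)
      thus "(inv \<phi>1 \<circ> g2 \<circ> \<phi>1) z = (inv \<phi> \<circ> g \<circ> \<phi>) z"
        by (simp add: g2_def a_def \<gamma>_def \<phi>1_def tri_tri tri_0)
    qed
    have "\<not> regular (inv \<phi>1 \<circ> g2 \<circ> \<phi>1)"
    proof (cases "map_degree \<phi>1 \<le> 1")
      case True
      show ?thesis by (rule conjugate_affine_not_regular[OF g2 \<phi>1 True Xg2]) simp
    next
      case False
      then obtain w where w: "XD \<phi>1 w" "cross v w \<noteq> 0" using dir\<phi> by blast
      hence "cross w v \<noteq> 0" using cross_swap by blast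
      thus ?thesis using conjugate_not_regular[OF g2 \<phi>1 Xg2 w(1)] by blast
    qed
    thus False using reg eq by simp
  qed
  \<comment> \<open>\<open>\<tau>\<close> is affine and fixes the direction \<open>v\<close>. It
    replaces \<open>r\<close> by \<open>p\<close> without changing degrees, nor whether directions
    differ from \<open>v\<close>.\<close>
  define \<tau> where "\<tau> = tri v (p - r)"
  have \<tau>: "\<tau> \<in> Aut_A2 UNIV" "map_degree \<tau> \<le> 1"
    unfolding \<tau>_def using tri_aut_UNIV(1) tri_degree_le[OF v0, of "p - r"] dp by auto
  have p\<phi>: "tri v p \<circ> \<phi> = \<tau> \<circ> \<phi>1" by (simp add: \<tau>_def \<phi>1_def fun_eq_iff tri_tri)
  have deg: "Polynomial.degree p = Polynomial.degree r"
    using degree_add_eq_right[of "p - r" r] dp r2 by simp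
  have r\<phi>: "map_degree \<phi>1 * Polynomial.degree r = map_degree \<phi>" using r by (simp add: redn_def \<phi>1_def)
  have "map_degree (\<tau> \<circ> \<phi>1) = map_degree \<phi>1 \<and>
    (map_degree (\<tau> \<circ> \<phi>1) \<le> 1 \<or> (\<exists>w. XD (\<tau> \<circ> \<phi>1) w \<and> cross v w \<noteq> 0))"
  proof (cases "map_degree \<phi>1 \<le> 1")
    case True
    have \<tau>\<phi>: "\<tau> \<circ> \<phi>1 \<in> Aut_A2 UNIV" by (intro aut_comp cfield_UNIV \<tau> \<phi>1)
    have "map_degree (\<tau> \<circ> \<phi>1) \<le> map_degree \<tau> * map_degree \<phi>1" by (intro aut_comp_degree_le \<tau> \<phi>1)
    also have "\<dots> \<le> 1 * 1" by (intro mult_le_mono \<tau> True)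
    finally show ?thesis using aut_degree_pos[OF \<tau>\<phi>] aut_degree_pos[OF \<phi>1] True by simp
  next
    case False
    then obtain w where w: "XD \<phi>1 w" "cross v w \<noteq> 0" using dir\<phi> by blast
    have "cross (lin \<tau> v) (lin \<tau> w) \<noteq> 0" using lin_cross[OF \<tau>] w(2) by blast
    moreover have "lin \<tau> v = v" unfolding \<tau>_def by (rule tri_affine_lin[OF v0])
    ultimately show ?thesis using XD_aff_left[OF \<tau> w(1)] by auto
  qed
  thus "map_degree (tri v p \<circ> \<phi>) * Polynomial.degree p = map_degree \<phi>"
    "map_degree (tri v p \<circ> \<phi>) \<le> 1 \<or> (\<exists>w. XD (tri v p \<circ> \<phi>) w \<and> cross v w \<noteq> 0)"
    unfolding p\<phi> deg using r\<phi> by auto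
qed

text \<open>What then separates \<phi> from a map over \<open>K\<close> is the affine factor
  \<open>a\<close>, which still has complex coefficients.\<close>

definition affine_factor :: "complex set \<Rightarrow> (complex ^ 2 \<Rightarrow> complex ^ 2) \<Rightarrow> bool" where
  "affine_factor K \<phi> \<longleftrightarrow> (\<exists>\<theta>\<in>Aut_A2 K. \<exists>a\<in>Aut_A2 UNIV. map_degree a \<le> 1 \<and> \<phi> = \<theta> \<circ> a)"

text \<open>The degree identity says that \<open>\<gamma>\<close> is a prefix of \<open>\<phi>\<close>, both being viewed as reduced
  products of affine and triangular maps. The map \<open>\<rho>\<close> is the rest of \<open>g = \<gamma> \<circ> \<rho>\<close>; in the
  induction the first triangular factor of \<open>\<gamma>\<close> is moved to the end of \<open>\<rho>\<close>.\<close>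

lemma prefix_dichotomy:
  assumes K: "cfield K"
    and "\<gamma> \<in> Aut_A2 K" "\<rho> \<in> Aut_A2 K" "\<phi> \<in> Aut_A2 UNIV"
    and "regular (\<gamma> \<circ> \<rho>)" "regular (inv \<phi> \<circ> (\<gamma> \<circ> \<rho>) \<circ> \<phi>)"
    and "XD \<gamma> v" "XD (\<gamma> \<circ> \<rho>) v" "XD \<phi> v"
    and "map_degree \<rho> \<le> 1 \<or> (\<exists>y r r'. XD \<rho> r \<and> XD (inv \<gamma>) y \<and> cross y r \<noteq> 0 \<and> XD (inv \<rho>) r' \<and> XD (inv (\<gamma> \<circ> \<rho>)) r')"
  shows "(affine_factor K \<phi> \<and> map_degree \<phi> \<le> map_degree \<gamma>) \<or> map_degree (inv \<gamma> \<circ> \<phi>) * map_degree \<gamma> = map_degree \<phi>"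
  using assms(2-)
proof (induction "map_degree \<gamma>" arbitrary: \<gamma> \<rho> \<phi> v rule: less_induct)
  case less
  note \<gamma> = less.prems(1) and \<rho> = less.prems(2) and \<phi> = less.prems(3)
  have \<gamma>U: "\<gamma> \<in> Aut_A2 UNIV" and \<rho>U: "\<rho> \<in> Aut_A2 UNIV" using aut_UNIV \<gamma> \<rho> by auto
  obtain u where u: "in_K2 K u" "XD \<gamma> u"
    using XD_exists[OF K \<gamma>U aut_defined[OF \<gamma>] XD_degree[OF less.prems(6)]] by metis
  have u0: "u \<noteq> 0" by (rule XD_nonzero[OF u(2)])
  have vu: "cross v u = 0" using XD_unique[OF less.prems(6) u(2)] .
  define g where "g = \<gamma> \<circ> \<rho>"
  have gK: "g \<in> Aut_A2 K" unfolding g_def by (intro aut_comp K \<gamma> \<rho>)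
  have g: "g \<in> Aut_A2 UNIV" by (rule aut_UNIV[OF gK])
  have Xg: "XD g u" and X\<phi>: "XD \<phi> u" unfolding g_def using XD_parallel[OF _ u0 vu] less.prems(7,8) by blast+
  have regg: "regular g" "regular (inv \<phi> \<circ> g \<circ> \<phi>)" using less.prems(4,5) by (auto simp: g_def)
  obtain p where p: "redn K u p \<gamma>" using triangular_reduction[OF K \<gamma>U aut_defined[OF \<gamma>] u] by blast
  let ?k = "Polynomial.degree p"
  have k2: "?k \<ge> 2" and pK: "\<And>i. Polynomial.coeff p i \<in> K" using p by (auto simp: redn_def)
  define \<gamma>1 where "\<gamma>1 = tri u p \<circ> \<gamma>"
  have tK: "tri u p \<in> Aut_A2 K" "tri u (- p) \<in> Aut_A2 K"
    using pK cfield_minus[OF K] by (auto intro!: tri_aut K u)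
  have \<gamma>1: "\<gamma>1 \<in> Aut_A2 K" "\<gamma>1 \<in> Aut_A2 UNIV" unfolding \<gamma>1_def
    by (intro aut_comp K tK \<gamma>) (intro aut_comp cfield_UNIV tri_aut_UNIV \<gamma>U)
  have d\<gamma>: "map_degree \<gamma>1 * ?k = map_degree \<gamma>" using p by (simp add: redn_def \<gamma>1_def)
  have dir\<gamma>: "map_degree \<gamma>1 \<le> 1 \<or> (\<exists>w. XD \<gamma>1 w \<and> cross u w \<noteq> 0)" using p by (simp add: redn_def \<gamma>1_def)
  have \<gamma>_eq: "\<gamma> = tri u (- p) \<circ> \<gamma>1" by (simp add: \<gamma>1_def tri_cancel)
  obtain y where y: "\<And>s. Polynomial.degree s \<ge> 2 \<Longrightarrow> XD (inv (tri u s \<circ> \<gamma>1)) y"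
     "map_degree \<gamma>1 \<ge> 2 \<Longrightarrow> XD (inv \<gamma>1) y" "map_degree \<gamma>1 \<le> 1 \<Longrightarrow> y = lin (inv \<gamma>1) u"
    using tri_comp_directions[OF u0 \<gamma>1(2) dir\<gamma>] by metis
  have Xi\<gamma>: "XD (inv \<gamma>) y" using y(1)[of "- p"] k2 unfolding \<gamma>_eq by simp
  have \<rho>_cases: "map_degree \<rho> \<le> 1 \<or> (\<exists>r r'. XD \<rho> r \<and> cross y r \<noteq> 0 \<and> XD (inv \<rho>) r' \<and> XD (inv g) r')"
  proof (cases "map_degree \<rho> \<le> 1")
    case False
    then obtain y' r r' where yr: "XD \<rho> r" "XD (inv \<gamma>) y'" "cross y' r \<noteq> 0" "XD (inv \<rho>) r'" "XD (inv g) r'"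
      using less.prems(9) unfolding g_def by blast
    have "cross y' y = 0" using XD_unique[OF yr(2) Xi\<gamma>] .
    hence "cross y r \<noteq> 0" using cross_trans[OF XD_nonzero[OF Xi\<gamma>]] yr(3) by blast
    thus ?thesis using yr by blast
  qed simp
  \<comment> \<open>Since nothing cancels between \<open>\<gamma>\<close> and \<open>\<rho>\<close>,
    the map that strips the first factor of \<open>\<gamma>\<close> also strips the first factor of
    \<open>g\<close>. So \<open>common_reduction\<close> applies and strips it from
    \<open>\<phi>\<close>.\<close>
  have dirg: "map_degree (tri u p \<circ> g) \<le> 1 \<or> (\<exists>w. XD (tri u p \<circ> g) w \<and> cross u w \<noteq> 0)"
  proof -
    have pg: "tri u p \<circ> g = \<gamma>1 \<circ> \<rho>" by (simp add: g_def \<gamma>1_def o_assoc)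
    show ?thesis
    proof (cases "map_degree \<gamma>1 \<le> 1")
      case True
      show ?thesis
      proof (cases "map_degree \<rho> \<le> 1")
        case True': True
        have "map_degree (\<gamma>1 \<circ> \<rho>) \<le> map_degree \<gamma>1 * map_degree \<rho>" by (intro aut_comp_degree_le \<gamma>1 \<rho>U)
        also have "\<dots> \<le> 1 * 1" by (intro mult_le_mono True True')
        finally show ?thesis unfolding pg by simp
      next
        case False
        then obtain r where r: "XD \<rho> r" "cross y r \<noteq> 0" using \<rho>_cases by blast
        have "lin \<gamma>1 y = u" unfolding y(3)[OF True]
          using lin_comp[OF \<gamma>1(2) True aut_inv[OF \<gamma>1(2)] affine_inv[OF \<gamma>1(2) True], of u] aut_inv_eq[OF \<gamma>1(2)]
          by (simp add: lin_def o_def)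
        hence "cross u (lin \<gamma>1 r) \<noteq> 0" using lin_cross[OF \<gamma>1(2) True, of y r] r(2) by simp
        thus ?thesis unfolding pg using XD_aff_left(1)[OF \<gamma>1(2) True r(1)] by blast
      qed
    next
      case False
      then obtain w where w: "XD \<gamma>1 w" "cross u w \<noteq> 0" using dir\<gamma> by blast
      have "XD (\<gamma>1 \<circ> \<rho>) w"
      proof (cases "map_degree \<rho> \<le> 1")
        case True
        show ?thesis by (rule XD_aff_right(1)[OF \<rho>U True w(1)])
      next
        case False': False
        then obtain r where r: "XD \<rho> r" "cross y r \<noteq> 0" using \<rho>_cases by blast
        show ?thesis by (rule XD_comp(2)[OF \<gamma>1(2) w(1) _ r]) (use y(2) False in simp)
      qed
      thus ?thesis unfolding pg using w(2) by blast
    qed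
  qed
  define \<phi>1 where "\<phi>1 = tri u p \<circ> \<phi>"
  have \<phi>1: "\<phi>1 \<in> Aut_A2 UNIV" unfolding \<phi>1_def by (intro aut_comp cfield_UNIV tri_aut_UNIV \<phi>)
  have d\<phi>: "map_degree \<phi>1 * ?k = map_degree \<phi>"
    and dir\<phi>: "map_degree \<phi>1 \<le> 1 \<or> (\<exists>w. XD \<phi>1 w \<and> cross u w \<noteq> 0)"
    using common_reduction[OF g regg(1) \<phi> Xg X\<phi> regg(2) k2 dirg] by (auto simp: \<phi>1_def)
  have \<phi>_eq: "\<phi> = tri u (- p) \<circ> \<phi>1" by (simp add: \<phi>1_def tri_cancel)
  have quot: "inv \<gamma> \<circ> \<phi> = inv \<gamma>1 \<circ> \<phi>1"
  proof -
    have "inv \<gamma>1 = inv \<gamma> \<circ> tri u (- p)"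
      unfolding \<gamma>1_def using aut_inv_comp[OF tri_aut_UNIV(1) \<gamma>U] by (simp add: tri_minus_eq)
    thus ?thesis by (simp add: \<phi>1_def fun_eq_iff tri_tri tri_0)
  qed
  show ?case
  proof (cases "map_degree \<phi>1 \<le> 1")
    case True
    hence "affine_factor K \<phi>" unfolding affine_factor_def using \<phi>_eq tK(2) \<phi>1 by blast
    moreover have "map_degree \<phi> \<le> map_degree \<gamma>"
    proof -
      have "map_degree \<phi>1 * ?k \<le> map_degree \<gamma>1 * ?k"
        using True aut_degree_pos[OF \<gamma>1(2)] by (intro mult_le_mono1) simp
      thus ?thesis unfolding d\<phi> d\<gamma> .
    qed
    ultimately show ?thesis by blast
  next
    case \<phi>1na: False
    then obtain x where x: "XD \<phi>1 x" "cross u x \<noteq> 0" using dir\<phi> by blast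
    show ?thesis
    proof (cases "map_degree \<gamma>1 \<le> 1")
      case True
      have "map_degree (inv \<gamma> \<circ> \<phi>) = map_degree \<phi>1"
        unfolding quot by (rule XD_aff_left(2)[OF aut_inv[OF \<gamma>1(2)] affine_inv[OF \<gamma>1(2) True] x(1)])
      moreover have "map_degree \<gamma>1 = 1" using True aut_degree_pos[OF \<gamma>1(2)] by simp
      hence "map_degree \<gamma> = ?k" using d\<gamma> by (metis mult_1)
      ultimately show ?thesis using d\<phi> by simp
    next
      case \<gamma>1na: False
      then obtain w where w: "XD \<gamma>1 w" "cross u w \<noteq> 0" using dir\<gamma> by blast
      have Xi\<gamma>1: "XD (inv \<gamma>1) y" using y(2) \<gamma>1na by simp
      \<comment> \<open>\<open>\<gamma>1 \<circ> \<rho>1\<close> is the conjugate of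
        \<open>g\<close> by \<open>tri u p\<close>. The removed factor now sits at its end, so its
        inverse has direction \<open>u\<close>.\<close>
      define \<rho>1 where "\<rho>1 = \<rho> \<circ> tri u (- p)"
      have \<rho>1: "\<rho>1 \<in> Aut_A2 K" unfolding \<rho>1_def by (intro aut_comp K \<rho> tK)
      have \<rho>1U: "\<rho>1 \<in> Aut_A2 UNIV" by (rule aut_UNIV[OF \<rho>1])
      have k2': "Polynomial.degree (- p) \<ge> 2" using k2 by simp
      note tXD = tri_XD_both[OF u0 k2']
      have i\<rho>1: "inv \<rho>1 = tri u p \<circ> inv \<rho>" unfolding \<rho>1_def
        using aut_inv_comp[OF \<rho>U tri_aut_UNIV(1)] by (simp add: tri_minus_eq)
      have "\<exists>r. XD \<rho>1 r \<and> XD (inv \<rho>1) u \<and> cross y r \<noteq> 0"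
      proof (cases "map_degree \<rho> \<le> 1")
        case True
        have "XD \<rho>1 (lin \<rho> u)" unfolding \<rho>1_def by (rule XD_aff_left(1)[OF \<rho>U True tXD(1)])
        moreover have "XD (inv \<rho>1) u" unfolding i\<rho>1
          by (rule XD_aff_right(1)[OF aut_inv[OF \<rho>U] affine_inv[OF \<rho>U True] tri_XD[OF u0 k2]])
        moreover have "cross y (lin \<rho> u) \<noteq> 0"
        proof -
          have i: "inv \<rho> \<in> Aut_A2 UNIV" "map_degree (inv \<rho>) \<le> 1" using aut_inv[OF \<rho>U] affine_inv[OF \<rho>U True] by auto
          have "XD (inv g) (lin (inv \<rho>) y)"
            unfolding g_def aut_inv_comp[OF \<gamma>U \<rho>U] by (rule XD_aff_left(1)[OF i Xi\<gamma>])
          hence "cross u (lin (inv \<rho>) y) \<noteq> 0" by (rule regular_cross[OF regg(1) Xg])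
          moreover have "lin (inv \<rho>) (lin \<rho> u) = u"
            using lin_comp[OF i \<rho>U True, of u] aut_inv_eq[OF \<rho>U] by (simp add: lin_def o_def)
          ultimately have "cross (lin (inv \<rho>) (lin \<rho> u)) (lin (inv \<rho>) y) \<noteq> 0" by simp
          hence "cross (lin \<rho> u) y \<noteq> 0" using lin_cross[OF i] by blast
          thus ?thesis using cross_swap by blast
        qed
        ultimately show ?thesis by blast
      next
        case False
        then obtain r r' where r: "XD \<rho> r" "cross y r \<noteq> 0" "XD (inv \<rho>) r'" "XD (inv g) r'" using \<rho>_cases by blast
        have "cross u r' \<noteq> 0" by (rule regular_cross[OF regg(1) Xg r(4)])
        hence "cross r' u \<noteq> 0" using cross_swap by blast
        hence "XD \<rho>1 r" "XD (inv \<rho>1) u" unfolding \<rho>1_def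
          using XD_comp_inv(2,3)[OF \<rho>U tri_aut_UNIV(1) r(1,3) tXD(1,2)] by blast+
        thus ?thesis using r(2) by blast
      qed
      then obtain r where r: "XD \<rho>1 r" "XD (inv \<rho>1) u" "cross y r \<noteq> 0" by blast
      define g1 where "g1 = \<gamma>1 \<circ> \<rho>1"
      have g1: "g1 \<in> Aut_A2 UNIV" unfolding g1_def by (intro aut_comp cfield_UNIV \<gamma>1 \<rho>1U)
      have Xg1: "XD g1 w" "XD (inv g1) u" unfolding g1_def
        using XD_comp_inv(2,3)[OF \<gamma>1(2) \<rho>1U w(1) Xi\<gamma>1 r] by blast+
      have cwu: "cross w u \<noteq> 0" "cross x u \<noteq> 0" using w(2) x(2) cross_swap by blast+
      have reg1: "regular g1" using Xg1 cwu unfolding regular_def by blast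
      have eq: "inv \<phi>1 \<circ> g1 \<circ> \<phi>1 = inv \<phi> \<circ> g \<circ> \<phi>"
      proof
        fix z
        have "inv \<phi>1 = inv \<phi> \<circ> tri u (- p)"
          unfolding \<phi>1_def using aut_inv_comp[OF tri_aut_UNIV(1) \<phi>] by (simp add: tri_minus_eq)
        thus "(inv \<phi>1 \<circ> g1 \<circ> \<phi>1) z = (inv \<phi> \<circ> g \<circ> \<phi>) z"
          by (simp add: g1_def g_def \<gamma>1_def \<rho>1_def \<phi>1_def tri_tri tri_0)
      qed
      \<comment> \<open>The conjugated map contracts to \<open>w\<close> and its inverse to
        \<open>u\<close>. As \<open>\<phi>1\<close> has direction \<open>x\<close> different from
        \<open>u\<close>, regularity of the conjugate leaves only \<open>w\<close>.\<close>
      have "cross x w = 0"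
        using conjugate_not_regular[OF g1 \<phi>1 Xg1 x(1) _ cwu(2)] regg(2) eq by metis
      hence X\<phi>1: "XD \<phi>1 w" using XD_parallel[OF x(1) XD_nonzero[OF w(1)]] by blast
      have "map_degree \<gamma>1 * 1 < map_degree \<gamma>1 * ?k"
        using k2 aut_degree_pos[OF \<gamma>1(2)] by (intro mult_strict_left_mono) auto
      hence less\<gamma>: "map_degree \<gamma>1 < map_degree \<gamma>" using d\<gamma> by linarith
      have "(affine_factor K \<phi>1 \<and> map_degree \<phi>1 \<le> map_degree \<gamma>1) \<or>
          map_degree (inv \<gamma>1 \<circ> \<phi>1) * map_degree \<gamma>1 = map_degree \<phi>1"
      proof (rule less.hyps[OF less\<gamma> \<gamma>1(1) \<rho>1 \<phi>1])
        show "regular (\<gamma>1 \<circ> \<rho>1)" using reg1 by (simp add: g1_def)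
        show "regular (inv \<phi>1 \<circ> (\<gamma>1 \<circ> \<rho>1) \<circ> \<phi>1)" using regg(2) eq by (simp add: g1_def)
        show "XD \<gamma>1 w" by (rule w(1))
        show "XD (\<gamma>1 \<circ> \<rho>1) w" using Xg1 by (simp add: g1_def)
        show "XD \<phi>1 w" by (rule X\<phi>1)
        show "map_degree \<rho>1 \<le> 1 \<or> (\<exists>y r r'. XD \<rho>1 r \<and> XD (inv \<gamma>1) y \<and> cross y r \<noteq> 0 \<and>
            XD (inv \<rho>1) r' \<and> XD (inv (\<gamma>1 \<circ> \<rho>1)) r')"
          using r Xi\<gamma>1 Xg1(2) unfolding g1_def by blast
      qed
      thus ?thesis
      proof
        assume a: "affine_factor K \<phi>1 \<and> map_degree \<phi>1 \<le> map_degree \<gamma>1"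
        then obtain \<theta> b where th: "\<theta> \<in> Aut_A2 K" "b \<in> Aut_A2 UNIV" "map_degree b \<le> 1" "\<phi>1 = \<theta> \<circ> b"
          unfolding affine_factor_def by blast
        have "\<phi> = (tri u (- p) \<circ> \<theta>) \<circ> b" unfolding \<phi>_eq th(4) by (simp add: o_assoc)
        moreover have "tri u (- p) \<circ> \<theta> \<in> Aut_A2 K" by (intro aut_comp K tK th)
        ultimately have "affine_factor K \<phi>" unfolding affine_factor_def using th(2,3) by blast
        moreover have "map_degree \<phi>1 * ?k \<le> map_degree \<gamma>1 * ?k" using a by (intro mult_le_mono1) simp
        ultimately show ?thesis unfolding d\<phi> d\<gamma> by blast
      next
        assume a: "map_degree (inv \<gamma>1 \<circ> \<phi>1) * map_degree \<gamma>1 = map_degree \<phi>1"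
        have "map_degree (inv \<gamma> \<circ> \<phi>) * map_degree \<gamma> = map_degree (inv \<gamma>1 \<circ> \<phi>1) * map_degree \<gamma>1 * ?k"
          unfolding quot d\<gamma>[symmetric] by (simp add: mult.assoc)
        thus ?thesis using a d\<phi> by simp
      qed
    qed
  qed
qed

lemma regular_inv:
  assumes "g \<in> Aut_A2 K" "regular g" shows "regular (inv g)"
  using assms(2) unfolding regular_def aut_inv_inv[OF assms(1)] by (metis cross_swap)

text \<open>The dichotomy is applied with \<open>\<gamma> = g\<close> and
  \<open>\<rho> = id\<close>. If all of \<open>g\<close> were a prefix of \<open>\<phi>\<close>,
  composing with \<open>inv g\<close> would lower the degree, against minimality.\<close>

lemma prefix_same_direction:
  assumes K: "cfield K" and g: "g \<in> Aut_A2 K" "regular g" and \<phi>: "\<phi> \<in> Aut_A2 UNIV"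
    and reg: "regular (inv \<phi> \<circ> g \<circ> \<phi>)" and v: "XD g v" "XD \<phi> v"
    and min: "map_degree \<phi> \<le> map_degree (inv g \<circ> \<phi>)"
  shows "affine_factor K \<phi> \<and> map_degree \<phi> \<le> map_degree g"
proof -
  have gU: "g \<in> Aut_A2 UNIV" by (rule aut_UNIV[OF g(1)])
  have "(affine_factor K \<phi> \<and> map_degree \<phi> \<le> map_degree g) \<or> map_degree (inv g \<circ> \<phi>) * map_degree g = map_degree \<phi>"
    using prefix_dichotomy[OF K g(1) aut_id[OF K] \<phi>, of v] g(2) reg v map_degree_id by simp
  moreover have "map_degree (inv g \<circ> \<phi>) * map_degree g > map_degree \<phi>"
  proof -
    have "map_degree \<phi> < map_degree \<phi> * 2" using aut_degree_pos[OF \<phi>] by simp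
    also have "\<dots> \<le> map_degree (inv g \<circ> \<phi>) * map_degree g" by (intro mult_le_mono min XD_degree[OF v(1)])
    finally show ?thesis .
  qed
  ultimately show ?thesis by linarith
qed

theorem conjugacy_of_regular:
  assumes K: "cfield K" and g: "g \<in> Aut_A2 K" "regular g" and f: "regular f"
    and \<phi>: "\<phi> \<in> Aut_A2 UNIV" "\<phi> \<circ> f = g \<circ> \<phi>"
  shows "\<exists>\<theta>\<in>Aut_A2 K. \<exists>\<psi>\<in>Aut_A2 UNIV. \<phi> = \<theta> \<circ> \<psi> \<and> \<psi> \<circ> f = g \<circ> \<psi> \<and> affine_factor K \<psi> \<and> map_degree \<psi> \<le> map_degree g"
proof -
  have gU: "g \<in> Aut_A2 UNIV" by (rule aut_UNIV[OF g(1)])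
  \<comment> \<open>The candidates are the conjugacies that differ from \<open>\<phi>\<close> by a
    map over \<open>K\<close>. This set is stable under composition with \<open>g\<close> and
    \<open>inv g\<close>, so a member of least degree cannot be shortened by either.\<close>
  define S where "S = {\<psi> \<in> Aut_A2 UNIV. \<psi> \<circ> f = g \<circ> \<psi> \<and> (\<exists>\<theta>\<in>Aut_A2 K. \<phi> = \<theta> \<circ> \<psi>)}"
  have "\<phi> = id \<circ> \<phi>" by simp
  hence "\<phi> \<in> S" using \<phi> aut_id[OF K] unfolding S_def by blast
  then obtain \<psi> where \<psi>: "\<psi> \<in> S" and min: "\<And>\<xi>. \<xi> \<in> S \<Longrightarrow> map_degree \<psi> \<le> map_degree \<xi>"
    using ex_has_least_nat[of "\<lambda>\<xi>. \<xi> \<in> S" \<phi> map_degree] by blast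
  have \<psi>U: "\<psi> \<in> Aut_A2 UNIV" and \<psi>c: "\<psi> \<circ> f = g \<circ> \<psi>" using \<psi> by (auto simp: S_def)
  obtain \<theta> where \<theta>: "\<theta> \<in> Aut_A2 K" "\<phi> = \<theta> \<circ> \<psi>" using \<psi> by (auto simp: S_def)
  have \<psi>z: "\<psi> (f z) = g (\<psi> z)" for z using fun_cong[OF \<psi>c, of z] by simp
  have S1: "inv g \<circ> \<psi> \<in> S"
  proof -
    have "\<phi> = (\<theta> \<circ> g) \<circ> (inv g \<circ> \<psi>)" using aut_inv_eq[OF g(1)] by (simp add: \<theta>(2) fun_eq_iff)
    moreover have "\<theta> \<circ> g \<in> Aut_A2 K" by (intro aut_comp K \<theta> g)
    moreover have "inv g \<circ> \<psi> \<circ> f = g \<circ> (inv g \<circ> \<psi>)" using aut_inv_eq[OF g(1)] \<psi>z by (simp add: fun_eq_iff)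
    moreover have "inv g \<circ> \<psi> \<in> Aut_A2 UNIV" by (intro aut_comp cfield_UNIV aut_inv gU \<psi>U)
    ultimately show ?thesis unfolding S_def by blast
  qed
  have S2: "g \<circ> \<psi> \<in> S"
  proof -
    have "\<phi> = (\<theta> \<circ> inv g) \<circ> (g \<circ> \<psi>)" using aut_inv_eq[OF g(1)] by (simp add: \<theta>(2) fun_eq_iff)
    moreover have "\<theta> \<circ> inv g \<in> Aut_A2 K" by (intro aut_comp K \<theta> aut_inv g)
    moreover have "g \<circ> \<psi> \<circ> f = g \<circ> (g \<circ> \<psi>)" using \<psi>z by (simp add: fun_eq_iff)
    moreover have "g \<circ> \<psi> \<in> Aut_A2 UNIV" by (intro aut_comp cfield_UNIV gU \<psi>U)
    ultimately show ?thesis unfolding S_def by blast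
  qed
  have fg: "inv \<psi> \<circ> g \<circ> \<psi> = f"
  proof
    fix z show "(inv \<psi> \<circ> g \<circ> \<psi>) z = f z" by (simp add: \<psi>z[symmetric] aut_inv_eq[OF \<psi>U])
  qed
  have ifg: "inv \<psi> \<circ> inv g \<circ> \<psi> = inv f"
  proof -
    have "inv (inv \<psi> \<circ> (g \<circ> \<psi>)) = inv (g \<circ> \<psi>) \<circ> inv (inv \<psi>)"
      by (rule aut_inv_comp[OF aut_inv[OF \<psi>U] aut_comp[OF cfield_UNIV gU \<psi>U]])
    also have "inv (g \<circ> \<psi>) = inv \<psi> \<circ> inv g" by (rule aut_inv_comp[OF gU \<psi>U])
    also have "inv (inv \<psi>) = \<psi>" by (rule aut_inv_inv[OF \<psi>U])
    finally show ?thesis using fg by (simp only: o_assoc)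
  qed
  have fU: "f \<in> Aut_A2 UNIV" unfolding fg[symmetric] by (intro aut_comp cfield_UNIV aut_inv \<psi>U gU)
  have "affine_factor K \<psi> \<and> map_degree \<psi> \<le> map_degree g"
  proof (cases "map_degree \<psi> \<le> 1")
    case True
    have "\<psi> = id \<circ> \<psi>" by simp
    hence "affine_factor K \<psi>" unfolding affine_factor_def using \<psi>U True aut_id[OF K] by blast
    thus ?thesis using True aut_degree_pos[OF gU] by simp
  next
    case False
    hence "map_degree \<psi> \<ge> 2" by simp
    then obtain x where x: "XD \<psi> x" using XD_exists_UNIV[OF \<psi>U] by metis
    have x0: "x \<noteq> 0" by (rule XD_nonzero[OF x])
    obtain v v' where v: "XD g v" "XD (inv g) v'" using g(2) by (auto simp: regular_def)
    \<comment> \<open>Otherwise \<open>inv \<psi> \<circ> g \<circ> \<psi>\<close>, which is the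
      regular map \<open>f\<close>, would not be regular.\<close>
    have "cross x v = 0 \<or> cross x v' = 0"
      using conjugate_not_regular[OF gU \<psi>U v x] f fg by auto
    thus ?thesis
    proof
      assume "cross x v = 0"
      hence "XD g x" using XD_parallel[OF v(1) x0] cross_swap by blast
      thus ?thesis using prefix_same_direction[OF K g \<psi>U _ _ x] f fg min[OF S1] by simp
    next
      assume "cross x v' = 0"
      hence X: "XD (inv g) x" using XD_parallel[OF v(2) x0] cross_swap by blast
      have "affine_factor K \<psi> \<and> map_degree \<psi> \<le> map_degree (inv g)"
        using prefix_same_direction[OF K aut_inv[OF g(1)] regular_inv[OF g] \<psi>U _ X x] regular_inv[OF fU f] ifg min[OF S2]
        by (simp add: aut_inv_inv[OF gU])
      thus ?thesis by (simp add: map_degree_inv[OF gU])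
    qed
  qed
  thus ?thesis using \<theta> \<psi>U \<psi>c by blast
qed

section \<open>Harnack's inequality and holomorphic maps of polynomial growth\<close>

text \<open>ln |F| is the real part of a holomorphic logarithm L with values in the right half
  plane. The Cayley transform that sends L(a) to 0 turns L into a self-map of the disc, and the
  Schwarz lemma gives the sharp Harnack constant.\<close>

lemma harnack_log:
  assumes F: "F holomorphic_on ball a \<rho>" and one: "\<And>z. z \<in> ball a \<rho> \<Longrightarrow> norm (F z) > 1"
    and z: "z \<in> ball a \<rho>"
  shows "ln (norm (F a)) * (\<rho> - dist a z) \<le> (\<rho> + dist a z) * ln (norm (F z))"
proof -
  have \<rho>: "\<rho> > 0" using z by (metis ball_eq_empty empty_iff not_le)
  have ne: "F w \<noteq> 0" if "w \<in> ball a \<rho>" for w using one[OF that] by auto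
  have "contractible (ball a \<rho>)" by (intro convex_imp_contractible convex_ball)
  then obtain L where L: "L holomorphic_on ball a \<rho>" "\<And>w. w \<in> ball a \<rho> \<Longrightarrow> F w = exp (L w)"
    using contractible_imp_holomorphic_log[OF F _ ne] by metis
  have nF: "ln (norm (F w)) = Re (L w)" "Re (L w) > 0" if "w \<in> ball a \<rho>" for w
    using L(2)[OF that] one[OF that] by (simp_all add: norm_exp_eq_Re)
  define A where "A = L a"
  have a: "a \<in> ball a \<rho>" using \<rho> by simp
  have A: "Re A > 0" using nF(2)[OF a] by (simp add: A_def)
  define h where "h = (\<lambda>\<zeta>. (L (a + of_real \<rho> * \<zeta>) - A) / (L (a + of_real \<rho> * \<zeta>) + cnj A))"
  have mem: "a + of_real \<rho> * \<zeta> \<in> ball a \<rho>" if "norm \<zeta> < 1" for \<zeta>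
  proof -
    have "norm (of_real \<rho> * \<zeta>) < \<rho> * 1" using that \<rho> by (simp add: norm_mult)
    thus ?thesis by (simp add: dist_norm)
  qed
  have den: "L (a + of_real \<rho> * \<zeta>) + cnj A \<noteq> 0" if "norm \<zeta> < 1" for \<zeta>
  proof
    assume "L (a + of_real \<rho> * \<zeta>) + cnj A = 0"
    hence "Re (L (a + of_real \<rho> * \<zeta>) + cnj A) = 0" by simp
    thus False using nF(2)[OF mem[OF that]] A by simp
  qed
  have less: "norm (w - A) < norm (w + cnj A)" if "Re w > 0" for w
  proof -
    have "(norm (w + cnj A))\<^sup>2 - (norm (w - A))\<^sup>2 = 4 * (Re w * Re A)"
      unfolding cmod_power2 by (simp add: power2_eq_square algebra_simps)
    hence "(norm (w - A))\<^sup>2 < (norm (w + cnj A))\<^sup>2" using mult_pos_pos[OF that A] by linarith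
    thus ?thesis by (rule power2_less_imp_less) simp
  qed
  have hol: "h holomorphic_on ball 0 1"
  proof -
    have "(\<lambda>\<zeta>. L (a + of_real \<rho> * \<zeta>)) holomorphic_on ball 0 1"
    proof -
      have "(L \<circ> (\<lambda>\<zeta>. a + of_real \<rho> * \<zeta>)) holomorphic_on ball 0 1"
        by (rule holomorphic_on_compose_gen[OF _ L(1)]) (auto intro!: holomorphic_intros simp: image_subset_iff mem simp del: mem_ball)
      thus ?thesis by (simp add: o_def)
    qed
    thus ?thesis unfolding h_def using den by (intro holomorphic_intros) auto
  qed
  have h0: "h 0 = 0" by (simp add: h_def A_def)
  have h1: "norm (h \<zeta>) < 1" if "norm \<zeta> < 1" for \<zeta>
    using less[OF nF(2)[OF mem[OF that]]] den[OF that] unfolding h_def by (simp add: norm_divide divide_simps)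
  define \<zeta> where "\<zeta> = (z - a) / of_real \<rho>"
  define s where "s = dist a z / \<rho>"
  have s: "norm \<zeta> = s" using \<rho> by (simp add: \<zeta>_def s_def norm_divide dist_norm norm_minus_commute)
  have s1: "s < 1" "s \<ge> 0" using z \<rho> by (simp_all add: s_def)
  have az: "a + of_real \<rho> * \<zeta> = z" using \<rho> by (simp add: \<zeta>_def)
  have "norm (h \<zeta>) \<le> norm \<zeta>" using Schwarz_Lemma(1)[OF hol h0 h1, of \<zeta>] s s1 by simp
  hence "norm (L z - A) \<le> s * norm (L z + cnj A)"
    using den[of \<zeta>] s s1 unfolding h_def az by (simp add: norm_divide divide_simps)
  hence "(norm (L z - A))\<^sup>2 \<le> (s * norm (L z + cnj A))\<^sup>2" by (intro power_mono) auto
  hence "(Re (L z) - Re A)\<^sup>2 + (Im (L z) - Im A)\<^sup>2 \<le> s\<^sup>2 * ((Re (L z) + Re A)\<^sup>2 + (Im (L z) - Im A)\<^sup>2)"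
    unfolding power_mult_distrib cmod_power2 by simp
  \<comment> \<open>Since s < 1, the imaginary parts may be dropped from both sides in favour of the
    inequality for real parts.\<close>
  moreover have "s\<^sup>2 * (Im (L z) - Im A)\<^sup>2 \<le> 1 * (Im (L z) - Im A)\<^sup>2"
    using s1 by (intro mult_right_mono) (auto intro: power_le_one)
  ultimately have "(Re (L z) - Re A)\<^sup>2 \<le> (s * (Re (L z) + Re A))\<^sup>2"
    unfolding power_mult_distrib distrib_left[of "s\<^sup>2"] by linarith
  hence "\<bar>Re (L z) - Re A\<bar> \<le> \<bar>s * (Re (L z) + Re A)\<bar>" by (simp only: abs_le_square_iff)
  hence "Re A - Re (L z) \<le> s * (Re (L z) + Re A)" using s1 A nF(2)[OF z] by (simp add: abs_mult)
  hence "Re A * (1 - s) \<le> (1 + s) * Re (L z)" by (simp add: algebra_simps)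
  hence "Re A * (1 - s) * \<rho> \<le> (1 + s) * Re (L z) * \<rho>" using \<rho> by (intro mult_right_mono) auto
  moreover have "(1 - s) * \<rho> = \<rho> - dist a z" "(1 + s) * \<rho> = \<rho> + dist a z"
    using \<rho> by (simp_all add: s_def algebra_simps)
  ultimately have "Re A * (\<rho> - dist a z) \<le> (\<rho> + dist a z) * Re (L z)"
    by (metis mult.assoc mult.commute)
  thus ?thesis using nF(1)[OF a] nF(1)[OF z] by (simp add: A_def)
qed

section \<open>Holomorphic curves in the plane and polynomial growth\<close>

definition supn :: "complex ^ 2 \<Rightarrow> real" where
  "supn z = max (norm (z $ 1)) (norm (z $ 2))"

lemma supn_ge: "norm (z $ 1) \<le> supn z" "norm (z $ 2) \<le> supn z" "0 \<le> supn z"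
  by (auto simp: supn_def le_max_iff_disj)

definition hol2 :: "complex set \<Rightarrow> (complex \<Rightarrow> complex ^ 2) \<Rightarrow> bool" where
  "hol2 S \<gamma> \<longleftrightarrow> (\<lambda>t. \<gamma> t $ 1) holomorphic_on S \<and> (\<lambda>t. \<gamma> t $ 2) holomorphic_on S"

lemma bieval_sum_total_degree:
  "bieval P z = (\<Sum>i\<le>total_degree P. \<Sum>j\<le>total_degree P. bicoeff P i j * z $ 1 ^ i * z $ 2 ^ j)"
  by (rule bieval_as_sum) (use total_degree_le_iff[of P "total_degree P"] in force)

lemma hol2_polymap:
  assumes "defined_over UNIV F" "hol2 S \<gamma>" shows "hol2 S (\<lambda>t. F (\<gamma> t))"
proof -
  obtain P Q where F: "F = polymap P Q" using assms(1) by (rule defined_overE)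
  have "(\<lambda>t. bieval P (\<gamma> t)) holomorphic_on S" for P
    unfolding bieval_sum_total_degree using assms(2) by (intro holomorphic_intros) (auto simp: hol2_def)
  thus ?thesis by (simp add: hol2_def F)
qed

lemma has_derivative_curve:
  fixes \<gamma> :: "complex \<Rightarrow> complex ^ 2"
  assumes "((\<lambda>t. \<gamma> t $ 1) has_field_derivative a) (at t)" "((\<lambda>t. \<gamma> t $ 2) has_field_derivative b) (at t)"
  shows "(\<gamma> has_derivative (\<lambda>h. h *s vector [a, b])) (at t)"
proof -
  have lin: "bounded_linear (\<lambda>w :: complex. w *s (e :: complex ^ 2))" for e
    by (intro linear_conv_bounded_linear[THEN iffD1] linearI) (auto simp: vec_eq_iff algebra_simps)
  let ?e1 = "vector [1, 0] :: complex ^ 2" and ?e2 = "vector [0, 1] :: complex ^ 2"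
  have "((\<lambda>t. \<gamma> t $ 1 *s ?e1 + \<gamma> t $ 2 *s ?e2) has_derivative (\<lambda>h. (a * h) *s ?e1 + (b * h) *s ?e2)) (at t)"
    using assms unfolding has_field_derivative_def
    by (intro has_derivative_add bounded_linear.has_derivative[OF lin]) auto
  moreover have "(\<lambda>t. \<gamma> t $ 1 *s ?e1 + \<gamma> t $ 2 *s ?e2) = \<gamma>" by (intro ext vec2_eqI) simp_all
  moreover have "(\<lambda>h. (a * h) *s ?e1 + (b * h) *s ?e2) = (\<lambda>h. h *s vector [a, b])"
    by (intro ext vec2_eqI) simp_all
  ultimately show ?thesis by simp
qed

lemma hol2_holomorphic:
  assumes \<phi>: "holomorphic_C2 \<phi>" and S: "open S" and \<gamma>: "hol2 S \<gamma>"
  shows "hol2 S (\<lambda>t. \<phi> (\<gamma> t))"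
proof -
  have "(\<lambda>t. \<phi> (\<gamma> t) $ i) field_differentiable at t" if t: "t \<in> S" for t i
  proof -
    have "(\<lambda>t. \<gamma> t $ 1) field_differentiable at t" "(\<lambda>t. \<gamma> t $ 2) field_differentiable at t"
      using \<gamma> S t holomorphic_on_imp_differentiable_at unfolding hol2_def by blast+
    then obtain a b where "((\<lambda>t. \<gamma> t $ 1) has_field_derivative a) (at t)" "((\<lambda>t. \<gamma> t $ 2) has_field_derivative b) (at t)"
      unfolding field_differentiable_def by blast
    from has_derivative_curve[OF this] have d: "(\<gamma> has_derivative (\<lambda>h. h *s vector [a, b])) (at t)" .
    obtain D where D: "(\<phi> has_derivative D) (at (\<gamma> t))" "Vector_Spaces.linear (*s) (*s) D"
      using \<phi> unfolding holomorphic_C2_def by blast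
    have "((\<lambda>t. \<phi> (\<gamma> t)) has_derivative (\<lambda>h. D (h *s vector [a, b]))) (at t)"
      using has_derivative_compose[OF d D(1)] .
    hence "((\<lambda>t. \<phi> (\<gamma> t) $ i) has_derivative (\<lambda>h. D (h *s vector [a, b]) $ i)) (at t)"
      by (rule bounded_linear.has_derivative[OF bounded_linear_vec_nth])
    moreover have "D (h *s w) = h *s D w" for h w
      using D(2) by (simp add: Vector_Spaces.linear_iff)
    hence "(\<lambda>h. D (h *s vector [a, b]) $ i) = (*) (D (vector [a, b]) $ i)"
      by (auto simp: fun_eq_iff mult.commute)
    ultimately show ?thesis unfolding field_differentiable_def has_field_derivative_def by metis
  qed
  thus ?thesis unfolding hol2_def holomorphic_on_def using field_differentiable_at_within by blast
qed

lemma holomorphic_C2_continuous: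
  assumes "holomorphic_C2 \<phi>" shows "continuous_on A \<phi>"
proof (rule continuous_at_imp_continuous_on, rule ballI)
  fix x obtain D where "(\<phi> has_derivative D) (at x)" using assms unfolding holomorphic_C2_def by blast
  thus "isCont \<phi> x" by (rule has_derivative_continuous)
qed

text \<open>Holomorphy is tested on holomorphic curves. This form is stable under composition,
  covers biholomorphisms and polynomial maps alike, and leaves only complex analysis in one
  variable.\<close>

definition hol_map :: "(complex ^ 2 \<Rightarrow> complex ^ 2) \<Rightarrow> bool" where
  "hol_map \<phi> \<longleftrightarrow> continuous_on UNIV \<phi> \<and> (\<forall>S \<gamma>. open S \<longrightarrow> hol2 S \<gamma> \<longrightarrow> hol2 S (\<lambda>t. \<phi> (\<gamma> t)))"

lemma hol_map_holomorphic: "holomorphic_C2 \<phi> \<Longrightarrow> hol_map \<phi>"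
  unfolding hol_map_def using holomorphic_C2_continuous hol2_holomorphic by blast

lemma hol_map_polymap:
  assumes "defined_over UNIV F" shows "hol_map F"
proof -
  obtain P Q where F: "F = polymap P Q" using assms by (rule defined_overE)
  have "continuous_on UNIV (bieval P)" for P
    unfolding bieval_sum_total_degree[abs_def] by (intro continuous_intros)
  hence "continuous_on UNIV (\<lambda>z. F z $ i)" for i
    using exhaust_2[of i] by (auto simp: F)
  hence "continuous_on UNIV (\<lambda>z. \<chi> i. F z $ i)" by (rule continuous_on_vec_lambda)
  hence "continuous_on UNIV F" by simp
  thus ?thesis unfolding hol_map_def using hol2_polymap[OF assms] by blast
qed

lemma hol_map_comp:
  assumes "hol_map F" "hol_map G" shows "hol_map (F \<circ> G)"
proof -
  have "continuous_on UNIV (F \<circ> G)"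
    using assms unfolding hol_map_def by (intro continuous_on_compose) (auto intro: continuous_on_subset)
  thus ?thesis using assms unfolding hol_map_def o_def by blast
qed

lemma entire_growth_poly:
  fixes f :: "complex \<Rightarrow> complex"
  assumes "f holomorphic_on UNIV" "\<And>z. norm z \<ge> A \<Longrightarrow> norm (f z) \<le> B * norm z ^ n"
  obtains p where "Polynomial.degree p \<le> n" "\<And>z. f z = poly p z"
proof
  let ?p = "\<Sum>k\<le>n. Polynomial.monom ((deriv ^^ k) f 0 / fact k) k"
  show "Polynomial.degree ?p \<le> n"
    by (intro degree_sum_le) (auto intro: order_trans[OF degree_monom_le])
  show "f z = poly ?p z" for z
    using Liouville_polynomial[where \<xi> = z, OF assms] by (simp add: poly_sum poly_monom)
qed

text \<open>Every horizontal slice is a polynomial in x of degree at most \<open>k\<close>, hence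
  determined by its values at 0, ..., k. Lagrange interpolation there writes \<open>F\<close>
  through k + 1 vertical slices, which are polynomials in y.\<close>

lemma polynomial_growth_imp_polynomial:
  fixes F :: "complex ^ 2 \<Rightarrow> complex"
  assumes h1: "\<And>y. (\<lambda>x. F (vector [x, y])) holomorphic_on UNIV"
    and h2: "\<And>x. (\<lambda>y. F (vector [x, y])) holomorphic_on UNIV"
    and growth: "\<And>z. norm (F z) \<le> B * (1 + supn z) ^ k"
  obtains P where "F = bieval P"
proof -
  have B: "B \<ge> 0"
  proof (rule ccontr)
    assume "\<not> B \<ge> 0"
    hence "B * (1 + supn 0) ^ k < 0" by (intro mult_neg_pos zero_less_power) (auto simp: supn_def)
    thus False using growth[of 0] norm_ge_zero[of "F 0"] by linarith
  qed
  have bound: "norm (F z) \<le> (B * 2 ^ k) * norm w ^ k" if "supn z \<le> norm w" "norm w \<ge> 1" for z w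
  proof -
    have "norm (F z) \<le> B * (1 + supn z) ^ k" by (rule growth)
    also have "\<dots> \<le> B * (2 * norm w) ^ k"
      using that B supn_ge(3)[of z] by (intro mult_left_mono power_mono) auto
    finally show ?thesis by (simp add: power_mult_distrib algebra_simps)
  qed
  have slice1: "\<exists>p. Polynomial.degree p \<le> k \<and> (\<forall>x. F (vector [x, y]) = poly p x)" for y
  proof -
    obtain p where "Polynomial.degree p \<le> k" "\<And>x. F (vector [x, y]) = poly p x"
      by (rule entire_growth_poly[OF h1[of y], of "max 1 (norm y)" "B * 2 ^ k" k])
        (auto intro!: bound simp: supn_def)
    thus ?thesis by blast
  qed
  have slice2: "\<exists>p. \<forall>y. F (vector [x, y]) = poly p y" for x
  proof -
    obtain p where "Polynomial.degree p \<le> k" "\<And>y. F (vector [x, y]) = poly p y"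
      by (rule entire_growth_poly[OF h2[of x], of "max 1 (norm x)" "B * 2 ^ k" k])
        (auto intro!: bound simp: supn_def)
    thus ?thesis by blast
  qed
  obtain q where q: "\<And>x y. F (vector [x, y]) = poly (q x) y" using slice2 by metis
  define node :: "nat \<Rightarrow> complex" where "node = of_nat"
  define lag where "lag i = (\<Prod>j\<in>{..k} - {i}. Polynomial.smult (1 / (node i - node j)) [:- node j, 1:])" for i
  have lagv: "poly (lag i) (node j) = (if i = j then 1 else 0)" if "i \<le> k" "j \<le> k" for i j
  proof (cases "i = j")
    case True
    have "poly (Polynomial.smult (1 / (node i - node l)) [:- node l, 1:]) (node i) = 1" if "l \<in> {..k} - {i}" for l
    proof -
      have "node i - node l \<noteq> 0" using that by (auto simp: node_def)
      thus ?thesis by (simp add: diff_divide_distrib[symmetric])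
    qed
    hence "poly (lag i) (node i) = 1" unfolding lag_def poly_prod by (intro prod.neutral) blast
    thus ?thesis using True by simp
  next
    case False
    hence "j \<in> {..k} - {i}" using that by auto
    hence "(\<Prod>l\<in>{..k} - {i}. poly (Polynomial.smult (1 / (node i - node l)) [:- node l, 1:]) (node j)) = 0"
      by (intro prod_zero) auto
    thus ?thesis using False by (simp add: lag_def poly_prod)
  qed
  have lagd: "Polynomial.degree (lag i) \<le> k" if "i \<le> k" for i
  proof -
    have "Polynomial.degree (lag i) \<le> (\<Sum>j\<in>{..k} - {i}. 1)"
      unfolding lag_def
    proof (rule order_trans[OF degree_prod_sum_le])
      show "sum (Polynomial.degree \<circ> (\<lambda>j. Polynomial.smult (1 / (node i - node j)) [:- node j, 1:])) ({..k} - {i})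
        \<le> (\<Sum>j\<in>{..k} - {i}. 1)"
      proof (rule sum_mono)
        fix j
        show "(Polynomial.degree \<circ> (\<lambda>j. Polynomial.smult (1 / (node i - node j)) [:- node j, 1:])) j \<le> 1"
          using degree_smult_le[of "1 / (node i - node j)" "[:- node j, 1:]"] by simp
      qed
    qed simp
    also have "\<dots> = k" using that by simp
    finally show ?thesis .
  qed
  define P where "P = (\<Sum>i\<le>k. unisubst biX (lag i) * unisubst biY (q (node i)))"
  have "F z = bieval P z" for z
  proof -
    obtain p where p: "Polynomial.degree p \<le> k" "\<And>x. F (vector [x, z $ 2]) = poly p x" using slice1 by blast
    define r where "r = (\<Sum>i\<le>k. Polynomial.smult (poly (q (node i)) (z $ 2)) (lag i))"
    have "p = r"
    proof (rule poly_eqI_degree[of "node ` {..k}"])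
      have card: "card (node ` {..k}) = Suc k" by (subst card_image) (auto simp: node_def inj_on_def)
      show "Polynomial.degree p < card (node ` {..k})" using p(1) card by simp
      have "Polynomial.degree r \<le> k" unfolding r_def
        by (intro degree_sum_le) (auto intro: order_trans[OF degree_smult_le] lagd)
      thus "Polynomial.degree r < card (node ` {..k})" using card by simp
      fix x assume "x \<in> node ` {..k}"
      then obtain j where j: "j \<le> k" "x = node j" by auto
      have "poly r x = (\<Sum>i\<le>k. if i = j then poly (q (node i)) (z $ 2) else 0)"
        unfolding r_def poly_sum j(2) by (intro sum.cong refl) (use j(1) lagv in auto)
      also have "\<dots> = poly (q (node j)) (z $ 2)" using j(1) by (simp add: sum.delta)
      also have "\<dots> = poly p x" using p(2)[of x] q[of x "z $ 2"] j(2) by simp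
      finally show "poly p x = poly r x" by simp
    qed
    hence "F z = poly r (z $ 1)" using p(2)[of "z $ 1"] by (simp add: vector_2_eta)
    also have "\<dots> = bieval P z"
      by (simp add: r_def P_def poly_sum bieval_unisubst mult.commute del: One_nat_def)
    finally show ?thesis .
  qed
  hence "F = bieval P" by (rule ext)
  thus ?thesis by (rule that)
qed

section \<open>Escape rates\<close>

definition logp :: "complex ^ 2 \<Rightarrow> real" where
  "logp z = ln (max 1 (supn z))"

lemma supn_bounded_image:
  assumes cont: "continuous_on UNIV \<psi>"
  shows "\<exists>B'. \<forall>z. supn z \<le> B \<longrightarrow> supn (\<psi> z) \<le> B'"
proof -
  have "compact {z :: complex ^ 2. supn z \<le> B}"
  proof -
    have "{z :: complex ^ 2. supn z \<le> B} = {z. norm (z $ 1) \<le> B} \<inter> {z. norm (z $ 2) \<le> B}"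
      by (auto simp: supn_def)
    moreover have "closed {z :: complex ^ 2. norm (z $ 1) \<le> B}" "closed {z :: complex ^ 2. norm (z $ 2) \<le> B}"
      by (intro closed_Collect_le continuous_intros)+
    moreover have "bounded {z :: complex ^ 2. supn z \<le> B}"
    proof (rule boundedI)
      fix z :: "complex ^ 2" assume "z \<in> {z. supn z \<le> B}"
      moreover have "norm z \<le> norm (z $ 1) + norm (z $ 2)"
        using L2_set_le_sum[of UNIV "\<lambda>i. norm (z $ i)"] by (simp add: norm_vec_def sum_2)
      ultimately show "norm z \<le> 2 * B" using supn_ge[of z] by simp
    qed
    ultimately show ?thesis by (simp add: compact_eq_bounded_closed closed_Int)
  qed
  moreover have "continuous_on {z. supn z \<le> B} (\<lambda>z. supn (\<psi> z))"
    unfolding supn_def using cont by (intro continuous_intros continuous_on_subset[OF cont]) auto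
  ultimately have "compact ((\<lambda>z. supn (\<psi> z)) ` {z. supn z \<le> B})" by (intro compact_continuous_image)
  then obtain B' where "\<forall>x\<in>(\<lambda>z. supn (\<psi> z)) ` {z. supn z \<le> B}. norm x \<le> B'"
    using compact_imp_bounded bounded_iff by blast
  hence "supn (\<psi> z) \<le> B'" if "supn z \<le> B" for z using that by (force simp: supn_ge(3))
  thus ?thesis by blast
qed

lemma logp_nonneg [simp]: "0 \<le> logp z" by (simp add: logp_def)

lemma logp_eq: "supn z \<ge> 1 \<Longrightarrow> logp z = ln (supn z)"
  by (simp add: logp_def max_def)

lemma total_degree_growth:
  obtains M where "M \<ge> 0" "\<And>z. supn z \<ge> 1 \<Longrightarrow> total_degree P \<le> m \<Longrightarrow> norm (bieval P z) \<le> M * supn z ^ m"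
proof
  let ?M = "\<Sum>i\<le>total_degree P. \<Sum>j\<le>total_degree P. norm (bicoeff P i j)"
  show "?M \<ge> 0" by (intro sum_nonneg) auto
  fix z assume z: "supn z \<ge> 1" and m: "total_degree P \<le> m"
  have "norm (bieval P z) \<le> (\<Sum>i\<le>total_degree P. \<Sum>j\<le>total_degree P. norm (bicoeff P i j * z $ 1 ^ i * z $ 2 ^ j))"
    unfolding bieval_sum_total_degree[of P z] by (intro order_trans[OF norm_sum] sum_mono order_refl)
  also have "\<dots> \<le> (\<Sum>i\<le>total_degree P. \<Sum>j\<le>total_degree P. norm (bicoeff P i j) * supn z ^ m)"
  proof (intro sum_mono)
    fix i j
    show "norm (bicoeff P i j * z $ 1 ^ i * z $ 2 ^ j) \<le> norm (bicoeff P i j) * supn z ^ m"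
    proof (cases "bicoeff P i j = 0")
      case False
      hence ij: "i + j \<le> m" using m total_degree_le_iff[of P m] by blast
      have "norm (z $ 1 ^ i * z $ 2 ^ j) \<le> supn z ^ i * supn z ^ j"
        unfolding norm_mult norm_power using supn_ge[of z] by (intro mult_mono power_mono zero_le_power) auto
      also have "\<dots> \<le> supn z ^ m" unfolding power_add[symmetric] by (rule power_increasing[OF ij z])
      finally show ?thesis by (simp add: norm_mult mult.assoc mult_left_mono)
    qed simp
  qed
  also have "\<dots> = ?M * supn z ^ m" by (simp add: sum_distrib_right)
  finally show "norm (bieval P z) \<le> ?M * supn z ^ m" .
qed

text \<open>Automorphisms that attract the point at infinity \<open>[0:1:0]\<close> and whose inverses attract \<open>[1:0:0]\<close>.\<close>

locale henon =
  fixes f finv :: "complex ^ 2 \<Rightarrow> complex ^ 2" and d d' :: nat and c c' :: complex and M :: real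
  assumes inv1: "finv (f z) = z" and inv2: "f (finv z) = z"
    and poly: "defined_over UNIV f" "defined_over UNIV finv"
    and d: "d \<ge> 2" "d' \<ge> 2" and c: "c \<noteq> 0" "c' \<noteq> 0" and M: "M \<ge> 0"
    and f1: "\<And>z. supn z \<ge> 1 \<Longrightarrow> norm (f z $ 1) \<le> M * supn z ^ (d - 1)"
    and f2: "\<And>z. supn z \<ge> 1 \<Longrightarrow> norm (f z $ 2 - c * z $ 2 ^ d) \<le> M * supn z ^ (d - 1)"
    and i2: "\<And>z. supn z \<ge> 1 \<Longrightarrow> norm (finv z $ 2) \<le> M * supn z ^ (d' - 1)"
    and i1: "\<And>z. supn z \<ge> 1 \<Longrightarrow> norm (finv z $ 1 - c' * z $ 1 ^ d') \<le> M * supn z ^ (d' - 1)"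
begin

text \<open>Beyond \<open>R\<close> the leading term is at least 8 M + 4 times |y|^(d-1), against an
  error of M |y|^(d-1). In \<open>growth_step\<close> this makes the dominant coordinate at least
  double and the other at most a quarter of it.\<close>

definition R :: real where
  "R = Max {2, (8 * M + 4) / norm c, (8 * M + 4) / norm c'}"

lemma R: "R \<ge> 2" "norm c * R \<ge> 8 * M + 4" "norm c' * R \<ge> 8 * M + 4"
proof -
  have "R \<ge> (8 * M + 4) / norm c" "R \<ge> (8 * M + 4) / norm c'" by (simp_all add: R_def)
  thus "norm c * R \<ge> 8 * M + 4" "norm c' * R \<ge> 8 * M + 4" using c by (simp_all add: field_simps)
qed (simp add: R_def)

text \<open>The usual filtration at infinity: \<open>f\<close> expands on \<open>Vp\<close> and maps
  it into itself; \<open>finv\<close> expands on its mirror image \<open>Vm\<close>.\<close>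

definition Vp :: "(complex ^ 2) set" where "Vp = {z. norm (z $ 1) \<le> norm (z $ 2) \<and> R \<le> norm (z $ 2)}"
definition Vm :: "(complex ^ 2) set" where "Vm = {z. norm (z $ 2) \<le> norm (z $ 1) \<and> R \<le> norm (z $ 1)}"

lemma growth_step:
  fixes y b a :: complex and k :: complex and e :: nat
  assumes y: "norm y \<ge> R" and k: "norm k * R \<ge> 8 * M + 4" and e: "e \<ge> 2"
    and a: "norm a \<le> M * norm y ^ (e - 1)" and b: "norm (b - k * y ^ e) \<le> M * norm y ^ (e - 1)"
  shows "norm b \<ge> norm k / 2 * norm y ^ e" "norm b \<ge> 2 * norm y" "norm a \<le> norm b / 4"
    "norm b \<le> (norm k + M) * norm y ^ e"
proof -
  define r where "r = norm y"
  define Y where "Y = r ^ (e - 1)"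
  have r: "r \<ge> 2" "r \<ge> R" using y R by (auto simp: r_def)
  have Y: "Y \<ge> r" using power_increasing[of 1 "e - 1" r] e r by (simp add: Y_def)
  have Ye: "r ^ e = r * Y" using e by (simp add: Y_def power_eq_if)
  have kr: "norm k * r \<ge> 8 * M + 4" using k r(2) by (meson mult_left_mono norm_ge_zero order_trans)
  have nb: "norm (k * y ^ e) = norm k * r * Y" by (simp add: norm_mult norm_power r_def[symmetric] Ye)
  have lo: "norm b \<ge> norm k * r * Y - M * Y"
    using norm_triangle_ineq2[of "k * y ^ e" b] b nb by (simp add: norm_minus_commute r_def[symmetric] Y_def)
  have hi: "norm b \<le> norm k * r * Y + M * Y"
    using norm_triangle_ineq2[of b "k * y ^ e"] b nb by (simp add: r_def[symmetric] Y_def)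
  have Y0: "Y \<ge> 0" using Y r by linarith
  have MY: "M * Y \<ge> 0" using M Y0 by simp
  have prod: "norm k * r * Y \<ge> (8 * M + 4) * Y" using kr Y0 by (rule mult_right_mono)
  hence prod': "norm k * r * Y \<ge> 8 * (M * Y) + 4 * Y" by (simp add: algebra_simps)
  show half: "norm b \<ge> norm k / 2 * norm y ^ e"
  proof -
    have "norm k * r * Y / 2 \<le> norm b" using lo prod' MY Y0 by linarith
    moreover have "norm k / 2 * norm y ^ e = norm k * r * Y / 2" by (simp add: r_def[symmetric] Ye)
    ultimately show ?thesis by linarith
  qed
  show "norm b \<ge> 2 * norm y" using lo prod' MY Y Y0 unfolding r_def[symmetric] by linarith
  have "norm a \<le> M * Y" using a by (simp add: Y_def r_def)
  thus "norm a \<le> norm b / 4" using lo prod' MY Y0 by linarith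
  have "Y \<le> r * Y" using mult_right_mono[of 1 r Y] r Y0 by simp
  hence "M * Y \<le> M * (r * Y)" using M by (rule mult_left_mono)
  thus "norm b \<le> (norm k + M) * norm y ^ e" using hi by (simp add: r_def[symmetric] Ye algebra_simps)
qed

lemma Vp_supn: "z \<in> Vp \<Longrightarrow> supn z = norm (z $ 2)" by (simp add: Vp_def supn_def)
lemma Vm_supn: "z \<in> Vm \<Longrightarrow> supn z = norm (z $ 1)" by (simp add: Vm_def supn_def)

lemma Vp_step:
  assumes "z \<in> Vp"
  shows "norm (f z $ 2) \<ge> norm c / 2 * norm (z $ 2) ^ d" "norm (f z $ 2) \<ge> 2 * norm (z $ 2)"
    "norm (f z $ 1) \<le> norm (f z $ 2) / 4" "norm (f z $ 2) \<le> (norm c + M) * norm (z $ 2) ^ d"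
proof -
  have z: "norm (z $ 2) \<ge> R" using assms by (simp add: Vp_def)
  have s: "supn z = norm (z $ 2)" "supn z \<ge> 1" using Vp_supn[OF assms] z R by auto
  note g = growth_step[OF z R(2) d(1) f1[OF s(2), unfolded s(1)] f2[OF s(2), unfolded s(1)]]
  show "norm (f z $ 2) \<ge> norm c / 2 * norm (z $ 2) ^ d" "norm (f z $ 2) \<ge> 2 * norm (z $ 2)"
    "norm (f z $ 1) \<le> norm (f z $ 2) / 4" "norm (f z $ 2) \<le> (norm c + M) * norm (z $ 2) ^ d" by (fact g)+
qed

lemma Vm_step:
  assumes "z \<in> Vm"
  shows "norm (finv z $ 1) \<ge> 2 * norm (z $ 1)" "norm (finv z $ 2) \<le> norm (finv z $ 1) / 4"
proof -
  have z: "norm (z $ 1) \<ge> R" using assms by (simp add: Vm_def)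
  have s: "supn z = norm (z $ 1)" "supn z \<ge> 1" using Vm_supn[OF assms] z R by auto
  note g = growth_step[OF z R(3) d(2) i2[OF s(2), unfolded s(1)] i1[OF s(2), unfolded s(1)]]
  show "norm (finv z $ 1) \<ge> 2 * norm (z $ 1)" "norm (finv z $ 2) \<le> norm (finv z $ 1) / 4" by (fact g)+
qed

lemma Vp_invariant:
  assumes "z \<in> Vp" shows "f z \<in> Vp" "norm (f z $ 1) < norm (f z $ 2)" "R < norm (f z $ 2)"
proof -
  have "norm (z $ 2) \<ge> R" using assms by (simp add: Vp_def)
  hence b: "norm (f z $ 2) \<ge> 2 * R" using Vp_step(2)[OF assms] by linarith
  thus "norm (f z $ 1) < norm (f z $ 2)" "R < norm (f z $ 2)" using Vp_step(3)[OF assms] R by linarith+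
  thus "f z \<in> Vp" by (simp add: Vp_def)
qed

lemma Vp_iterate: "z \<in> Vp \<Longrightarrow> (f ^^ n) z \<in> Vp"
  by (induction n) (auto intro: Vp_invariant)

lemma Vp_iterate_growth: "z \<in> Vp \<Longrightarrow> norm ((f ^^ n) z $ 2) \<ge> 2 ^ n * norm (z $ 2)"
proof (induction n)
  case (Suc n)
  have "2 * norm ((f ^^ n) z $ 2) \<le> norm (f ((f ^^ n) z) $ 2)" using Vp_step(2) Vp_iterate Suc.prems by blast
  thus ?case using Suc by simp
qed simp

section \<open>Escaping points and the escape rate\<close>

definition escapes :: "complex ^ 2 \<Rightarrow> bool" where "escapes z \<longleftrightarrow> (\<exists>n. (f ^^ n) z \<in> Vp)"

lemma not_Vp_cases: "z \<notin> Vp \<Longrightarrow> supn z < R \<or> z \<in> Vm"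
  by (auto simp: Vp_def Vm_def supn_def max_def split: if_splits)

text \<open>A point that is large and not in \<open>Vp\<close> lies in \<open>Vm\<close>, and there
  the preimage is at least twice as large. An orbit avoiding \<open>Vp\<close> therefore does not
  grow outside the ball of radius \<open>R\<close>.\<close>

lemma bounded_if_not_escapes:
  assumes "\<not> escapes z" shows "supn ((f ^^ n) z) \<le> max R (supn z)"
proof (induction n)
  case (Suc n)
  have "f ((f ^^ n) z) \<notin> Vp" using assms unfolding escapes_def by (metis comp_apply funpow.simps(2))
  thus ?case
  proof (cases "f ((f ^^ n) z) \<in> Vm")
    case True
    have "norm ((f ^^ n) z $ 1) \<ge> 2 * norm (f ((f ^^ n) z) $ 1)" using Vm_step(1)[OF True] by (simp add: inv1)
    hence "supn (f ((f ^^ n) z)) \<le> supn ((f ^^ n) z)"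
      using Vm_supn[OF True] supn_ge(1)[of "(f ^^ n) z"] norm_ge_zero[of "f ((f ^^ n) z) $ 1"] by linarith
    thus ?thesis using Suc by simp
  next
    case False
    hence "supn (f ((f ^^ n) z)) < R" using not_Vp_cases \<open>f ((f ^^ n) z) \<notin> Vp\<close> by blast
    thus ?thesis by simp
  qed
qed simp

lemma logp_growth: obtains C where "C \<ge> 0" "\<And>z. logp (f z) \<le> d * logp z + C"
proof -
  define B where "B = norm c + 2 * M + 1"
  have B1: "B \<ge> 1" using M by (simp add: B_def)
  obtain C0 where C0: "\<And>z. supn z \<le> 1 \<Longrightarrow> supn (f z) \<le> C0"
  proof -
    have "hol_map f" by (rule hol_map_polymap[OF poly(1)])
    thus ?thesis using supn_bounded_image[of f 1] that unfolding hol_map_def by metis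
  qed
  define C where "C = ln (max B (max 1 C0))"
  have "C \<ge> 0" by (simp add: C_def)
  moreover have "logp (f z) \<le> d * logp z + C" for z
  proof (cases "supn z \<ge> 1")
    case True
    define s where "s = supn z"
    have s: "s \<ge> 1" using True by (simp add: s_def)
    have sd: "s ^ (d - 1) \<le> s ^ d" by (intro power_increasing s) simp
    hence Msd: "M * s ^ (d - 1) \<le> M * s ^ d" using M by (rule mult_left_mono)
    have z2: "norm (c * z $ 2 ^ d) \<le> norm c * s ^ d"
      unfolding norm_mult norm_power s_def using supn_ge[of z] by (intro mult_left_mono power_mono) auto
    have "norm (f z $ 2) \<le> norm c * s ^ d + M * s ^ d"
      using norm_triangle_sub[of "f z $ 2" "c * z $ 2 ^ d"] f2[OF True] z2 Msd by (simp add: s_def)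
    moreover have "norm (f z $ 1) \<le> M * s ^ d" using f1[OF True] Msd by (simp add: s_def)
    moreover have "B * s ^ d = norm c * s ^ d + M * s ^ d + M * s ^ d + s ^ d" by (simp add: B_def algebra_simps)
    moreover have "M * s ^ d \<ge> 0" "norm c * s ^ d \<ge> 0" "s ^ d \<ge> 1" using M s by auto
    ultimately have "norm (f z $ 2) \<le> B * s ^ d" "norm (f z $ 1) \<le> B * s ^ d" "1 \<le> B * s ^ d"
      by linarith+
    hence "supn (f z) \<le> B * s ^ d" "1 \<le> B * s ^ d" by (simp_all add: supn_def)
    hence "logp (f z) \<le> ln (B * s ^ d)" unfolding logp_def by (intro ln_mono) auto
    also have "\<dots> = ln B + d * ln s" using B1 s by (simp add: ln_mult ln_realpow)
    also have "ln B \<le> C" unfolding C_def using B1 by (intro ln_mono) auto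
    also have "ln s = logp z" using s by (simp add: s_def logp_eq)
    finally show ?thesis by simp
  next
    case False
    hence "supn (f z) \<le> C0" using C0 by simp
    hence "logp (f z) \<le> C" unfolding logp_def C_def by (intro ln_mono) auto
    thus ?thesis by (simp add: add_increasing)
  qed  ultimately show ?thesis by (rule that)
qed

lemma logp_iterate: obtains C where "C \<ge> 0" "\<And>n z. logp ((f ^^ n) z) \<le> real d ^ n * (logp z + C)"
proof -
  obtain C where C: "C \<ge> 0" "\<And>z. logp (f z) \<le> d * logp z + C" using logp_growth by blast
  have "logp ((f ^^ n) z) + C \<le> real d ^ n * (logp z + C)" for n z
  proof (induction n)
    case (Suc n)
    have "logp ((f ^^ Suc n) z) + C \<le> d * logp ((f ^^ n) z) + 2 * C" using C(2)[of "(f ^^ n) z"] by simp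
    also have "2 * C \<le> d * C" using C(1) d by (intro mult_right_mono) auto
    also have "d * logp ((f ^^ n) z) + d * C = d * (logp ((f ^^ n) z) + C)" by (simp add: algebra_simps)
    also have "\<dots> \<le> d * (real d ^ n * (logp z + C))" by (intro mult_left_mono Suc) simp
    finally show ?case by (simp add: algebra_simps)
  qed simp
  hence "logp ((f ^^ n) z) \<le> real d ^ n * (logp z + C)" for n z using C(1) by (meson add_increasing2 le_add_same_cancel1 order_trans)
  thus ?thesis using that C(1) by blast
qed

text \<open>The Green function of the escaping set. The limit exists by \<open>G_tendsto\<close>;
  for bounded orbits it is 0.\<close>

definition G :: "complex ^ 2 \<Rightarrow> real" where "G w = lim (\<lambda>n. logp ((f ^^ n) w) / real d ^ n)"

definition Cg :: real where "Cg = max \<bar>ln (norm c / 2)\<bar> \<bar>ln (norm c + M)\<bar>"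

lemma Vp_logp: "z \<in> Vp \<Longrightarrow> logp z = ln (norm (z $ 2))"
  using Vp_supn R by (subst logp_eq) (auto simp: Vp_def)

lemma Vp_log_step:
  assumes "z \<in> Vp" shows "\<bar>logp (f z) - d * logp z\<bar> \<le> Cg"
proof -
  have y: "norm (z $ 2) > 0" using assms R by (auto simp: Vp_def)
  have fy: "norm (f z $ 2) > 0" using Vp_step(2)[OF assms] y by linarith
  have nc: "norm c / 2 > 0" "norm c + M > 0" using c M by (auto simp: add_pos_nonneg)
  have "ln (norm c / 2 * norm (z $ 2) ^ d) \<le> ln (norm (f z $ 2))"
    using Vp_step(1)[OF assms] y nc by (intro ln_mono) auto
  hence 1: "ln (norm c / 2) + d * ln (norm (z $ 2)) \<le> ln (norm (f z $ 2))"
    using y nc by (simp only: ln_mult_pos[OF nc(1) zero_less_power[OF y]] ln_realpow)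
  have "ln (norm (f z $ 2)) \<le> ln ((norm c + M) * norm (z $ 2) ^ d)"
    using Vp_step(4)[OF assms] fy by (intro ln_mono) auto
  hence 2: "ln (norm (f z $ 2)) \<le> ln (norm c + M) + d * ln (norm (z $ 2))"
    using y nc by (simp only: ln_mult_pos[OF nc(2) zero_less_power[OF y]] ln_realpow)
  show ?thesis unfolding Vp_logp[OF assms] Vp_logp[OF Vp_invariant(1)[OF assms]] Cg_def
    using 1 2 by linarith
qed

text \<open>The telescoping differences are at most Cg / d^(n+1) \<le> Cg / 2^(n+1), whose sum is
  \<open>Cg\<close>. So the same constant bounds one step and the limit.\<close>

lemma Vp_convergent:
  assumes "z \<in> Vp"
  shows "convergent (\<lambda>n. logp ((f ^^ n) z) / real d ^ n)" "\<bar>lim (\<lambda>n. logp ((f ^^ n) z) / real d ^ n) - logp z\<bar> \<le> Cg"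
proof -
  define a where "a n = logp ((f ^^ n) z) / real d ^ n" for n
  have Cg0: "Cg \<ge> 0" by (simp add: Cg_def le_max_iff_disj)
  have step: "\<bar>a (Suc n) - a n\<bar> \<le> Cg * (1 / 2) ^ Suc n" for n
  proof -
    let ?w = "(f ^^ n) z"
    have dn: "(real d) ^ Suc n > 0" using d by simp
    have "a (Suc n) - a n = (logp (f ?w) - d * logp ?w) / real d ^ Suc n" using d by (simp add: a_def field_simps)
    hence "\<bar>a (Suc n) - a n\<bar> = \<bar>logp (f ?w) - d * logp ?w\<bar> / real d ^ Suc n" using dn by simp
    also have "\<dots> \<le> Cg / real d ^ Suc n" using Vp_log_step[OF Vp_iterate[OF assms]] dn by (intro divide_right_mono) auto
    also have "\<dots> \<le> Cg / 2 ^ Suc n"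
    proof (rule divide_left_mono[OF _ Cg0])
      show "2 ^ Suc n \<le> real d ^ Suc n" using d by (intro power_mono) auto
      show "0 < real d ^ Suc n * 2 ^ Suc n" using dn by (intro mult_pos_pos) auto
    qed
    finally show ?thesis by (simp only: power_one_over times_divide_eq_right mult_1_right)
  qed
  have gs: "(\<lambda>n. Cg * (1 / 2) ^ Suc n) sums Cg"
    using sums_mult[OF geometric_sums[of "1 / 2 :: real"], of "Cg / 2"] by simp
  have summ: "summable (\<lambda>n. a (Suc n) - a n)"
    by (rule summable_comparison_test'[OF sums_summable[OF gs], of 0]) (simp only: real_norm_def step)
  have "(\<lambda>n. a (Suc n) - a n) sums suminf (\<lambda>n. a (Suc n) - a n)" using summ by (rule summable_sums)
  hence "(\<lambda>n. \<Sum>k<n. a (Suc k) - a k) \<longlonglongrightarrow> suminf (\<lambda>n. a (Suc n) - a n)" by (simp add: sums_def)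
  hence "(\<lambda>n. a n - a 0) \<longlonglongrightarrow> suminf (\<lambda>n. a (Suc n) - a n)" by (simp only: sum_lessThan_telescope)
  hence "(\<lambda>n. a n - a 0 + a 0) \<longlonglongrightarrow> suminf (\<lambda>n. a (Suc n) - a n) + a 0" by (intro tendsto_intros)
  hence lim: "a \<longlonglongrightarrow> suminf (\<lambda>n. a (Suc n) - a n) + a 0" by simp
  have "norm (suminf (\<lambda>n. a (Suc n) - a n)) \<le> suminf (\<lambda>n. Cg * (1 / 2) ^ Suc n)"
    by (rule norm_suminf_le[OF _ sums_summable[OF gs]]) (simp only: real_norm_def step)
  hence "\<bar>suminf (\<lambda>n. a (Suc n) - a n)\<bar> \<le> Cg" using sums_unique[OF gs] by simp
  hence "\<bar>lim a - a 0\<bar> \<le> Cg" using limI[OF lim] by linarith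
  thus "\<bar>lim (\<lambda>n. logp ((f ^^ n) z) / real d ^ n) - logp z\<bar> \<le> Cg"
    unfolding a_def[abs_def] by simp
  show "convergent (\<lambda>n. logp ((f ^^ n) z) / real d ^ n)" using lim unfolding convergent_def a_def by blast
qed

lemma shift_tendsto:
  assumes "(\<lambda>n. logp ((f ^^ n) ((f ^^ k) z)) / real d ^ n) \<longlonglongrightarrow> l"
  shows "(\<lambda>n. logp ((f ^^ n) z) / real d ^ n) \<longlonglongrightarrow> l / real d ^ k"
proof -
  have "(\<lambda>n. logp ((f ^^ (n + k)) z) / real d ^ (n + k)) = (\<lambda>n. logp ((f ^^ n) ((f ^^ k) z)) / real d ^ n / real d ^ k)"
    by (simp add: funpow_add power_add)
  moreover have "(\<lambda>n. logp ((f ^^ n) ((f ^^ k) z)) / real d ^ n / real d ^ k) \<longlonglongrightarrow> l / real d ^ k"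
    using d by (intro tendsto_intros assms) auto
  ultimately show ?thesis using LIMSEQ_offset[of "\<lambda>n. logp ((f ^^ n) z) / real d ^ n" k] by simp
qed

lemma G_tendsto: "(\<lambda>n. logp ((f ^^ n) w) / real d ^ n) \<longlonglongrightarrow> G w"
proof -
  have "convergent (\<lambda>n. logp ((f ^^ n) w) / real d ^ n)"
  proof (cases "escapes w")
    case True
    then obtain k where "(f ^^ k) w \<in> Vp" by (auto simp: escapes_def)
    from Vp_convergent(1)[OF this] show ?thesis using shift_tendsto unfolding convergent_def by blast
  next
    case False
    let ?B = "ln (max 1 (max R (supn w)))"
    have b: "logp ((f ^^ n) w) \<le> ?B" for n
      unfolding logp_def using bounded_if_not_escapes[OF False, of n] by (intro ln_mono) auto
    have "(\<lambda>n. logp ((f ^^ n) w) / real d ^ n) \<longlonglongrightarrow> 0"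
    proof (rule tendsto_sandwich[OF _ _ tendsto_const])
      show "(\<lambda>n. ?B * (1 / real d) ^ n) \<longlonglongrightarrow> 0"
        using d by (intro tendsto_mult_right_zero LIMSEQ_power_zero) simp
      show "eventually (\<lambda>n. logp ((f ^^ n) w) / real d ^ n \<le> ?B * (1 / real d) ^ n) sequentially"
        using b by (intro always_eventually allI) (simp add: power_one_over divide_right_mono)
    qed (intro always_eventually allI divide_nonneg_nonneg, auto)
    thus ?thesis unfolding convergent_def by blast
  qed
  thus ?thesis unfolding G_def by (simp add: convergent_LIMSEQ_iff)
qed

lemma G_f: "G (f w) = d * G w"
proof -
  have "(\<lambda>n. logp ((f ^^ n) ((f ^^ 1) w)) / real d ^ n) \<longlonglongrightarrow> G (f w)" using G_tendsto[of "f w"] by simp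
  from shift_tendsto[OF this] have "G w = G (f w) / d" using LIMSEQ_unique[OF G_tendsto[of w]] by simp
  thus ?thesis using d by simp
qed

lemma G_funpow: "G ((f ^^ n) w) = real d ^ n * G w"
  by (induction n) (simp_all add: G_f)

lemma G_nonneg: "G w \<ge> 0"
  by (rule LIMSEQ_le_const[OF G_tendsto]) auto

lemma G_Vp: "z \<in> Vp \<Longrightarrow> \<bar>G z - logp z\<bar> \<le> Cg"
  unfolding G_def by (rule Vp_convergent(2))

text \<open>Far along the orbit \<open>logp\<close> exceeds the error \<open>Cg\<close> of
  \<open>G_Vp\<close>, so \<open>G\<close> is positive there, and the functional equation brings
  this back to \<open>z\<close>.\<close>

lemma G_pos: assumes "escapes z" shows "G z > 0"
proof -
  obtain k where k: "(f ^^ k) z \<in> Vp" using assms by (auto simp: escapes_def)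
  obtain n where n: "real n > Cg / ln 2" using reals_Archimedean2 by blast
  let ?w = "(f ^^ n) ((f ^^ k) z)"
  have w: "?w \<in> Vp" by (rule Vp_iterate[OF k])
  have "norm (?w $ 2) \<ge> 2 ^ n * norm ((f ^^ k) z $ 2)" by (rule Vp_iterate_growth[OF k])
  moreover have "norm ((f ^^ k) z $ 2) \<ge> 1" using k R by (simp add: Vp_def)
  hence "2 ^ n * norm ((f ^^ k) z $ 2) \<ge> 2 ^ n * 1" by (rule mult_left_mono) simp
  ultimately have "norm (?w $ 2) \<ge> 2 ^ n" by linarith
  hence "ln (norm (?w $ 2)) \<ge> ln (2 ^ n)" by (intro ln_mono) auto
  hence "logp ?w \<ge> n * ln 2" using Vp_logp[OF w] by (simp add: ln_realpow)
  moreover have "n * ln 2 > Cg" using n by (simp add: field_simps)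
  ultimately have "G ?w > 0" using G_Vp[OF w] by linarith
  hence "real d ^ n * (real d ^ k * G z) > 0" by (simp add: G_funpow)
  thus ?thesis using d by (simp add: zero_less_mult_iff)
qed

lemma G_upper: obtains C where "C \<ge> 0" "\<And>w. G w \<le> logp w + C"
proof -
  obtain C where C: "C \<ge> 0" "\<And>n z. logp ((f ^^ n) z) \<le> real d ^ n * (logp z + C)" using logp_iterate by blast
  have "G w \<le> logp w + C" for w
  proof (rule LIMSEQ_le_const2[OF G_tendsto], intro exI allI impI)
    fix n show "logp ((f ^^ n) w) / real d ^ n \<le> logp w + C"
      using C(2)[of n w] d by (simp add: divide_le_eq mult.commute)
  qed
  thus ?thesis using that C(1) by blast
qed

lemma hol2_funpow: "hol2 S \<gamma> \<Longrightarrow> hol2 S (\<lambda>t. (f ^^ n) (\<gamma> t))"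
  by (induction n) (auto intro: hol2_polymap[OF poly(1)])

lemma hol2_continuous: "hol2 S \<gamma> \<Longrightarrow> continuous_on S (\<lambda>t. \<gamma> t $ i)"
  using exhaust_2[of i] holomorphic_on_imp_continuous_on unfolding hol2_def by auto

text \<open>For large n the second coordinate of the n-th iterate along the curve is holomorphic and
  larger than 1 in absolute value on the disc. \<open>harnack_log\<close> applies to it, and the
  inequality passes to the limit after division by d^n.\<close>

lemma harnack_G:
  assumes S: "open S" "cball a \<rho> \<subseteq> S" and \<gamma>: "hol2 S \<gamma>" and esc: "\<And>t. t \<in> cball a \<rho> \<Longrightarrow> escapes (\<gamma> t)"
    and z: "z \<in> ball a \<rho>"
  shows "G (\<gamma> a) * (\<rho> - dist a z) \<le> (\<rho> + dist a z) * G (\<gamma> z)"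
proof -
  \<comment> \<open>\<open>Vp\<close> with strict inequalities, to get open sets. Orbits enter it
    one step after \<open>Vp\<close>, the sets increase with n, and compactness of the disc yields
    one n for all its points.\<close>
  define Oc where "Oc n = {t \<in> S. norm ((f ^^ n) (\<gamma> t) $ 1) < norm ((f ^^ n) (\<gamma> t) $ 2) \<and> R < norm ((f ^^ n) (\<gamma> t) $ 2)}" for n
  have O_open: "open (Oc n)" for n
  proof -
    have c: "continuous_on S (\<lambda>t. norm ((f ^^ n) (\<gamma> t) $ i))" for i
      by (intro continuous_on_norm hol2_continuous[OF hol2_funpow[OF \<gamma>]])
    have less: "open {t \<in> S. p t < q t}" if pq: "continuous_on S p" "continuous_on S q" for p q :: "complex \<Rightarrow> real"
    proof -
      obtain T where T: "open T" "T \<inter> S = {t \<in> S. p t < q t}" using open_Collect_less_Int[OF pq] by blast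
      show ?thesis unfolding T(2)[symmetric] by (rule open_Int[OF T(1) S(1)])
    qed
    have "open {t \<in> S. norm ((f ^^ n) (\<gamma> t) $ 1) < norm ((f ^^ n) (\<gamma> t) $ 2)}"
      "open {t \<in> S. R < norm ((f ^^ n) (\<gamma> t) $ 2)}"
      by (intro less c continuous_on_const)+
    hence "open ({t \<in> S. norm ((f ^^ n) (\<gamma> t) $ 1) < norm ((f ^^ n) (\<gamma> t) $ 2)} \<inter> {t \<in> S. R < norm ((f ^^ n) (\<gamma> t) $ 2)})"
      by (rule open_Int)
    moreover have "Oc n = {t \<in> S. norm ((f ^^ n) (\<gamma> t) $ 1) < norm ((f ^^ n) (\<gamma> t) $ 2)} \<inter> {t \<in> S. R < norm ((f ^^ n) (\<gamma> t) $ 2)}"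
      unfolding Oc_def by auto
    ultimately show ?thesis by simp
  qed
  have O_step: "Oc n \<subseteq> Oc (Suc n)" for n
    unfolding Oc_def using Vp_invariant by (auto simp: Vp_def)
  have O_mono: "Oc m \<subseteq> Oc n" if "m \<le> n" for m n
    using that O_step by (rule lift_Suc_mono_le[of Oc, rotated])
  have cover: "cball a \<rho> \<subseteq> (\<Union>n\<in>UNIV. Oc n)"
  proof
    fix t assume t: "t \<in> cball a \<rho>"
    then obtain n where n: "(f ^^ n) (\<gamma> t) \<in> Vp" using esc by (auto simp: escapes_def)
    have "t \<in> Oc (Suc n)" using Vp_invariant(2,3)[OF n] S(2) t by (auto simp: Oc_def)
    thus "t \<in> (\<Union>n\<in>UNIV. Oc n)" by blast
  qed
  obtain C' where C': "finite C'" "cball a \<rho> \<subseteq> (\<Union>n\<in>C'. Oc n)"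
    using compactE_image[OF compact_cball O_open cover] by metis
  define N0 where "N0 = Max (insert 0 C')"
  have inO: "t \<in> Oc n" if "n \<ge> N0" "t \<in> cball a \<rho>" for n t
  proof -
    obtain m where m: "m \<in> C'" "t \<in> Oc m" using C'(2) \<open>t \<in> cball a \<rho>\<close> by blast
    have "m \<le> N0" unfolding N0_def using C'(1) m(1) by (intro Max_ge) auto
    thus ?thesis using O_mono[of m n] m(2) that(1) by (meson le_trans subsetD)
  qed
  have lp: "logp ((f ^^ n) (\<gamma> t)) = ln (norm ((f ^^ n) (\<gamma> t) $ 2)) \<and> norm ((f ^^ n) (\<gamma> t) $ 2) > 1"
    if "n \<ge> N0" "t \<in> cball a \<rho>" for n t
  proof -
    have "(f ^^ n) (\<gamma> t) \<in> Vp" using inO[OF that] by (auto simp: Oc_def Vp_def)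
    thus ?thesis using Vp_logp R by (auto simp: Vp_def)
  qed
  have \<rho>: "\<rho> > 0" using z by (metis ball_eq_empty empty_iff not_le)
  have main: "logp ((f ^^ n) (\<gamma> a)) * (\<rho> - dist a z) \<le> (\<rho> + dist a z) * logp ((f ^^ n) (\<gamma> z))" if n: "n \<ge> N0" for n
  proof -
    have "(\<lambda>t. (f ^^ n) (\<gamma> t) $ 2) holomorphic_on S" using hol2_funpow[OF \<gamma>] by (simp add: hol2_def)
    hence "(\<lambda>t. (f ^^ n) (\<gamma> t) $ 2) holomorphic_on ball a \<rho>"
      by (rule holomorphic_on_subset) (use S(2) ball_subset_cball in blast)
    from harnack_log[OF this _ z] have
      "ln (norm ((f ^^ n) (\<gamma> a) $ 2)) * (\<rho> - dist a z) \<le> (\<rho> + dist a z) * ln (norm ((f ^^ n) (\<gamma> z) $ 2))"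
      using lp[OF n] by auto
    thus ?thesis using lp[OF n, of a] lp[OF n, of z] \<rho> z by simp
  qed
  have "(\<lambda>n. logp ((f ^^ n) (\<gamma> a)) / real d ^ n * (\<rho> - dist a z)) \<longlonglongrightarrow> G (\<gamma> a) * (\<rho> - dist a z)"
    by (intro tendsto_intros G_tendsto)
  moreover have "(\<lambda>n. (\<rho> + dist a z) * (logp ((f ^^ n) (\<gamma> z)) / real d ^ n)) \<longlonglongrightarrow> (\<rho> + dist a z) * G (\<gamma> z)"
    by (intro tendsto_intros G_tendsto)
  ultimately show ?thesis
  proof (rule LIMSEQ_le, intro exI[of _ N0] allI impI)
    fix n assume n: "N0 \<le> n"
    show "logp ((f ^^ n) (\<gamma> a)) / real d ^ n * (\<rho> - dist a z) \<le> (\<rho> + dist a z) * (logp ((f ^^ n) (\<gamma> z)) / real d ^ n)"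
      using divide_right_mono[OF main[OF n], of "real d ^ n"] by simp
  qed
qed

end

section \<open>Holomorphic conjugacies have polynomial growth\<close>

locale henon_conjugacy = F: henon f finv df df' cf cf' Mf + H: henon g ginv dg dg' cg cg' Mg
  for f finv df df' cf cf' Mf g ginv dg dg' cg cg' Mg +
  fixes \<phi> \<phi>inv :: "complex ^ 2 \<Rightarrow> complex ^ 2"
  assumes hol: "hol_map \<phi>" "hol_map \<phi>inv"
    and \<phi>inv1: "\<phi>inv (\<phi> z) = z" and \<phi>inv2: "\<phi> (\<phi>inv z) = z"
    and conj: "\<phi> (f z) = g (\<phi> z)"
begin

lemma conj_iterate: "\<phi> ((f ^^ n) z) = (g ^^ n) (\<phi> z)"
  by (induction n) (simp_all add: conj)

text \<open>A bounded orbit of \<open>g\<close> is carried by the continuous map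
  \<open>\<phi>inv\<close> to a bounded orbit of \<open>f\<close>, whereas escaping orbits double in
  size at each step.\<close>

lemma escapes_image:
  assumes "F.escapes z" shows "H.escapes (\<phi> z)"
proof (rule ccontr)
  assume ne: "\<not> H.escapes (\<phi> z)"
  obtain B where B: "\<And>w. supn w \<le> max H.R (supn (\<phi> z)) \<Longrightarrow> supn (\<phi>inv w) \<le> B"
    using supn_bounded_image[of \<phi>inv "max H.R (supn (\<phi> z))"] hol(2) unfolding hol_map_def by metis
  have bd: "supn ((f ^^ n) z) \<le> B" for n
  proof -
    have "(f ^^ n) z = \<phi>inv ((g ^^ n) (\<phi> z))" by (simp add: conj_iterate[symmetric] \<phi>inv1)
    thus ?thesis using B[OF H.bounded_if_not_escapes[OF ne, of n]] by simp
  qed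
  obtain k where k: "(f ^^ k) z \<in> F.Vp" using assms by (auto simp: F.escapes_def)
  have y: "norm ((f ^^ k) z $ 2) \<ge> 1" using k F.R by (simp add: F.Vp_def)
  have "2 ^ n \<le> B" for n
  proof -
    have "2 ^ n * 1 \<le> 2 ^ n * norm ((f ^^ k) z $ 2)" using y by (rule mult_left_mono) simp
    also have "\<dots> \<le> norm ((f ^^ n) ((f ^^ k) z) $ 2)" by (rule F.Vp_iterate_growth[OF k])
    also have "\<dots> \<le> supn ((f ^^ (n + k)) z)" using supn_ge(2) by (simp add: funpow_add)
    also have "\<dots> \<le> B" by (rule bd)
    finally show ?thesis by simp
  qed
  moreover obtain n where "B < 2 ^ n" using real_arch_pow[of 2 B] by auto
  ultimately show False by (meson not_less)
qed

definition u :: "complex ^ 2 \<Rightarrow> real" where "u z = H.G (\<phi> z)"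

lemma u_nonneg: "u z \<ge> 0" by (simp add: u_def H.G_nonneg)

lemma u_iterate: "u ((f ^^ n) z) = real dg ^ n * u z"
  by (simp add: u_def conj_iterate H.G_funpow)

lemma Vp_escapes: "z \<in> F.Vp \<Longrightarrow> F.escapes z"
  unfolding F.escapes_def by (intro exI[of _ 0]) simp

lemma harnack_u:
  assumes "open S" "cball a \<rho> \<subseteq> S" "hol2 S \<gamma>" "\<And>t. t \<in> cball a \<rho> \<Longrightarrow> \<gamma> t \<in> F.Vp" "z \<in> ball a \<rho>"
  shows "u (\<gamma> a) * (\<rho> - dist a z) \<le> (\<rho> + dist a z) * u (\<gamma> z)"
  unfolding u_def
proof (rule H.harnack_G[OF assms(1,2) _ _ assms(5)])
  show "hol2 S (\<lambda>t. \<phi> (\<gamma> t))" using hol(1) assms(1,3) unfolding hol_map_def by blast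
  show "H.escapes (\<phi> (\<gamma> t))" if "t \<in> cball a \<rho>" for t
    by (intro escapes_image Vp_escapes assms(4) that)
qed

text \<open>The disc about \<open>p $ 1\<close> of radius |y|/2 stays in \<open>Vp\<close>, and 0
  lies within half that radius. The Harnack quotient is then at most (3/4) / (1/4) = 3.\<close>

lemma horizontal:
  assumes p: "p \<in> F.Vp" "norm (p $ 1) \<le> norm (p $ 2) / 4"
  shows "u p \<le> 3 * u (vector [0, p $ 2])"
proof -
  let ?y = "p $ 2" and ?x = "p $ 1"
  let ?r = "norm ?y / 2"
  have y: "norm ?y \<ge> F.R" "norm ?y > 0" using p(1) F.R by (auto simp: F.Vp_def)
  have "u (vector [?x, ?y]) * (?r - dist ?x 0) \<le> (?r + dist ?x 0) * u (vector [0, ?y])"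
  proof (rule harnack_u[of UNIV])
    show "hol2 UNIV (\<lambda>t. vector [t, ?y])" by (auto simp: hol2_def intro!: holomorphic_intros)
    fix t assume "t \<in> cball ?x ?r"
    hence "norm (t - ?x) \<le> ?r" by (simp add: dist_norm norm_minus_commute)
    hence "norm t \<le> norm ?y" using norm_triangle_sub[of t ?x] p(2) y by linarith
    thus "vector [t, ?y] \<in> F.Vp" using y by (simp add: F.Vp_def)
  next
    have "norm ?x < ?r" using p(2) y by linarith
    thus "0 \<in> ball ?x ?r" by simp
  qed auto
  hence 1: "u p * (?r - norm ?x) \<le> (?r + norm ?x) * u (vector [0, ?y])" by (simp add: vector_2_eta)
  have "u p * (norm ?y / 4) \<le> u p * (?r - norm ?x)" using p(2) u_nonneg by (intro mult_left_mono) auto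
  also note 1
  also have "(?r + norm ?x) * u (vector [0, ?y]) \<le> (3 * norm ?y / 4) * u (vector [0, ?y])"
    using p(2) u_nonneg by (intro mult_right_mono) auto
  finally have "u p * norm ?y \<le> 3 * u (vector [0, ?y]) * norm ?y" by (simp add: mult_ac)
  thus ?thesis using y(2) by simp
qed

text \<open>The curve t -> (0, exp t) lies in \<open>Vp\<close> for Re t \<ge> ln R. The disc about
  Ln y reaches to Re t = ln R + 1 and contains the comparison point at Re t = ln R + 2, so \<rho>
  minus the distance is 1 and their sum is below 2 ln |y|.\<close>

lemma vertical:
  assumes B: "\<And>y. norm y = F.R * exp 2 \<Longrightarrow> u (vector [0, y]) \<le> B"
    and y: "norm y \<ge> F.R * exp 3"
  shows "u (vector [0, y]) \<le> 2 * ln (norm y) * B"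
proof -
  have R1: "F.R > 1" using F.R by linarith
  have y0: "norm y > 0" using y R1 by (meson exp_gt_zero less_le_trans mult_pos_pos zero_less_one order_less_trans)
  have lR: "ln F.R > 0" using R1 by simp
  have "ln (F.R * exp 3) \<le> ln (norm y)" using y y0 R1 by (intro ln_mono) auto
  hence T: "ln (norm y) \<ge> ln F.R + 3" using R1 by (simp add: ln_mult)
  define a where "a = Ln y"
  define \<rho> where "\<rho> = ln (norm y) - ln F.R - 1"
  define z where "z = Complex (ln F.R + 2) (Im a)"
  have Rea: "Re a = ln (norm y)" using y0 by (simp add: a_def)
  have ea: "exp a = y" using y0 by (simp add: a_def)
  have daz: "dist a z = ln (norm y) - ln F.R - 2"
  proof -
    have "a - z = of_real (ln (norm y) - ln F.R - 2)" by (simp add: z_def complex_eq_iff Rea)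
    hence "norm (a - z) = \<bar>ln (norm y) - ln F.R - 2\<bar>" by (simp only: norm_of_real)
    thus ?thesis using T by (simp add: dist_norm)
  qed
  have "u (vector [0, exp a]) * (\<rho> - dist a z) \<le> (\<rho> + dist a z) * u (vector [0, exp z])"
  proof (rule harnack_u[of UNIV])
    show "hol2 UNIV (\<lambda>t. vector [0, exp t])" by (auto simp: hol2_def intro!: holomorphic_intros)
    fix t assume "t \<in> cball a \<rho>"
    hence "norm (a - t) \<le> \<rho>" by (simp add: dist_norm)
    hence "Re a - Re t \<le> \<rho>" using complex_Re_le_cmod[of "a - t"] by simp
    hence "Re t \<ge> ln F.R" using Rea by (simp add: \<rho>_def)
    hence "exp (Re t) \<ge> F.R" using R1 by (metis exp_le_cancel_iff exp_ln less_trans zero_less_one)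
    thus "vector [0, exp t] \<in> F.Vp" by (simp add: F.Vp_def)
  qed (use daz \<rho>_def in auto)
  hence "u (vector [0, y]) \<le> (\<rho> + dist a z) * u (vector [0, exp z])" by (simp add: ea daz \<rho>_def)
  also have "\<dots> \<le> (2 * ln (norm y)) * B"
  proof (rule mult_mono)
    have "norm (exp z) = F.R * exp 2" using R1 by (simp add: z_def exp_add)
    thus "u (vector [0, exp z]) \<le> B" by (rule B)
    show "\<rho> + dist a z \<le> 2 * ln (norm y)" using lR by (simp add: daz \<rho>_def)
    show "0 \<le> 2 * ln (norm y)" using T lR by simp
  qed (rule u_nonneg)
  finally show ?thesis by simp
qed

text \<open>Pull \<open>z\<close> forward to w = f^n(z), where \<open>horizontal\<close> and
  \<open>vertical\<close> give u(w) \<le> 3 * 2 B ln |w|, and divide by dg^n. The constants depend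
  neither on \<open>z\<close> nor on \<open>n\<close>.\<close>

lemma main_estimate:
  obtains A C where "A \<ge> 0" "C \<ge> 0"
    "\<And>z. F.escapes z \<Longrightarrow> \<exists>n0. \<forall>n\<ge>n0. u z \<le> A * (real df / real dg) ^ n * (logp z + C)"
proof -
  obtain C1 where C1: "C1 \<ge> 0" "\<And>w. H.G w \<le> logp w + C1" using H.G_upper by blast
  obtain B' where B': "\<And>z. supn z \<le> F.R * exp 2 \<Longrightarrow> supn (\<phi> z) \<le> B'"
    using supn_bounded_image[of \<phi> "F.R * exp 2"] hol(1) unfolding hol_map_def by metis
  define B where "B = ln (max 1 B') + C1"
  have B0: "B \<ge> 0" using C1(1) by (simp add: B_def)
  have B: "u (vector [0, y]) \<le> B" if "norm y = F.R * exp 2" for y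
  proof -
    have "supn (\<phi> (vector [0, y])) \<le> B'" by (rule B') (use that F.R in \<open>simp add: supn_def\<close>)
    hence "logp (\<phi> (vector [0, y])) \<le> ln (max 1 B')" unfolding logp_def by (intro ln_mono) auto
    thus ?thesis using C1(2)[of "\<phi> (vector [0, y])"] by (simp add: u_def B_def)
  qed
  obtain C where C: "C \<ge> 0" "\<And>n z. logp ((f ^^ n) z) \<le> real df ^ n * (logp z + C)"
    using F.logp_iterate by blast
  have "\<exists>n0. \<forall>n\<ge>n0. u z \<le> 6 * B * (real df / real dg) ^ n * (logp z + C)" if esc: "F.escapes z" for z
  proof -
    obtain k where k: "(f ^^ k) z \<in> F.Vp" using esc by (auto simp: F.escapes_def)
    have yk: "norm ((f ^^ k) z $ 2) \<ge> 1" using k F.R by (simp add: F.Vp_def)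
    obtain m where m: "F.R * exp 3 < 2 ^ m" using real_arch_pow[of 2 "F.R * exp 3"] by auto
    \<comment> \<open>\<open>k\<close> steps lead into \<open>Vp\<close>, \<open>m\<close> steps
      bring the second coordinate above R exp 3, and one more step ensures that the first coordinate
      is at most a quarter of the second.\<close>
    have "u z \<le> 6 * B * (real df / real dg) ^ n * (logp z + C)" if n: "n \<ge> k + m + 1" for n
    proof -
      define w where "w = (f ^^ n) z"
      define j where "j = n - k - 1"
      have nj: "n = Suc j + k" "m \<le> j" using n by (auto simp: j_def)
      have w1: "w = f ((f ^^ j) ((f ^^ k) z))" by (simp add: w_def nj funpow_add)
      have vj: "(f ^^ j) ((f ^^ k) z) \<in> F.Vp" by (rule F.Vp_iterate[OF k])
      have w: "w \<in> F.Vp" "norm (w $ 1) \<le> norm (w $ 2) / 4"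
        unfolding w1 using F.Vp_invariant(1)[OF vj] F.Vp_step(3)[OF vj] by auto
      have "(2 :: real) ^ m \<le> 2 ^ j" by (rule power_increasing[OF nj(2)]) simp
      hence "F.R * exp 3 \<le> 2 ^ j" using m by linarith
      also have "2 ^ j \<le> 2 ^ j * norm ((f ^^ k) z $ 2)" using mult_left_mono[OF yk, of "2 ^ j"] by simp
      also have "\<dots> \<le> norm ((f ^^ j) ((f ^^ k) z) $ 2)" by (rule F.Vp_iterate_growth[OF k])
      also have "\<dots> \<le> 2 * norm ((f ^^ j) ((f ^^ k) z) $ 2)" by simp
      also have "\<dots> \<le> norm (w $ 2)" unfolding w1 by (rule F.Vp_step(2)[OF vj])
      finally have wy: "norm (w $ 2) \<ge> F.R * exp 3" .
      have "real dg ^ n * u z = u w" by (simp add: w_def u_iterate)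
      also have "u w \<le> 3 * u (vector [0, w $ 2])" by (rule horizontal[OF w])
      also have "u (vector [0, w $ 2]) \<le> 2 * ln (norm (w $ 2)) * B" by (rule vertical[OF B wy])
      also have "ln (norm (w $ 2)) = logp w" using F.Vp_logp[OF w(1)] by simp
      also have "logp w \<le> real df ^ n * (logp z + C)" unfolding w_def by (rule C(2))
      finally have "real dg ^ n * u z \<le> 3 * (2 * (real df ^ n * (logp z + C)) * B)"
        using B0 by (simp add: mult_right_mono)
      hence "u z \<le> 3 * (2 * (real df ^ n * (logp z + C)) * B) / real dg ^ n"
        using H.d by (simp add: le_divide_eq mult.commute)
      thus ?thesis by (simp add: power_divide mult_ac)
    qed
    thus ?thesis by blast
  qed
  thus ?thesis using that[of "6 * B" C] B0 C(1) by simp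
qed

text \<open>If dg > df, the bound of \<open>main_estimate\<close> tends to 0, although
  \<open>u\<close> is positive at escaping points.\<close>

lemma degree_le: "dg \<le> df"
proof (rule ccontr)
  assume "\<not> dg \<le> df"
  hence q: "real df / real dg < 1" "0 \<le> real df / real dg" by auto
  obtain A C where AC: "A \<ge> 0" "C \<ge> 0"
    "\<And>z. F.escapes z \<Longrightarrow> \<exists>n0. \<forall>n\<ge>n0. u z \<le> A * (real df / real dg) ^ n * (logp z + C)"
    using main_estimate by blast
  define z :: "complex ^ 2" where "z = vector [0, of_real F.R]"
  have esc: "F.escapes z" using F.R by (intro Vp_escapes) (simp add: F.Vp_def z_def)
  obtain n0 where n0: "\<And>n. n \<ge> n0 \<Longrightarrow> u z \<le> A * (real df / real dg) ^ n * (logp z + C)" using AC(3)[OF esc] by blast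
  have "(\<lambda>n. A * (real df / real dg) ^ n * (logp z + C)) \<longlonglongrightarrow> A * 0 * (logp z + C)"
    using q by (intro tendsto_intros LIMSEQ_power_zero) simp
  hence "u z \<le> A * 0 * (logp z + C)" using n0 by (intro LIMSEQ_le_const) auto
  moreover have "u z > 0" unfolding u_def by (intro H.G_pos escapes_image esc)
  ultimately show False by simp
qed

lemma sym: "henon_conjugacy g ginv dg dg' cg cg' Mg f finv df df' cf cf' Mf \<phi>inv \<phi>"
proof unfold_locales
  show "\<phi>inv (g z) = f (\<phi>inv z)" for z using conj[of "\<phi>inv z"] \<phi>inv1 \<phi>inv2 by metis
qed (fact hol \<phi>inv1 \<phi>inv2)+

text \<open>The degrees are equal by symmetry, so the factor (df/dg)^n is 1. On \<open>H.Vp\<close>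
  the function \<open>H.G\<close> differs from \<open>logp\<close> by a bounded amount, so the bound
  on \<open>u\<close> is one on \<phi>.\<close>

theorem growth_plus: "\<exists>A C. A \<ge> 0 \<and> C \<ge> 0 \<and> (\<forall>z. \<phi> z \<in> H.Vp \<longrightarrow> logp (\<phi> z) \<le> A * logp z + C)"
proof -
  interpret sym: henon_conjugacy g ginv dg dg' cg cg' Mg f finv df df' cf cf' Mf \<phi>inv \<phi> by (rule sym)
  have dd: "dg = df" using degree_le sym.degree_le by simp
  obtain A C where AC: "A \<ge> 0" "C \<ge> 0"
    "\<And>z. F.escapes z \<Longrightarrow> \<exists>n0. \<forall>n\<ge>n0. u z \<le> A * (real df / real dg) ^ n * (logp z + C)"
    using main_estimate by blast
  have "logp (\<phi> z) \<le> A * logp z + (A * C + H.Cg)" if "\<phi> z \<in> H.Vp" for z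
  proof -
    have "F.escapes z" using sym.escapes_image[OF sym.Vp_escapes[OF that]] by (simp add: \<phi>inv1)
    then obtain n0 where "u z \<le> A * (real df / real dg) ^ n0 * (logp z + C)" using AC(3) by blast
    hence "u z \<le> A * (logp z + C)" using F.d by (simp add: dd)
    moreover have "logp (\<phi> z) \<le> u z + H.Cg" using H.G_Vp[OF that] unfolding u_def by linarith
    ultimately show ?thesis by (simp add: algebra_simps)
  qed
  moreover have "A * C + H.Cg \<ge> 0" using AC(1,2) by (simp add: H.Cg_def le_max_iff_disj)
  ultimately show ?thesis using AC(1) by blast
qed

end

definition swap :: "complex ^ 2 \<Rightarrow> complex ^ 2" where "swap z = vector [z $ 2, z $ 1]"

lemma swap_simps [simp]: "swap z $ 1 = z $ 2" "swap z $ 2 = z $ 1" "swap (swap z) = z" "supn (swap z) = supn z"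
  by (simp_all add: swap_def supn_def max.commute vec2_eqI)

lemma logp_swap [simp]: "logp (swap z) = logp z" by (simp add: logp_def)

lemma swap_defined: "defined_over UNIV swap"
proof -
  have eq: "swap = polymap biY biX" by (intro ext vec2_eqI) (simp_all del: One_nat_def)
  show ?thesis unfolding eq by (intro defined_over_polymap bipoly_over_UNIV)
qed

text \<open>After exchanging the axes the inverse is again attracted to [0:1:0], so forward
  estimates also serve for the inverse.\<close>

lemma henon_swap:
  assumes "henon f finv d d' c c' M"
  shows "henon (\<lambda>z. swap (finv (swap z))) (\<lambda>z. swap (f (swap z))) d' d c' c M"
proof -
  interpret henon f finv d d' c c' M by (rule assms)
  have "defined_over UNIV (swap \<circ> (F \<circ> swap))" if "defined_over UNIV F" for F
    by (intro defined_over_comp cfield_UNIV swap_defined that)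
  hence p: "defined_over UNIV (\<lambda>z. swap (F (swap z)))" if "defined_over UNIV F" for F
    using that by (simp add: o_def)
  show ?thesis
    by unfold_locales (use inv1 inv2 p poly d c M f1[of "swap _"] f2[of "swap _"] i1[of "swap _"] i2[of "swap _"] in auto)
qed

text \<open>The value \<phi>(z) is in \<open>Vp\<close> of \<open>g\<close>, in \<open>Vm\<close>,
  or smaller than \<open>R\<close>. The first case is \<open>growth_plus\<close>, the second is
  \<open>growth_plus\<close> for the inverses with exchanged axes.\<close>

theorem henon_conjugacy_polynomial:
  assumes f: "henon f finv df df' cf cf' Mf" and g: "henon g ginv dg dg' cg cg' Mg"
    and hol: "hol_map \<phi>" "hol_map \<phi>inv" and inv: "\<And>z. \<phi>inv (\<phi> z) = z" "\<And>z. \<phi> (\<phi>inv z) = z"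
    and conj: "\<And>z. \<phi> (f z) = g (\<phi> z)"
  shows "defined_over UNIV \<phi>"
proof -
  interpret P: henon_conjugacy f finv df df' cf cf' Mf g ginv dg dg' cg cg' Mg \<phi> \<phi>inv
    using f g hol inv conj by (simp add: henon_conjugacy_def henon_conjugacy_axioms_def)
  define s where "s F z = swap (F (swap z))" for F z
  have hs: "hol_map (s F)" if "hol_map F" for F
  proof -
    have "hol_map (swap \<circ> (F \<circ> swap))" by (intro hol_map_comp hol_map_polymap swap_defined that)
    thus ?thesis by (simp add: o_def s_def[abs_def])
  qed
  have "finv (\<phi>inv z) = \<phi>inv (ginv z)" for z
    using conj[of "finv (\<phi>inv z)"] P.F.inv2 P.H.inv1 inv by metis
  hence conj': "\<phi> (finv z) = ginv (\<phi> z)" for z using inv by metis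
  interpret N: henon_conjugacy "s finv" "s f" df' df cf' cf Mf "s ginv" "s g" dg' dg cg' cg Mg "s \<phi>" "s \<phi>inv"
    using henon_swap[OF f] henon_swap[OF g] hs[OF hol(1)] hs[OF hol(2)] inv conj'
    by (simp add: henon_conjugacy_def henon_conjugacy_axioms_def s_def[abs_def])
  obtain A C where AC: "A \<ge> 0" "C \<ge> 0" "\<And>z. \<phi> z \<in> P.H.Vp \<Longrightarrow> logp (\<phi> z) \<le> A * logp z + C"
    using P.growth_plus by blast
  obtain A' C' where AC': "A' \<ge> 0" "C' \<ge> 0" "\<And>z. s \<phi> z \<in> N.H.Vp \<Longrightarrow> logp (s \<phi> z) \<le> A' * logp z + C'"
    using N.growth_plus by blast
  \<comment> \<open>\<open>R\<close> is symmetric in \<open>c\<close> and \<open>c'\<close>, so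
    \<open>Vm\<close> of \<open>g\<close> is exactly the exchanged image of \<open>Vp\<close> of the
    swapped inverse.\<close>
  have RR: "N.H.R = P.H.R" unfolding N.H.R_def P.H.R_def by (simp add: insert_commute)
  define k where "k = nat \<lceil>A + A'\<rceil>"
  define D where "D = C + C' + ln P.H.R"
  have lnR: "ln P.H.R \<ge> 0" using P.H.R by simp
  have Ak: "A + A' \<le> real k" by (simp add: k_def) linarith
  have bound: "logp (\<phi> z) \<le> k * logp z + D" for z
  proof -
    have ge: "A * logp z \<le> k * logp z" "A' * logp z \<le> k * logp z" "0 \<le> k * logp z"
      using Ak AC(1) AC'(1) by (auto intro!: mult_right_mono)
    consider "\<phi> z \<in> P.H.Vp" | "\<phi> z \<in> P.H.Vm" | "supn (\<phi> z) < P.H.R" using P.H.not_Vp_cases by blast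
    thus ?thesis
    proof cases
      case 1
      thus ?thesis using AC(3)[OF 1] ge AC'(2) lnR unfolding D_def by linarith
    next
      case 2
      have "s \<phi> (swap z) \<in> N.H.Vp" using 2 by (simp add: N.H.Vp_def P.H.Vm_def RR s_def)
      from AC'(3)[OF this] have "logp (\<phi> z) \<le> A' * logp z + C'" by (simp add: s_def)
      thus ?thesis using ge AC(2) lnR unfolding D_def by linarith
    next
      case 3
      have "logp (\<phi> z) \<le> ln P.H.R" unfolding logp_def using 3 P.H.R by (intro ln_mono) auto
      thus ?thesis using ge AC(2) AC'(2) unfolding D_def by linarith
    qed
  qed
  have growth: "supn (\<phi> z) \<le> exp D * (1 + supn z) ^ k" for z
  proof -
    have "supn (\<phi> z) \<le> exp (logp (\<phi> z))" by (simp add: logp_def)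
    also have "\<dots> \<le> exp (k * logp z + D)" using bound[of z] by simp
    also have "\<dots> = exp D * exp (logp z) ^ k" by (simp add: exp_add exp_of_nat_mult)
    also have "exp (logp z) = max 1 (supn z)" by (simp add: logp_def)
    also have "exp D * max 1 (supn z) ^ k \<le> exp D * (1 + supn z) ^ k"
      using supn_ge(3)[of z] by (intro mult_left_mono power_mono) auto
    finally show ?thesis .
  qed
  have "\<exists>P. (\<lambda>z. \<phi> z $ i) = bieval P" if i: "i = 1 \<or> i = 2" for i
  proof -
    have sl: "(\<lambda>t. \<phi> (\<gamma> t) $ i) holomorphic_on UNIV" if "hol2 UNIV \<gamma>" for \<gamma>
    proof -
      have "hol2 UNIV (\<lambda>t. \<phi> (\<gamma> t))" using hol(1) that unfolding hol_map_def by blast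
      thus ?thesis using i by (auto simp: hol2_def)
    qed
    obtain P where "(\<lambda>z. \<phi> z $ i) = bieval P"
    proof (rule polynomial_growth_imp_polynomial[of "\<lambda>z. \<phi> z $ i" "exp D" k])
      show "(\<lambda>x. \<phi> (vector [x, y]) $ i) holomorphic_on UNIV" for y
        by (rule sl) (auto simp: hol2_def intro!: holomorphic_intros)
      show "(\<lambda>y. \<phi> (vector [x, y]) $ i) holomorphic_on UNIV" for x
        by (rule sl) (auto simp: hol2_def intro!: holomorphic_intros)
      show "norm (\<phi> z $ i) \<le> exp D * (1 + supn z) ^ k" for z
        using growth[of z] supn_ge[of "\<phi> z"] i by auto
    qed blast
    thus ?thesis by blast
  qed
  then obtain P Q where PQ: "(\<lambda>z. \<phi> z $ 1) = bieval P" "(\<lambda>z. \<phi> z $ 2) = bieval Q" by metis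
  have "\<phi> = polymap P Q" using fun_cong[OF PQ(1)] fun_cong[OF PQ(2)] by (intro ext vec2_eqI) auto
  thus ?thesis by (simp add: defined_over_polymap)
qed

section \<open>Algebraic extensions by roots\<close>

lemma complex_ring_simps [simp]:
  "carrier complex_ring = UNIV" "monoid.mult complex_ring x y = x * y" "monoid.one complex_ring = 1"
  "ring.zero complex_ring = 0" "ring.add complex_ring x y = x + y"
  by (simp_all add: ring_of_type_algebra_def)

lemma complex_ring_inv:
  shows complex_ring_a_inv: "a_inv complex_ring x = - x"
    and complex_ring_m_inv: "x \<noteq> 0 \<Longrightarrow> m_inv complex_ring x = inverse x"
    and complex_ring_pow: "x [^]\<^bsub>complex_ring\<^esub> (n :: nat) = x ^ n"
proof -
  interpret R: Ring.field complex_ring by (rule field_from_type_algebra)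
  show "a_inv complex_ring x = - x" using R.minus_equality[of "- x" x] by simp
  show "x \<noteq> 0 \<Longrightarrow> m_inv complex_ring x = inverse x" using R.inv_char[of x "inverse x"] by simp
  show "x [^]\<^bsub>complex_ring\<^esub> (n :: nat) = x ^ n" by (induction n) (simp_all add: mult.commute)
qed

lemma subfield_imp_cfield:
  assumes "subfield K complex_ring" shows "cfield K"
proof -
  interpret R: Ring.field complex_ring by (rule field_from_type_algebra)
  note K = subringE[OF subfieldE(1)[OF assms]]
  have "inverse a \<in> K" if "a \<in> K" for a
    using R.subfield_m_inv(1)[OF assms, of a] that K(2) complex_ring_m_inv[of a] by (cases "a = 0") auto
  thus ?thesis unfolding cfield_def using K(2,3,5,6,7) by (auto simp: complex_ring_a_inv)
qed

lemma root_algebraic: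
  assumes K: "subfield K complex_ring" and m: "m \<ge> 1" "x ^ m \<in> K"
  shows "ring.algebraic complex_ring K x"
proof -
  interpret R: Ring.field complex_ring by (rule field_from_type_algebra)
  have cK: "cfield K" by (rule subfield_imp_cfield[OF K])
  \<comment> \<open>The coefficients of X^m - x^m, leading one first.\<close>
  define p where "p = 1 # replicate (m - 1) 0 @ [- (x ^ m)]"
  have e: "R.eval (replicate j 0 @ [b]) x = b" for j b
    by (induction j) (simp_all add: complex_ring_pow)
  have "R.eval p x = 0" using m(1) by (simp add: p_def e complex_ring_pow)
  moreover have "p \<in> carrier (K[X]\<^bsub>complex_ring\<^esub>)"
    using cK m(2) unfolding p_def univ_poly_def polynomial_def
    by (auto simp: cfield_0 cfield_1 cfield_minus)
  ultimately have "(R.algebraic over K) x" using R.algebraicI[of p K x] by (auto simp: p_def)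
  thus ?thesis by (simp add: over_def)
qed

lemma root_extension:
  assumes K: "subfield K complex_ring" and m: "m \<ge> 1" "\<alpha> ^ m \<in> K" and n: "n \<ge> 1" "\<gamma> ^ n \<in> K"
  obtains L where "finite_extension K L" "cfield L" "K \<subseteq> L" "\<alpha> \<in> L" "\<gamma> \<in> L" "L \<subseteq> alg_closure_in_C K"
proof -
  interpret R: Ring.field complex_ring by (rule field_from_type_algebra)
  define L where "L = R.finite_extension K [\<alpha>, \<gamma>]"
  have alg: "(R.algebraic over K) x" if "x \<in> set [\<alpha>, \<gamma>]" for x
    using that root_algebraic[OF K m] root_algebraic[OF K n] by (auto simp: over_def)
  have c: "set [\<alpha>, \<gamma>] \<subseteq> carrier complex_ring" by simp
  have L: "subfield L complex_ring" unfolding L_def by (rule R.finite_extension_is_subfield[OF K c alg])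
  have fd: "R.finite_dimension K L" unfolding L_def by (rule R.finite_extension_finite_dimension(1)[OF K c alg])
  have KL: "K \<subseteq> L" unfolding L_def by (rule R.finite_extension_incl[OF subfieldE(3)[OF K] c])
  have mem: "set [\<alpha>, \<gamma>] \<subseteq> L" unfolding L_def by (rule R.finite_extension_mem[OF subfieldE(1)[OF K] c])
  have "L \<subseteq> alg_closure_in_C K"
    using R.finite_dimension_imp_algebraic[OF K subfieldE(1)[OF L] fd] by (auto simp: alg_closure_in_C_def over_def)
  moreover have "finite_extension K L" using L KL fd by (simp add: finite_extension_def)
  ultimately show ?thesis using that[of L] subfield_imp_cfield[OF L] KL mem by simp
qed

section \<open>Affine conjugacies between normal forms\<close>

abbreviation axis1 :: "complex ^ 2" where "axis1 \<equiv> vector [1, 0]"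
abbreviation axis2 :: "complex ^ 2" where "axis2 \<equiv> vector [0, 1]"

definition normal :: "(complex ^ 2 \<Rightarrow> complex ^ 2) \<Rightarrow> bool" where
  "normal F \<longleftrightarrow> XD F axis2 \<and> XD (inv F) axis1"

text \<open>By \<open>XDL_inv\<close> the linear form of \<open>F\<close> vanishes on
  \<open>axis1\<close>, so the leading part is a multiple of y^d in the second component only. Its
  factor is a coefficient of \<open>Q\<close>, hence in \<open>K\<close>.\<close>

lemma normal_form:
  assumes K: "cfield K" and F: "F \<in> Aut_A2 K" "normal F"
  obtains P Q c where "F = polymap P Q" "P \<in> bipoly_over K" "Q \<in> bipoly_over K"
    "total_degree P < map_degree F" "total_degree (Q - bimonom c 0 (map_degree F)) < map_degree F"
    "c \<in> K" "c \<noteq> 0"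
proof -
  obtain P Q where P: "P \<in> bipoly_over K" "Q \<in> bipoly_over K" "F = polymap P Q"
    using aut_defined[OF F(1)] by (rule defined_overE)
  define d where "d = map_degree F"
  obtain c l where X: "XDL F d c l axis2" unfolding d_def using F(2) by (auto simp: normal_def elim: XDE)
  have d2: "d \<ge> 2" using X by (simp add: XDL_def)
  have "lf l axis1 = 0"
    using XDL_inv[OF aut_UNIV[OF F(1)] X] F(2) by (simp add: normal_def)
  hence l1: "l $ 1 = 0" by (simp add: lf_def)
  hence l2: "l $ 2 \<noteq> 0" using X vec2_nonzeroD[of l] by (auto simp: XDL_def)
  have PQd: "total_degree P \<le> d" "total_degree Q \<le> d" by (auto simp: d_def P(3) map_degree_polymap)
  have "topf d F (\<lambda>z. vector [hcf d P z, hcf d Q z])" unfolding topf_def P(3) using PQd by blast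
  from topf_unique[OF this] X have "(\<lambda>z. vector [hcf d P z, hcf d Q z]) = (\<lambda>z. (c * lf l z ^ d) *s axis2)"
    by (simp add: XDL_def)
  from fun_cong[OF this] have top: "vector [hcf d P z, hcf d Q z] = (c * lf l z ^ d) *s axis2" for z .
  have hP: "hcf d P z = 0" for z using arg_cong[OF top[of z], where f = "\<lambda>v. v $ 1"] by simp
  have hQ: "hcf d Q z = c * (l $ 2 * z $ 2) ^ d" for z
    using arg_cong[OF top[of z], where f = "\<lambda>v. v $ 2"] l1 by (simp add: lf_def)
  define C where "C = c * (l $ 2) ^ d"
  have C0: "C \<noteq> 0" using X l2 by (simp add: C_def XDL_def)
  have hM: "hcf d (bimonom C 0 d) z = C * z $ 2 ^ d" for z
  proof -
    have "((\<lambda>t. bieval (bimonom C 0 d) (t *s z) / t ^ d) \<longlongrightarrow> hcf d (bimonom C 0 d) z) at_infinity"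
      by (rule hcf_limit_line) (use total_degree_bimonom_le[of C 0 d] in simp)
    moreover have "((\<lambda>t. bieval (bimonom C 0 d) (t *s z) / t ^ d) \<longlongrightarrow> C * z $ 2 ^ d) at_infinity"
    proof (rule Lim_transform_eventually[OF tendsto_const])
      have "eventually (\<lambda>t :: complex. t \<noteq> 0) at_infinity" by (rule eventually_not_equal_at_infinity)
      thus "eventually (\<lambda>t. C * z $ 2 ^ d = bieval (bimonom C 0 d) (t *s z) / t ^ d) at_infinity"
        by eventually_elim (simp add: power_mult_distrib)
    qed
    ultimately show ?thesis using tendsto_unique[OF trivial_limit_at_infinity] by blast
  qed
  have dP: "total_degree P < d" using hcf_eq_0_iff[OF PQd(1)] hP d2 by auto
  have "total_degree (Q - bimonom C 0 d) \<le> d"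
    using PQd(2) total_degree_bimonom_le[of C 0 d] by (intro total_degree_diff_le) auto
  moreover have "hcf d (Q - bimonom C 0 d) z = 0" for z
    by (simp only: hcf_diff hQ hM) (simp add: C_def power_mult_distrib)
  ultimately have dQ: "total_degree (Q - bimonom C 0 d) < d" using hcf_eq_0_iff[of "Q - bimonom C 0 d" d] d2 by auto
  have "bicoeff (Q - bimonom C 0 d) 0 d = 0"
    using dQ total_degree_le_iff[of "Q - bimonom C 0 d" "total_degree (Q - bimonom C 0 d)"] by fastforce
  hence "C = bicoeff Q 0 d" by simp
  hence "C \<in> K" using P(2) by (simp add: bipoly_over_iff)
  thus ?thesis using that[OF P(3,1,2)] dP dQ C0 by (simp add: d_def)
qed

section \<open>Exchange of the axes, and the growth estimates of normal maps\<close>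

lemma swap_aut: "cfield K \<Longrightarrow> swap \<in> Aut_A2 K"
proof -
  assume K: "cfield K"
  have "swap = affmap 0 1 0 1 0 0" by (intro ext vec2_eqI) simp_all
  thus ?thesis using affmap_aut(1)[OF K, of 0 1 0 1 0 0] K by (simp add: cfield_0 cfield_1)
qed

lemma swap_affine: "map_degree swap \<le> 1" and lin_swap: "lin swap z = swap z"
proof -
  have s: "swap = affmap 0 1 0 1 0 0" by (intro ext vec2_eqI) simp_all
  show "map_degree swap \<le> 1" unfolding s by (rule affmap_degree)
  show "lin swap z = swap z" unfolding s lin_affmap by simp
qed

definition flip :: "(complex ^ 2 \<Rightarrow> complex ^ 2) \<Rightarrow> complex ^ 2 \<Rightarrow> complex ^ 2" where
  "flip F = swap \<circ> F \<circ> swap"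

lemma flip_apply: "flip F z = swap (F (swap z))" by (simp add: flip_def)

lemma flip_aut: "cfield K \<Longrightarrow> F \<in> Aut_A2 K \<Longrightarrow> flip F \<in> Aut_A2 K"
  unfolding flip_def by (intro aut_comp swap_aut)

lemma inv_flip: "F \<in> Aut_A2 K \<Longrightarrow> inv (flip F) = flip (inv F)"
  by (rule inv_equality) (simp_all add: flip_apply aut_inv_eq)

lemma XD_flip: "XD F v \<Longrightarrow> XD (flip F) (swap v)"
proof -
  assume "XD F v"
  note s = swap_aut[OF cfield_UNIV] swap_affine
  have "XD (swap \<circ> (F \<circ> swap)) (lin swap v)" by (intro XD_aff_left(1) XD_aff_right(1) s \<open>XD F v\<close>)
  thus ?thesis by (simp add: flip_def o_assoc lin_swap)
qed

lemma normal_flip_inv: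
  assumes "F \<in> Aut_A2 K" "normal F" shows "normal (flip (inv F))"
proof -
  have "swap axis1 = axis2" "swap axis2 = axis1" by (simp_all add: swap_def)
  thus ?thesis using assms XD_flip[of "inv F" axis1] XD_flip[of F axis2]
    by (simp add: normal_def inv_flip[OF aut_inv[OF assms(1)]] aut_inv_inv[OF assms(1)])
qed

text \<open>The estimates for the inverse are those of the normal map \<open>flip (inv F)\<close>,
  read after exchanging the coordinates.\<close>

lemma normal_imp_henon:
  assumes F: "F \<in> Aut_A2 UNIV" "normal F"
  shows "\<exists>d d' c c' M. henon F (inv F) d d' c c' M"
proof -
  have one: "\<exists>d c M. d \<ge> 2 \<and> c \<noteq> 0 \<and> M \<ge> 0 \<and> (\<forall>z. supn z \<ge> 1 \<longrightarrow>
      norm (F z $ 1) \<le> M * supn z ^ (d - 1) \<and> norm (F z $ 2 - c * z $ 2 ^ d) \<le> M * supn z ^ (d - 1))"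
    if F: "F \<in> Aut_A2 UNIV" "normal F" for F
  proof -
    obtain P Q c where P: "F = polymap P Q"
      "total_degree P < map_degree F" "total_degree (Q - bimonom c 0 (map_degree F)) < map_degree F" "c \<noteq> 0"
      using normal_form[OF cfield_UNIV F] by metis
    define d where "d = map_degree F"
    have d: "d \<ge> 2" unfolding d_def using F(2) XD_degree by (auto simp: normal_def)
    obtain M1 where M1: "M1 \<ge> 0" "\<And>z. supn z \<ge> 1 \<Longrightarrow> total_degree P \<le> d - 1 \<Longrightarrow> norm (bieval P z) \<le> M1 * supn z ^ (d - 1)"
      using total_degree_growth[of P "d - 1"] by metis
    obtain M2 where M2: "M2 \<ge> 0" "\<And>z. supn z \<ge> 1 \<Longrightarrow> total_degree (Q - bimonom c 0 d) \<le> d - 1 \<Longrightarrow>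
        norm (bieval (Q - bimonom c 0 d) z) \<le> M2 * supn z ^ (d - 1)"
      using total_degree_growth[of "Q - bimonom c 0 d" "d - 1"] by metis
    have "norm (F z $ 1) \<le> max M1 M2 * supn z ^ (d - 1) \<and> norm (F z $ 2 - c * z $ 2 ^ d) \<le> max M1 M2 * supn z ^ (d - 1)"
      if z: "supn z \<ge> 1" for z
    proof
      have s: "0 \<le> supn z ^ (d - 1)" using z by simp
      have "norm (F z $ 1) \<le> M1 * supn z ^ (d - 1)" using M1(2)[OF z] P(2) by (simp add: P(1) d_def)
      also have "\<dots> \<le> max M1 M2 * supn z ^ (d - 1)" using s by (intro mult_right_mono) auto
      finally show "norm (F z $ 1) \<le> max M1 M2 * supn z ^ (d - 1)" .
      have "norm (F z $ 2 - c * z $ 2 ^ d) \<le> M2 * supn z ^ (d - 1)" using M2(2)[OF z] P(3) by (simp add: P(1) d_def)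
      also have "\<dots> \<le> max M1 M2 * supn z ^ (d - 1)" using s by (intro mult_right_mono) auto
      finally show "norm (F z $ 2 - c * z $ 2 ^ d) \<le> max M1 M2 * supn z ^ (d - 1)" .
    qed
    thus ?thesis using d P(4) M1(1) by (intro exI[of _ d] exI[of _ c] exI[of _ "max M1 M2"]) auto
  qed
  obtain d c M where A: "d \<ge> 2" "c \<noteq> 0" "M \<ge> 0" "\<And>z. supn z \<ge> 1 \<Longrightarrow> norm (F z $ 1) \<le> M * supn z ^ (d - 1)"
    "\<And>z. supn z \<ge> 1 \<Longrightarrow> norm (F z $ 2 - c * z $ 2 ^ d) \<le> M * supn z ^ (d - 1)"
    using one[OF F] by blast
  obtain d' c' M' where B: "d' \<ge> 2" "c' \<noteq> 0" "M' \<ge> 0"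
    "\<And>z. supn z \<ge> 1 \<Longrightarrow> norm (flip (inv F) z $ 1) \<le> M' * supn z ^ (d' - 1)"
    "\<And>z. supn z \<ge> 1 \<Longrightarrow> norm (flip (inv F) z $ 2 - c' * z $ 2 ^ d') \<le> M' * supn z ^ (d' - 1)"
    using one[OF flip_aut[OF cfield_UNIV aut_inv[OF F(1)]] normal_flip_inv[OF F]] by blast
  have up: "x \<le> max M M' * supn z ^ e" if "x \<le> N * supn z ^ e" "N = M \<or> N = M'" "supn z \<ge> 1" for x N z e
  proof -
    have "N * supn z ^ e \<le> max M M' * supn z ^ e" using that(2,3) by (intro mult_right_mono) auto
    thus ?thesis using that(1) by linarith
  qed
  have "henon F (inv F) d d' c c' (max M M')"
  proof unfold_locales
    show "norm (inv F z $ 2) \<le> max M M' * supn z ^ (d' - 1)" if "1 \<le> supn z" for z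
      using up[OF B(4)[of "swap z"]] that by (simp add: flip_apply)
    show "norm (inv F z $ 1 - c' * z $ 1 ^ d') \<le> max M M' * supn z ^ (d' - 1)" if "1 \<le> supn z" for z
      using up[OF B(5)[of "swap z"]] that by (simp add: flip_apply)
    show "norm (F z $ 1) \<le> max M M' * supn z ^ (d - 1)" if "1 \<le> supn z" for z using up[OF A(4)[OF that]] that by blast
    show "norm (F z $ 2 - c * z $ 2 ^ d) \<le> max M M' * supn z ^ (d - 1)" if "1 \<le> supn z" for z
      using up[OF A(5)[OF that]] that by blast
  qed (use A B F aut_inv_eq[OF F(1)] aut_defined[OF F(1)] aut_defined[OF aut_inv[OF F(1)]] in auto)
  thus ?thesis by blast
qed

definition slice :: "complex \<Rightarrow> complex poly poly \<Rightarrow> complex poly" where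
  "slice a Q = map_poly (\<lambda>p. poly p a) Q"

lemma poly_slice: "poly (slice a Q) y = bieval Q (vector [a, y])"
proof (induction Q)
  case (pCons p Q)
  have "slice a (pCons p Q) = pCons (poly p a) (slice a Q)" by (simp add: slice_def map_poly_pCons)
  thus ?case using pCons by (simp add: bieval_def)
qed (simp add: slice_def bieval_def)

lemma coeff_slice: "Polynomial.coeff (slice a Q) j = poly (Polynomial.coeff Q j) a"
  by (simp add: slice_def coeff_map_poly)

lemma poly_const_if:
  assumes "\<And>i. i \<ge> 1 \<Longrightarrow> Polynomial.coeff p i = 0" shows "poly p a = Polynomial.coeff p 0"
proof -
  have "p = [:Polynomial.coeff p 0:]"
    by (rule poly_eqI) (use assms in \<open>auto simp: coeff_pCons split: nat.splits\<close>)
  thus ?thesis by (metis poly_pCons mult_zero_right poly_0 add_0_right)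
qed

text \<open>A monomial x^i y^j with i \<ge> 1 and j \<ge> d - 1 has degree at least \<open>d\<close>
  and is excluded. So the two top coefficients in y do not depend on the abscissa
  \<open>a\<close>.\<close>

lemma slice_coeffs:
  assumes "total_degree (Q - bimonom c 0 d) < d" "d \<ge> 2"
  shows "Polynomial.coeff (slice a Q) d = c" "Polynomial.coeff (slice a Q) (d - 1) = bicoeff Q 0 (d - 1)"
    "Polynomial.degree (slice a Q) \<le> d"
proof -
  have z: "bicoeff Q i j = (if i = 0 \<and> j = d then c else 0)" if "i + j \<ge> d" for i j
  proof -
    have "bicoeff (Q - bimonom c 0 d) i j = 0"
      using assms(1) that total_degree_le_iff[of "Q - bimonom c 0 d" "total_degree (Q - bimonom c 0 d)"] by fastforce
    thus ?thesis by auto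
  qed
  have p: "poly (Polynomial.coeff Q j) a = bicoeff Q 0 j" if "j \<ge> d - 1" for j
    using poly_const_if[of "Polynomial.coeff Q j" a] z[of _ j] that by (fastforce simp: bicoeff_def)
  show "Polynomial.coeff (slice a Q) d = c" using p[of d] z[of 0 d] by (simp add: coeff_slice)
  show "Polynomial.coeff (slice a Q) (d - 1) = bicoeff Q 0 (d - 1)" using p[of "d - 1"] by (simp add: coeff_slice)
  show "Polynomial.degree (slice a Q) \<le> d"
    by (rule degree_le) (use p z in \<open>auto simp: coeff_slice\<close>)
qed

lemma pcompose_linear_coeffs:
  fixes p :: "complex poly"
  assumes "Polynomial.degree p \<le> d" "d \<ge> 1"
  shows "Polynomial.coeff (pcompose p [:b, g:]) d = Polynomial.coeff p d * g ^ d"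
    "Polynomial.coeff (pcompose p [:b, g:]) (d - 1) =
       Polynomial.coeff p d * of_nat d * g ^ (d - 1) * b + Polynomial.coeff p (d - 1) * g ^ (d - 1)"
proof -
  have pw: "pcompose (Polynomial.monom c n) q = Polynomial.smult c (q ^ n)" for c n and q :: "complex poly"
    by (rule poly_eq_poly_eq_iff[THEN iffD1]) (simp add: fun_eq_iff poly_pcompose poly_monom poly_power)
  have "p = (\<Sum>i\<le>d. Polynomial.monom (Polynomial.coeff p i) i)"
    using poly_as_sum_of_monoms'[OF assms(1)] by simp
  hence "pcompose p [:b, g:] = (\<Sum>i\<le>d. Polynomial.smult (Polynomial.coeff p i) ([:b, g:] ^ i))"
    by (metis (no_types, lifting) pcompose_sum pw sum.cong)
  hence c: "Polynomial.coeff (pcompose p [:b, g:]) k = (\<Sum>i\<le>d. Polynomial.coeff p i * Polynomial.coeff ([:b, g:] ^ i) k)" for k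
    by (simp add: coeff_sum)
  have hi: "Polynomial.coeff ([:b, g:] ^ i) k = 0" if "i < k" for i k
  proof (rule coeff_eq_0)
    have "Polynomial.degree ([:b, g:] ^ i) \<le> Polynomial.degree [:b, g:] * i" by (rule degree_power_le)
    also have "\<dots> \<le> 1 * i" by (intro mult_le_mono1) simp
    finally show "Polynomial.degree ([:b, g:] ^ i) < k" using that by simp
  qed
  obtain e where e: "d = Suc e" using assms(2) by (cases d) auto
  have "Polynomial.coeff (pcompose p [:b, g:]) d = (\<Sum>i\<le>d. if i = d then Polynomial.coeff p d * g ^ d else 0)"
    unfolding c using hi[of _ d] coeff_linear_poly_power[of d d b g] by (intro sum.cong refl) auto
  thus "Polynomial.coeff (pcompose p [:b, g:]) d = Polynomial.coeff p d * g ^ d" by (simp add: sum.delta)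
  have "Polynomial.coeff (pcompose p [:b, g:]) e =
      (\<Sum>i\<le>e. Polynomial.coeff p i * Polynomial.coeff ([:b, g:] ^ i) e) + Polynomial.coeff p d * Polynomial.coeff ([:b, g:] ^ d) e"
    unfolding c e by simp
  also have "(\<Sum>i\<le>e. Polynomial.coeff p i * Polynomial.coeff ([:b, g:] ^ i) e) = (\<Sum>i\<le>e. if i = e then Polynomial.coeff p e * g ^ e else 0)"
    using hi[of _ e] coeff_linear_poly_power[of e e b g] by (intro sum.cong refl) auto
  also have "\<dots> = Polynomial.coeff p e * g ^ e" by (simp add: sum.delta)
  also have "Polynomial.coeff ([:b, g:] ^ d) e = of_nat d * g ^ e * b"
    using coeff_linear_poly_power[of e d b g] e by simp
  finally show "Polynomial.coeff (pcompose p [:b, g:]) (d - 1) =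
       Polynomial.coeff p d * of_nat d * g ^ (d - 1) * b + Polynomial.coeff p (d - 1) * g ^ (d - 1)"
    by (simp add: e algebra_simps)
qed

text \<open>Compare coefficients of y^d and y^(d-1) in the second component. The first gives
  \<gamma>^(d-1) = c / c'; the second is linear in \<delta> with coefficient c' d \<gamma>^(d-1),
  nonzero in characteristic 0. The unknown \<beta> only shifts the slice, which leaves these
  coefficients unchanged.\<close>

lemma affine_conjugacy_coeffs:
  assumes K: "cfield K" and F: "F \<in> Aut_A2 K" "normal F" and G: "G \<in> Aut_A2 K" "normal G"
    and deg: "map_degree F = map_degree G"
    and conj: "\<And>z. affmap \<alpha> 0 \<beta> 0 \<gamma> \<delta> (F z) = G (affmap \<alpha> 0 \<beta> 0 \<gamma> \<delta> z)" and \<gamma>: "\<gamma> \<noteq> 0"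
  shows "\<gamma> ^ (map_degree F - 1) \<in> K" "\<And>L. cfield L \<Longrightarrow> K \<subseteq> L \<Longrightarrow> \<gamma> \<in> L \<Longrightarrow> \<delta> \<in> L"
proof -
  define d where "d = map_degree F"
  have d2: "d \<ge> 2" unfolding d_def using F(2) XD_degree by (auto simp: normal_def)
  obtain P Q c where P: "F = polymap P Q" "Q \<in> bipoly_over K" "total_degree (Q - bimonom c 0 d) < d" "c \<in> K" "c \<noteq> 0"
    using normal_form[OF K F] unfolding d_def by metis
  obtain P' Q' c' where P': "G = polymap P' Q'" "Q' \<in> bipoly_over K" "total_degree (Q' - bimonom c' 0 d) < d" "c' \<in> K" "c' \<noteq> 0"
    using normal_form[OF K G] unfolding d_def deg by metis
  let ?q = "slice 0 Q" and ?q' = "slice \<beta> Q'"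
  have "\<gamma> * bieval Q z + \<delta> = bieval Q' (affmap \<alpha> 0 \<beta> 0 \<gamma> \<delta> z)" for z
    using arg_cong[OF conj[of z], where f = "\<lambda>v. v $ 2"] by (simp add: P(1) P'(1))
  hence ev: "\<gamma> * poly ?q y + \<delta> = poly ?q' (\<gamma> * y + \<delta>)" for y
    by (simp add: poly_slice affmap_def)
  have eq: "Polynomial.smult \<gamma> ?q + [:\<delta>:] = pcompose ?q' [:\<delta>, \<gamma>:]"
    by (rule poly_eq_poly_eq_iff[THEN iffD1]) (simp add: fun_eq_iff poly_pcompose ev add.commute[of \<delta>] mult.commute[of _ \<gamma>])
  note s = slice_coeffs[OF P(3) d2, of 0] and s' = slice_coeffs[OF P'(3) d2, of \<beta>]
  have d1: "d \<ge> 1" using d2 by simp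
  note pc = pcompose_linear_coeffs[OF s'(3) d1, of \<delta> \<gamma>]
  obtain e where e: "d = Suc (Suc e)" using d2 by (metis Suc_le_D numeral_2_eq_2 Suc_le_mono)
  have 1: "\<gamma> * c = c' * \<gamma> ^ d"
    using arg_cong[OF eq, where f = "\<lambda>p. Polynomial.coeff p d"] pc(1) s(1) s'(1) by (simp add: e)
  have 2: "\<gamma> * bicoeff Q 0 (d - 1) = c' * of_nat d * \<gamma> ^ (d - 1) * \<delta> + bicoeff Q' 0 (d - 1) * \<gamma> ^ (d - 1)"
    using arg_cong[OF eq, where f = "\<lambda>p. Polynomial.coeff p (d - 1)"] pc(2) s(2) s'(1,2) by (simp add: e)
  have "\<gamma> * c = \<gamma> * (c' * \<gamma> ^ (d - 1))" using 1 by (simp add: e)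
  hence "c = c' * \<gamma> ^ (d - 1)" using \<gamma> by simp
  hence "\<gamma> ^ (d - 1) = c / c'" using P'(5) by simp
  thus "\<gamma> ^ (map_degree F - 1) \<in> K" using cfield_divide[OF K P(4) P'(4)] by (simp add: d_def)
  fix L assume L: "cfield L" "K \<subseteq> L" "\<gamma> \<in> L"
  have nz: "c' * of_nat d * \<gamma> ^ (d - 1) \<noteq> 0" using P'(5) \<gamma> d2 by simp
  have "\<delta> = (\<gamma> * bicoeff Q 0 (d - 1) - bicoeff Q' 0 (d - 1) * \<gamma> ^ (d - 1)) / (c' * of_nat d * \<gamma> ^ (d - 1))"
    using 2 nz by (simp add: eq_divide_eq algebra_simps)
  moreover have "bicoeff Q 0 (d - 1) \<in> L" "bicoeff Q' 0 (d - 1) \<in> L" "c' \<in> L"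
    using L(2) P(2) P'(2,4) by (auto simp: bipoly_over_iff)
  ultimately show "\<delta> \<in> L"
    using L by (metis cfield_divide cfield_diff cfield_mult cfield_power cfield_of_nat)
qed

section \<open>Loxodromic automorphisms\<close>

lemma not_loxodromic_if_bounded:
  assumes f: "f \<in> Aut_A2 UNIV" and B: "\<And>n. map_degree (f ^^ n) \<le> B"
  shows "\<not> loxodromic f"
proof -
  have one: "map_degree (f ^^ n) \<ge> 1" for n by (rule aut_degree_pos[OF aut_power[OF cfield_UNIV f]])
  have B1: "B \<ge> 1" using one[of 0] B[of 0] by linarith
  have "(\<lambda>n. root n (real (map_degree (f ^^ n)))) \<longlonglongrightarrow> 1"
  proof (rule tendsto_sandwich[OF _ _ tendsto_const LIMSEQ_root_const])
    show "eventually (\<lambda>n. 1 \<le> root n (real (map_degree (f ^^ n)))) sequentially"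
      using eventually_gt_at_top[of 0] by eventually_elim (use one in \<open>simp add: real_root_ge_1_iff\<close>)
    show "eventually (\<lambda>n. root n (real (map_degree (f ^^ n))) \<le> root n (real B)) sequentially"
      using eventually_gt_at_top[of 0] by eventually_elim (use B in \<open>simp add: real_root_le_iff\<close>)
    show "0 < real B" using B1 by simp
  qed
  hence "dynamical_degree f = 1" unfolding dynamical_degree_def by (rule limI)
  thus ?thesis by (simp add: loxodromic_def)
qed

lemma axes_map:
  assumes K: "cfield K" and v: "in_K2 K v" "in_K2 K v'" "cross v v' \<noteq> 0"
  obtains N where "N \<in> Aut_A2 K" "map_degree N \<le> 1" "lin (inv N) v = axis2" "lin (inv N) v' = axis1"
proof -
  define N where "N = affmap (v' $ 1) (v $ 1) 0 (v' $ 2) (v $ 2) 0"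
  have "v' $ 1 * v $ 2 - v $ 1 * v' $ 2 \<noteq> 0" using v(3) by (simp add: cross_def algebra_simps)
  hence N: "N \<in> Aut_A2 K" unfolding N_def
    using K v(1,2) by (intro affmap_aut) (auto simp: in_K2_def cfield_0)
  have "N axis2 = v" "N axis1 = v'" "N 0 = 0" unfolding N_def by (intro vec2_eqI; simp)+
  hence "inv N v = axis2" "inv N v' = axis1" "inv N 0 = 0" using aut_inv_eq(1)[OF N] by metis+
  hence "lin (inv N) v = axis2" "lin (inv N) v' = axis1" by (simp_all add: lin_def)
  thus ?thesis using that[OF N] affmap_degree unfolding N_def by blast
qed

text \<open>Both directions of \<open>g\<close> are \<open>K\<close>-rational, so the linear map
  that takes the axes to them is defined over \<open>K\<close>.\<close>

lemma regular_imp_normal: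
  assumes K: "cfield K" and g: "g \<in> Aut_A2 K" "regular g"
  obtains N where "N \<in> Aut_A2 K" "map_degree N \<le> 1" "normal (inv N \<circ> g \<circ> N)"
    "map_degree (inv N \<circ> g \<circ> N) = map_degree g"
proof -
  have gU: "g \<in> Aut_A2 UNIV" by (rule aut_UNIV[OF g(1)])
  have d: "map_degree g \<ge> 2" "map_degree (inv g) \<ge> 2" using g(2) XD_degree by (auto simp: regular_def)
  obtain v where v: "in_K2 K v" "XD g v" using XD_exists[OF K gU aut_defined[OF g(1)] d(1)] by metis
  obtain v' where v': "in_K2 K v'" "XD (inv g) v'"
    using XD_exists[OF K aut_inv[OF gU] aut_defined[OF aut_inv[OF g(1)]] d(2)] by metis
  obtain N where N: "N \<in> Aut_A2 K" "map_degree N \<le> 1" "lin (inv N) v = axis2" "lin (inv N) v' = axis1"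
    using axes_map[OF K v(1) v'(1) regular_cross[OF g(2) v(2) v'(2)]] by metis
  have NU: "N \<in> Aut_A2 UNIV" by (rule aut_UNIV[OF N(1)])
  have iN: "inv N \<in> Aut_A2 UNIV" "map_degree (inv N) \<le> 1" using aut_inv[OF NU] affine_inv[OF NU N(2)] by auto
  have X: "XD (inv N \<circ> k \<circ> N) (lin (inv N) w)" "map_degree (inv N \<circ> k \<circ> N) = map_degree k" if "XD k w" for k w
  proof -
    have r: "XD (k \<circ> N) w" "map_degree (k \<circ> N) = map_degree k" by (rule XD_aff_right[OF NU N(2) that])+
    show "XD (inv N \<circ> k \<circ> N) (lin (inv N) w)" using XD_aff_left(1)[OF iN r(1)] by (simp add: o_assoc)
    show "map_degree (inv N \<circ> k \<circ> N) = map_degree k" using XD_aff_left(2)[OF iN r(1)] r(2) by (simp add: o_assoc)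
  qed
  have "inv (inv N \<circ> g \<circ> N) = inv N \<circ> inv g \<circ> N"
    by (rule inv_equality) (simp_all add: aut_inv_eq[OF NU] aut_inv_eq[OF gU])
  hence "normal (inv N \<circ> g \<circ> N)" using X(1)[OF v(2)] X(1)[OF v'(2)] N(3,4) by (simp add: normal_def)
  thus ?thesis using that[OF N(1,2)] X(2)[OF v(2)] by blast
qed

lemma loxodromic_normalization:
  assumes K: "cfield K" and f: "loxodromic f" "defined_over K f"
  obtains h f0 where "h \<in> Aut_A2 K" "f0 \<in> Aut_A2 K" "f = h \<circ> f0 \<circ> inv h" "normal f0"
    "map_degree h * map_degree f0 \<le> map_degree f"
proof -
  have fU: "f \<in> Aut_A2 UNIV" using f(1) by (simp add: loxodromic_def)
  have fK: "f \<in> Aut_A2 K" by (rule aut_over[OF K fU f(2)])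
  have "\<not> (\<exists>B. \<forall>n. map_degree (f ^^ n) \<le> B)" using not_loxodromic_if_bounded[OF fU] f(1) by blast
  then obtain h f1 where h: "h \<in> Aut_A2 K" "f1 \<in> Aut_A2 K" "f = h \<circ> f1 \<circ> inv h" "regular f1"
    "map_degree h * map_degree f1 \<le> map_degree f" using conjugate_to_regular[OF K fK] by blast
  obtain N where N: "N \<in> Aut_A2 K" "map_degree N \<le> 1" "normal (inv N \<circ> f1 \<circ> N)"
    "map_degree (inv N \<circ> f1 \<circ> N) = map_degree f1" using regular_imp_normal[OF K h(2,4)] by metis
  have "h \<circ> N \<in> Aut_A2 K" "inv N \<circ> f1 \<circ> N \<in> Aut_A2 K" by (intro aut_comp aut_inv K h N)+
  moreover have "f = (h \<circ> N) \<circ> (inv N \<circ> f1 \<circ> N) \<circ> inv (h \<circ> N)"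
    unfolding aut_inv_comp[OF h(1) N(1)] h(3) by (simp add: fun_eq_iff aut_inv_eq[OF N(1)])
  moreover have "map_degree (h \<circ> N) \<le> map_degree h"
  proof -
    have "map_degree (h \<circ> N) \<le> map_degree h * map_degree N"
      by (intro aut_comp_degree_le aut_UNIV[OF h(1)] aut_UNIV[OF N(1)])
    also have "\<dots> \<le> map_degree h * 1" by (intro mult_le_mono2 N(2))
    finally show ?thesis by simp
  qed
  hence "map_degree (h \<circ> N) * map_degree (inv N \<circ> f1 \<circ> N) \<le> map_degree f"
    using h(5) unfolding N(4) by (meson le_trans mult_le_mono1)
  ultimately show ?thesis using that N(3) by blast
qed

lemma normal_conjugacy_polynomial:
  assumes f: "f \<in> Aut_A2 UNIV" "normal f" and g: "g \<in> Aut_A2 UNIV" "normal g"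
    and hol: "hol_map \<phi>" "hol_map \<phi>inv" and inv: "\<And>z. \<phi>inv (\<phi> z) = z" "\<And>z. \<phi> (\<phi>inv z) = z"
    and conj: "\<And>z. \<phi> (f z) = g (\<phi> z)"
  shows "\<phi> \<in> Aut_A2 UNIV"
proof -
  obtain df df' cf cf' Mf where hf: "henon f (inv f) df df' cf cf' Mf" using normal_imp_henon[OF f] by blast
  obtain dg dg' cg cg' Mg where hg: "henon g (inv g) dg dg' cg cg' Mg" using normal_imp_henon[OF g] by blast
  have conj': "\<phi>inv (g z) = f (\<phi>inv z)" for z using conj[of "\<phi>inv z"] inv by metis
  have "defined_over UNIV \<phi>" by (rule henon_conjugacy_polynomial[OF hf hg hol inv conj])
  moreover have "defined_over UNIV \<phi>inv"
    by (rule henon_conjugacy_polynomial[OF hg hf hol(2,1) inv(2,1) conj'])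
  ultimately show ?thesis using inv by (intro autI(1))
qed

lemma cross_axes: "cross axis2 w = 0 \<longleftrightarrow> w $ 1 = 0" "cross axis1 w = 0 \<longleftrightarrow> w $ 2 = 0"
  by (simp_all add: cross_def)

text \<open>After moving the parts of the conjugacy over \<open>K\<close> to the side of
  \<open>g\<close>, an affine map \<open>b\<close> conjugates two normal maps over \<open>K\<close>.
  It preserves both axis directions, so its linear part is diagonal, and its four coefficients are
  found by comparing leading coefficients.\<close>

lemma regular_conjugacy_field:
  assumes K: "subfield K complex_ring" and f: "f \<in> Aut_A2 K" "normal f" and g: "g \<in> Aut_A2 K" "normal g"
    and \<phi>: "\<phi> \<in> Aut_A2 UNIV" "\<phi> \<circ> f = g \<circ> \<phi>"
  obtains L \<psi> where "finite_extension K L" "cfield L" "K \<subseteq> L" "L \<subseteq> alg_closure_in_C K"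
    "\<phi> \<in> Aut_A2 L" "\<psi> \<in> Aut_A2 L" "\<psi> \<circ> f = g \<circ> \<psi>" "map_degree \<psi> \<le> map_degree g"
proof -
  have cK: "cfield K" by (rule subfield_imp_cfield[OF K])
  have ax: "cross axis2 axis1 \<noteq> 0" by (simp add: cross_def)
  have reg: "regular f" "regular g" using f(2) g(2) ax unfolding normal_def regular_def by blast+
  obtain \<theta> \<psi> where \<theta>: "\<theta> \<in> Aut_A2 K" "\<psi> \<in> Aut_A2 UNIV" "\<phi> = \<theta> \<circ> \<psi>" "\<psi> \<circ> f = g \<circ> \<psi>" "affine_factor K \<psi>"
    "map_degree \<psi> \<le> map_degree g" using conjugacy_of_regular[OF cK g(1) reg(2,1) \<phi>] by blast
  obtain \<eta> a where a: "\<eta> \<in> Aut_A2 K" "a \<in> Aut_A2 UNIV" "map_degree a \<le> 1" "\<psi> = \<eta> \<circ> a"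
    using \<theta>(5) unfolding affine_factor_def by blast
  define k where "k = inv \<eta> \<circ> g \<circ> \<eta>"
  have k: "k \<in> Aut_A2 K" unfolding k_def by (intro aut_comp aut_inv cK g a)
  have ia: "inv a \<in> Aut_A2 UNIV" "map_degree (inv a) \<le> 1" using aut_inv[OF a(2)] affine_inv[OF a(2,3)] by auto
  have \<psi>z: "\<eta> (a (f z)) = g (\<eta> (a z))" for z using fun_cong[OF \<theta>(4), of z] by (simp add: a(4))
  have af: "a (f z) = k (a z)" for z using \<psi>z[of z] by (metis aut_inv_eq(1)[OF a(1)] comp_apply k_def)
  have ka: "k = a \<circ> f \<circ> inv a" using af by (simp add: fun_eq_iff aut_inv_eq[OF a(2)])
  have ika: "inv k = a \<circ> inv f \<circ> inv a" unfolding ka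
    by (rule inv_equality) (simp_all add: aut_inv_eq[OF a(2)] aut_inv_eq[OF f(1)])
  have XX: "XD (a \<circ> F \<circ> inv a) (lin a w)" if "XD F w" for F w
    using XD_aff_left(1)[OF a(2,3) XD_aff_right(1)[OF ia that]] by (simp add: o_assoc)
  have Xk: "XD k (lin a axis2)" "XD (inv k) (lin a axis1)"
    using XX f(2) unfolding normal_def ika by (auto simp: ka)
  have "cross (lin a axis2) (lin a axis1) \<noteq> 0" using lin_cross[OF a(2,3), of axis2 axis1] by (simp add: cross_def)
  hence regk: "regular k" using Xk unfolding regular_def by blast
  obtain N where N: "N \<in> Aut_A2 K" "map_degree N \<le> 1" "normal (inv N \<circ> k \<circ> N)"
    "map_degree (inv N \<circ> k \<circ> N) = map_degree k" using regular_imp_normal[OF cK k regk] by metis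
  have NU: "N \<in> Aut_A2 UNIV" by (rule aut_UNIV[OF N(1)])
  have iN: "inv N \<in> Aut_A2 UNIV" "map_degree (inv N) \<le> 1" using aut_inv[OF NU] affine_inv[OF NU N(2)] by auto
  define g1 where "g1 = inv N \<circ> k \<circ> N"
  have g1: "g1 \<in> Aut_A2 K" unfolding g1_def by (intro aut_comp aut_inv cK N k)
  define b where "b = inv N \<circ> a"
  have b: "b \<in> Aut_A2 UNIV" unfolding b_def by (intro aut_comp cfield_UNIV iN a)
  have "map_degree b \<le> map_degree (inv N) * map_degree a" unfolding b_def by (intro aut_comp_degree_le iN a)
  also have "\<dots> \<le> 1 * 1" by (intro mult_le_mono iN a)
  finally have b1: "map_degree b \<le> 1" by simp
  have bf: "b (f z) = g1 (b z)" for z by (simp add: b_def g1_def af aut_inv_eq[OF NU])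
  have ib: "inv b \<in> Aut_A2 UNIV" "map_degree (inv b) \<le> 1" using aut_inv[OF b] affine_inv[OF b b1] by auto
  have g1b: "g1 = b \<circ> f \<circ> inv b" using bf by (simp add: fun_eq_iff aut_inv_eq[OF b])
  have ig1b: "inv g1 = b \<circ> inv f \<circ> inv b" unfolding g1b
    by (rule inv_equality) (simp_all add: aut_inv_eq[OF b] aut_inv_eq[OF f(1)])
  have XXb: "XD (b \<circ> F \<circ> inv b) (lin b w)" if "XD F w" for F w
    using XD_aff_left(1)[OF b b1 XD_aff_right(1)[OF ib that]] by (simp add: o_assoc)
  have Xg1: "XD g1 (lin b axis2)" "XD (inv g1) (lin b axis1)"
    using XXb f(2) unfolding normal_def ig1b by (auto simp: g1b)
  have ng1: "normal g1" using N(3) by (simp add: g1_def)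
  have "cross axis2 (lin b axis2) = 0" "cross axis1 (lin b axis1) = 0"
    using XD_unique Xg1 ng1 unfolding normal_def by blast+
  hence lb: "lin b axis2 $ 1 = 0" "lin b axis1 $ 2 = 0" by (simp_all add: cross_axes)
  obtain \<alpha> q \<beta> r \<gamma> \<delta> where bq: "b = affmap \<alpha> q \<beta> r \<gamma> \<delta>" using affmapE[OF aut_defined[OF b] b1] by metis
  have "q = 0" "r = 0" using lb unfolding bq lin_affmap by simp_all
  hence bb: "b = affmap \<alpha> 0 \<beta> 0 \<gamma> \<delta>" using bq by simp
  have det: "\<alpha> * \<gamma> - 0 * 0 \<noteq> 0" using affmap_inj_det bij_is_inj[OF aut_bij[OF b]] unfolding bb by blast
  hence nz: "\<alpha> \<noteq> 0" "\<gamma> \<noteq> 0" by auto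
  have degs: "map_degree f = map_degree g1"
  proof -
    have "XD f axis2" using f(2) by (simp add: normal_def)
    thus ?thesis unfolding g1b using XD_aff_right(2)[OF ib] XD_aff_left(2)[OF b b1 XD_aff_right(1)[OF ib]]
      by (simp add: o_assoc)
  qed
  note c1 = affine_conjugacy_coeffs[OF cK f g1 ng1 degs bf[unfolded bb] nz(2)]
  \<comment> \<open>\<open>\<gamma>\<close> and \<open>\<delta>\<close> come from the second
    component of \<open>f\<close>. The inverse maps with exchanged axes are normal too and give
    \<open>\<alpha>\<close> and \<open>\<beta>\<close> in the same way.\<close>
  have ff: "flip (inv f) \<in> Aut_A2 K" "normal (flip (inv f))" "flip (inv g1) \<in> Aut_A2 K" "normal (flip (inv g1))"
    using flip_aut[OF cK aut_inv[OF f(1)]] flip_aut[OF cK aut_inv[OF g1]] normal_flip_inv[OF f] normal_flip_inv[OF g1 ng1] by auto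
  have bif: "b (inv f z) = inv g1 (b z)" for z
  proof -
    have "g1 (b (inv f z)) = b z" using bf[of "inv f z"] by (simp add: aut_inv_eq[OF f(1)])
    thus ?thesis by (metis aut_inv_eq(1)[OF g1])
  qed
  have swb: "affmap \<gamma> 0 \<delta> 0 \<alpha> \<beta> z = swap (b (swap z))" for z
    unfolding bb by (rule vec2_eqI) simp_all
  have cf: "affmap \<gamma> 0 \<delta> 0 \<alpha> \<beta> (flip (inv f) z) = flip (inv g1) (affmap \<gamma> 0 \<delta> 0 \<alpha> \<beta> z)" for z
    unfolding swb by (simp add: flip_apply bif)
  have XF: "XD (flip (inv f)) axis2" using ff(2) by (simp add: normal_def)
  have degs': "map_degree (flip (inv f)) = map_degree (flip (inv g1))"
  proof -
    have "map_degree (flip (inv F)) = map_degree F" if F: "F \<in> Aut_A2 UNIV" "normal F" for F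
    proof -
      have "XD (inv F) axis1" using F(2) by (simp add: normal_def)
      note s = swap_aut[OF cfield_UNIV] swap_affine
      have "map_degree (swap \<circ> (inv F \<circ> swap)) = map_degree (inv F)"
        using XD_aff_left(2)[OF s XD_aff_right(1)[OF s \<open>XD (inv F) axis1\<close>]] XD_aff_right(2)[OF s \<open>XD (inv F) axis1\<close>] by simp
      thus ?thesis using map_degree_inv[OF F(1)] by (simp add: flip_def o_assoc)
    qed
    thus ?thesis using aut_UNIV f g1 ng1 degs by metis
  qed
  note c2 = affine_conjugacy_coeffs[OF cK ff degs' cf nz(1)]
  have pos: "map_degree f - 1 \<ge> 1" "map_degree (flip (inv f)) - 1 \<ge> 1"
    using XD_degree[OF XF] XD_degree[of f axis2] f(2) unfolding normal_def by auto
  obtain L where L: "finite_extension K L" "cfield L" "K \<subseteq> L" "\<alpha> \<in> L" "\<gamma> \<in> L" "L \<subseteq> alg_closure_in_C K"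
    using root_extension[OF K pos(2) c2(1) pos(1) c1(1)] by metis
  have "\<delta> \<in> L" "\<beta> \<in> L" using c1(2)[OF L(2,3,5)] c2(2)[OF L(2,3,4)] by auto
  hence bL: "b \<in> Aut_A2 L" unfolding bb using L det by (intro affmap_aut(1)) (auto simp: cfield_0)
  have "a = N \<circ> b" by (simp add: b_def fun_eq_iff aut_inv_eq[OF NU])
  hence aL: "a \<in> Aut_A2 L" using aut_comp[OF L(2) aut_mono[OF L(3) N(1)] bL] by simp
  have \<psi>L: "\<psi> \<in> Aut_A2 L" unfolding a(4) by (intro aut_comp L(2) aut_mono[OF L(3) a(1)] aL)
  have \<phi>L: "\<phi> \<in> Aut_A2 L" unfolding \<theta>(3) by (intro aut_comp L(2) aut_mono[OF L(3) \<theta>(1)] \<psi>L)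
  show ?thesis by (rule that[OF L(1,2,3,6) \<phi>L \<psi>L \<theta>(4,6)])
qed

theorem theoremA:
  fixes K :: "complex set" and f g \<phi> :: "complex ^ 2 \<Rightarrow> complex ^ 2"
  assumes "subfield K complex_ring"
    and "loxodromic f" and "defined_over K f"
    and "loxodromic g" and "defined_over K g"
    and "biholomorphism \<phi>" and "\<phi> \<circ> f \<circ> inv \<phi> = g"
  shows "\<phi> \<in> Aut_A2 UNIV \<and>
         (\<exists>L. finite_extension K L \<and> defined_over L \<phi>) \<and>
         (\<exists>\<psi>\<in>Aut_A2 (alg_closure_in_C K).
            \<psi> \<circ> f = g \<circ> \<psi> \<and> map_degree \<psi> \<le> 2 ^ 57 * (map_degree f * map_degree g) ^ 29)"
proof -
  have K: "cfield K" by (rule subfield_imp_cfield[OF assms(1)])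
  obtain h f0 where h: "h \<in> Aut_A2 K" "f0 \<in> Aut_A2 K" "f = h \<circ> f0 \<circ> inv h" "normal f0"
    "map_degree h * map_degree f0 \<le> map_degree f" using loxodromic_normalization[OF K assms(2,3)] by metis
  obtain k g0 where k: "k \<in> Aut_A2 K" "g0 \<in> Aut_A2 K" "g = k \<circ> g0 \<circ> inv k" "normal g0"
    "map_degree k * map_degree g0 \<le> map_degree g" using loxodromic_normalization[OF K assms(4,5)] by metis
  have U: "h \<in> Aut_A2 UNIV" "f0 \<in> Aut_A2 UNIV" "k \<in> Aut_A2 UNIV" "g0 \<in> Aut_A2 UNIV"
    using aut_UNIV h k by blast+
  have \<phi>: "bij \<phi>" "hol_map \<phi>" "hol_map (inv \<phi>)" using assms(6) hol_map_holomorphic by (auto simp: biholomorphism_def)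
  have \<phi>i: "inv \<phi> (\<phi> z) = z" "\<phi> (inv \<phi> z) = z" for z
    using \<phi>(1) by (simp_all add: bij_is_inj bij_is_surj surj_f_inv_f)
  have \<phi>f: "\<phi> (f z) = g (\<phi> z)" for z using fun_cong[OF assms(7), of "\<phi> z"] by (simp add: \<phi>i)
  \<comment> \<open>The biholomorphism transported to the normal maps \<open>f0\<close> and
    \<open>g0\<close>.\<close>
  define \<phi>0 where "\<phi>0 = inv k \<circ> \<phi> \<circ> h"
  have hm: "hol_map (inv k)" "hol_map h" "hol_map (inv h)" "hol_map k"
    by (intro hol_map_polymap aut_defined aut_inv U)+
  have \<phi>0: "\<phi>0 \<in> Aut_A2 UNIV"
  proof (rule normal_conjugacy_polynomial[OF U(2) h(4) U(4) k(4), where \<phi>inv = "inv h \<circ> inv \<phi> \<circ> k"])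
    show "hol_map \<phi>0" "hol_map (inv h \<circ> inv \<phi> \<circ> k)" unfolding \<phi>0_def by (intro hol_map_comp hm \<phi>)+
    show "(inv h \<circ> inv \<phi> \<circ> k) (\<phi>0 z) = z" "\<phi>0 ((inv h \<circ> inv \<phi> \<circ> k) z) = z" for z
      by (simp_all add: \<phi>0_def aut_inv_eq[OF U(1)] aut_inv_eq[OF U(3)] \<phi>i)
    fix z
    have "h (f0 z) = f (h z)" by (simp add: h(3) aut_inv_eq[OF U(1)])
    thus "\<phi>0 (f0 z) = g0 (\<phi>0 z)" by (simp add: \<phi>0_def \<phi>f) (simp add: k(3) aut_inv_eq[OF U(3)])
  qed
  have conj0: "\<phi>0 \<circ> f0 = g0 \<circ> \<phi>0"
  proof
    fix z
    have "h (f0 z) = f (h z)" by (simp add: h(3) aut_inv_eq[OF U(1)])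
    thus "(\<phi>0 \<circ> f0) z = (g0 \<circ> \<phi>0) z" by (simp add: \<phi>0_def \<phi>f) (simp add: k(3) aut_inv_eq[OF U(3)])
  qed
  obtain L \<psi>0 where L: "finite_extension K L" "cfield L" "K \<subseteq> L" "L \<subseteq> alg_closure_in_C K"
    "\<phi>0 \<in> Aut_A2 L" "\<psi>0 \<in> Aut_A2 L" "\<psi>0 \<circ> f0 = g0 \<circ> \<psi>0" "map_degree \<psi>0 \<le> map_degree g0"
    using regular_conjugacy_field[OF assms(1) h(2,4) k(2,4) \<phi>0 conj0] by metis
  have hkL: "inv h \<in> Aut_A2 L" "k \<in> Aut_A2 L" by (intro aut_mono[OF L(3)] aut_inv h k)+
  have "\<phi> = k \<circ> \<phi>0 \<circ> inv h" by (simp add: \<phi>0_def fun_eq_iff aut_inv_eq[OF U(1)] aut_inv_eq[OF U(3)])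
  hence \<phi>L: "\<phi> \<in> Aut_A2 L" using aut_comp[OF L(2) aut_comp[OF L(2) hkL(2) L(5)] hkL(1)] by simp
  define \<psi> where "\<psi> = k \<circ> \<psi>0 \<circ> inv h"
  have \<psi>L: "\<psi> \<in> Aut_A2 L" unfolding \<psi>_def by (intro aut_comp L hkL)
  have \<psi>0z: "\<psi>0 (f0 z) = g0 (\<psi>0 z)" for z using fun_cong[OF L(7), of z] by simp
  have \<psi>conj: "\<psi> \<circ> f = g \<circ> \<psi>"
    by (simp add: \<psi>_def h(3) k(3) fun_eq_iff aut_inv_eq[OF U(1)] aut_inv_eq[OF U(3)] \<psi>0z)
  have \<psi>0U: "\<psi>0 \<in> Aut_A2 UNIV" by (rule aut_UNIV[OF L(6)])
  have "map_degree \<psi> \<le> map_degree (k \<circ> \<psi>0) * map_degree (inv h)"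
    unfolding \<psi>_def by (intro aut_comp_degree_le aut_comp aut_inv cfield_UNIV U \<psi>0U)
  also have "\<dots> \<le> (map_degree k * map_degree \<psi>0) * map_degree h"
    unfolding map_degree_inv[OF U(1)] by (intro mult_le_mono1 aut_comp_degree_le U \<psi>0U)
  \<comment> \<open>Here deg \<psi>0 \<le> deg g0, and deg f0 \<ge> 1 is inserted to complete the
    products bounded by deg g and deg f.\<close>
  also have "\<dots> \<le> (map_degree k * map_degree g0) * (map_degree h * map_degree f0)"
    using L(8) aut_degree_pos[OF U(2)] by (intro mult_le_mono) auto
  also have "\<dots> \<le> map_degree g * map_degree f" by (intro mult_le_mono h k)
  \<comment> \<open>From deg f deg g on, the bound is only enlarged to the stated one.\<close>
  also have "\<dots> = (map_degree f * map_degree g) ^ 1" by (simp add: mult.commute)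
  also have "\<dots> \<le> (map_degree f * map_degree g) ^ 29"
  proof (rule power_increasing)
    have "f \<in> Aut_A2 UNIV" "g \<in> Aut_A2 UNIV" using assms(2,4) by (simp_all add: loxodromic_def)
    thus "1 \<le> map_degree f * map_degree g" using aut_degree_pos mult_le_mono[of 1 _ 1] by fastforce
  qed simp
  also have "\<dots> \<le> 2 ^ 57 * (map_degree f * map_degree g) ^ 29" by simp
  finally have "map_degree \<psi> \<le> 2 ^ 57 * (map_degree f * map_degree g) ^ 29" .
  thus ?thesis
    using aut_UNIV[OF \<phi>L] aut_defined[OF \<phi>L] L(1) aut_mono[OF L(4) \<psi>L] \<psi>conj by blast
qed

end
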